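(* Let $a_1\in(0,1)$ be fixed and let $(a,b)\in\Delta_{(0,1)}$ vary with $a=a_1a_2$, $b=b_1b_2$, $a_1<a_2<1$. Let $\rho_{(a,b)}=w_+f_++w_-f_-$ be the limiting probability density of $\boldsymbol X_t/t$ for the walk with parameters $(a_1,a_2)$ and normalized initial state $\Psi_0$. Then the 1D limit $\rho_{a_1}=\lim_{b\to0}\rho_{(a,b)}$ exists, and $$\rho_{a_1}(v)=w(v;a_1)\,f_{\mathrm K}(v;a_1).$$ That is, for every bounded continuous function $g$ on $\mathbb R^2$, $$\lim_{b_2\to0+}\int_{E_1\cap E_2}g(\boldsymbol v)\rho_{(a,b)}(\boldsymbol v)\,d\boldsymbol v=\int_{-a_1}^{a_1}g(v,v)\,w(v;a_1)f_{\mathrm K}(v;a_1)\,dv .$$ Here $f_{\mathrm K}(v;r)=\dfrac{\sqrt{1-r^2}}{\pi(1-v^2)\sqrt{r^2-v^2}}I_{(-r,r)}(v)$ is the Konno function ($I_S$ is the indicator function of $S$) and $$w(v;a_1)=\frac12\sum_{n\in\mathbb Z}\ \sum_{\star=\pm}\ \sum_{m=0,1}P^{(n)}_{\mathrm K,\star}\bigl(k_{\star,m}(v)\bigr).$$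
   Context: Model. $\mathcal H=\ell^2(\mathbb Z^2;\mathbb C^2)$, $\Psi=(\Psi^{(+)},\Psi^{(-)})^T$. For $j=1,2$: $(S_j\Psi)^{(\pm)}(\boldsymbol x)=\Psi^{(\pm)}(\boldsymbol x\pm\boldsymbol e_j)$ with $\boldsymbol e_j$ the standard basis; $C_j=\begin{pmatrix}a_j&b_j\\-b_j&a_j\end{pmatrix}$ (acting pointwise), $b_j=\sqrt{1-a_j^2}$; $U=S_2C_2S_1C_1$; $\Psi_t=U^t\Psi_0$; $P(\boldsymbol X_t=\boldsymbol x)=\|\Psi_t(\boldsymbol x)\|^2$. $\Delta_{(0,1)}=\{(a,b):a,b>0,\ a+b<1\}$. 1D limit. "$\rho_{(a,b)}$ has the 1D limit $\rho_{a_1}$ as $b\to0$" means exactly the displayed convergence for all bounded continuous $g$, where $a_1$ is fixed, $a_2=\sqrt{1-b_2^2}$ and $b_2\to0+$, and $\rho_{a_1}$ is a one-dimensional probability density. The density $\rho_{(a,b)}$. For $j=1,2$, $F_j(\boldsymbol v)=1-\frac{(v_1+v_2)^2}{4a_j^2}-\frac{(v_1-v_2)^2}{4b_j^2}$, $E_j=\{F_j\ge0\}$, $F_0(\boldsymbol v)=\frac{(a_1b_2)^2+(a_2b_1)^2}{2ab}\Bigl[1-\frac{(v_1+v_2)^2}{4a_0^2}-\frac{(v_1-v_2)^2}{4b_0^2}\Bigr]$, $a_0^2=\frac{(a_1b_2)^2+(a_2b_1)^2}{b_1^2+b_2^2}$, $b_0^2=\frac{(a_1b_2)^2+(a_2b_1)^2}{a_1^2+a_2^2}$,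 and $f_\pm=\frac{F_0\pm\sqrt{F_1F_2}}{2\pi^2(1-v_1^2)(1-v_2^2)\sqrt{F_1F_2}}I_{E_1\cap E_2}$. Let $\mathbb T=\mathbb R/2\pi\mathbb Z$, $\hat\Psi(\boldsymbol k)=\sum_{\boldsymbol x}e^{-i\boldsymbol k\cdot\boldsymbol x}\Psi(\boldsymbol x)$, $\hat U(\boldsymbol k)=D(k_2)C_2D(k_1)C_1$, $D(\kappa)=\mathrm{diag}(e^{i\kappa},e^{-i\kappa})$; $l_1=k_2+k_1$, $l_2=k_2-k_1$, $c_i=\cos l_i$, $s_i=\sin l_i$, $\tau=ac_1-bc_2$, $\omega=\arccos\tau$; $|\omega_\pm(\boldsymbol k)\rangle$ unit eigenvectors of $\hat U(\boldsymbol k)$ for $e^{\pm i\omega(\boldsymbol k)}$; $P_\pm(\boldsymbol k)=|\langle\omega_\pm(\boldsymbol k)|\hat\Psi_0(\boldsymbol k)\rangle|^2$; $\boldsymbol v(\boldsymbol k)=\bigl(-\frac{as_1+bs_2}{\sqrt{1-\tau^2}},-\frac{as_1-bs_2}{\sqrt{1-\tau^2}}\bigr)$. Weights, for $\bullet=\pm$: $w_\bullet(\boldsymbol v)=\frac14\sum_{\star=\pm}\sum_{\lambda\in\{0,1\}^2}P_\star(\boldsymbol k^\bullet_\lambda(\boldsymbol v))$, where the inverse branches are as follows. $K_n$ is the set of $\boldsymbol k=(\frac{l_1-l_2}2,\frac{l_1+l_2}2)$ with $(l_1,l_2)$ in: $K_1:[0,\pi]^2$; $K_2:[-\pi,0]\times[0,\pi]$;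 $K_3:[-\pi,0]^2$; $K_4:[0,\pi]\times[-\pi,0]$; $K_5:[-2\pi,-\pi]\times[0,\pi]$; $K_6:[-\pi,0]\times[-2\pi,-\pi]$; $K_7:[\pi,2\pi]\times[-\pi,0]$; $K_8:[0,\pi]\times[\pi,2\pi]$. With $\varphi(c_1,c_2)=abc_1^2+(1-a^2-b^2)c_1c_2+abc_2^2$ on $[-1,1]^2$: $C^{(1)}=\{\varphi\le0,c_1\le0\le c_2\}$, $C^{(3)}=\{\varphi\le0,c_2\le0\le c_1\}$, $C^{(2)}=\{\varphi\ge0,c_1+c_2\le0\}$, $C^{(4)}=\{\varphi\ge0,c_1+c_2\ge0\}$. For $(\mu,\nu,\xi)\in\{0,1\}^3$, $K_{(\mu,\nu,\xi)}$ is the set of $\boldsymbol k\in\bigcup_{n=1}^4K_{n+4\mu}$ with $(c_1,c_2)\in C^{(m)}$, $m=2(\nu+1)-\xi$; up to null sets $\boldsymbol v$ maps it bijectively onto $E_1\cap E_2$, and for $\lambda=(\mu,\nu)$, $\boldsymbol k^+_\lambda$, $\boldsymbol k^-_\lambda$ are the inverses of $\boldsymbol v$ restricted to $K_{(\mu,\nu,0)}$, $K_{(\mu,\nu,1)}$ respectively. One-dimensional objects. $\psi_0^{(n)}(m)=\Psi_0(m,n+m)$ for $n,m\in\mathbb Z$, with Fourier transform $\hat\psi_0^{(n)}(k)=\sum_me^{-ikm}\psi^{(n)}_0(m)$. $v_{\mathrm K}(k)=-\frac{a_1\sin k}{\sqrt{1-(a_1\cos k)^2}}$, $|\omega_{\mathrm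 K,\pm}(k)\rangle=\frac1{\sqrt2}\begin{pmatrix}e^{ik}\sqrt{1\mp v_{\mathrm K}(k)}\\ \pm i\sqrt{1\pm v_{\mathrm K}(k)}\end{pmatrix}$, $P^{(n)}_{\mathrm K,\star}(k)=|\langle\omega_{\mathrm K,\star}(k)|\hat\psi^{(n)}_0(k)\rangle|^2$, and $k_{\pm,m}(v)=m\pi+\arcsin\Bigl(\frac{\mp(-1)^mb_1v}{a_1\sqrt{1-v^2}}\Bigr)$ for $v\in[-a_1,a_1]$, $m=0,1$.
   Formalization: In the weights, P_⋆ is evaluated at k^•_λ(⋆v) instead of k^•_λ(v); with the formula as written the sum over ⋆ collapses to the norm of the transformed initial state, and the claim fails for the walk started at the origin in state (1,0). *)

theory Defs
  imports "HOL-Analysis.Analysis"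
begin

text \<open>
  Signs are encoded as the reals \<open>1\<close> and \<open>- 1\<close>.  Vectors of \<open>complex ^ 2\<close> have
  the \<open>(+)\<close> component at index \<open>1\<close> and the \<open>(-)\<close> component at index \<open>2\<close>.
  The walk parameters are \<open>a1\<close> and \<open>a2\<close>, with \<open>a = a1 * a2\<close> and
  \<open>b = sb a1 * sb a2\<close>.
\<close>

definition sb :: "real \<Rightarrow> real" where
  "sb c = sqrt (1 - c\<^sup>2)"

definition braket :: "complex ^ 2 \<Rightarrow> complex ^ 2 \<Rightarrow> complex" where
  "braket u w = (\<Sum>i\<in>UNIV. cnj (u $ i) * w $ i)"


subsection \<open>Fourier transforms of square-summable initial states\<close>

text \<open>
  For a general square-summable state the Fourier series converges, unconditionally, in
  the mean over one period.  The transform is therefore determined only up to null sets,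
  and a Borel measurable periodic representative is chosen.
\<close>

definition is_fourier2 :: "(int \<times> int \<Rightarrow> complex ^ 2) \<Rightarrow> (real \<times> real \<Rightarrow> complex ^ 2) \<Rightarrow> bool" where
  "is_fourier2 \<Psi> \<Phi> \<longleftrightarrow>
     \<Phi> \<in> borel_measurable borel \<and>
     (\<forall>k1 k2. \<Phi> (k1 + 2 * pi, k2) = \<Phi> (k1, k2) \<and> \<Phi> (k1, k2 + 2 * pi) = \<Phi> (k1, k2)) \<and>
     ((\<lambda>X. \<integral>\<^sup>+ k \<in> {- pi..pi} \<times> {- pi..pi}.
          ennreal ((norm (\<Phi> k - (\<Sum>x\<in>X. cis (- (fst k * of_int (fst x) + snd k * of_int (snd x))) *s \<Psi> x)))\<^sup>2)
        \<partial>lborel) \<longlongrightarrow> 0) (finite_subsets_at_top UNIV)"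

definition fourier2 :: "(int \<times> int \<Rightarrow> complex ^ 2) \<Rightarrow> real \<times> real \<Rightarrow> complex ^ 2" where
  "fourier2 \<Psi> = (SOME \<Phi>. is_fourier2 \<Psi> \<Phi>)"

definition is_fourier1 :: "(int \<Rightarrow> complex ^ 2) \<Rightarrow> (real \<Rightarrow> complex ^ 2) \<Rightarrow> bool" where
  "is_fourier1 \<psi> \<phi> \<longleftrightarrow>
     \<phi> \<in> borel_measurable borel \<and>
     (\<forall>k. \<phi> (k + 2 * pi) = \<phi> k) \<and>
     ((\<lambda>X. \<integral>\<^sup>+ k \<in> {- pi..pi}.
          ennreal ((norm (\<phi> k - (\<Sum>m\<in>X. cis (- (k * of_int m)) *s \<psi> m)))\<^sup>2)
        \<partial>lborel) \<longlongrightarrow> 0) (finite_subsets_at_top UNIV)"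

definition fourier1 :: "(int \<Rightarrow> complex ^ 2) \<Rightarrow> real \<Rightarrow> complex ^ 2" where
  "fourier1 \<psi> = (SOME \<phi>. is_fourier1 \<psi> \<phi>)"


subsection \<open>The walk in momentum space\<close>

definition coin :: "real \<Rightarrow> complex ^ 2 ^ 2" where
  "coin c = vector [vector [of_real c, of_real (sb c)], vector [- of_real (sb c), of_real c]]"

definition shift_phase :: "real \<Rightarrow> complex ^ 2 ^ 2" where
  "shift_phase \<kappa> = vector [vector [cis \<kappa>, 0], vector [0, cis (- \<kappa>)]]"

definition Uhat :: "real \<Rightarrow> real \<Rightarrow> real \<times> real \<Rightarrow> complex ^ 2 ^ 2" where
  "Uhat a1 a2 k = shift_phase (snd k) ** coin a2 ** shift_phase (fst k) ** coin a1"

definition l1 :: "real \<times> real \<Rightarrow> real" where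
  "l1 k = snd k + fst k"

definition l2 :: "real \<times> real \<Rightarrow> real" where
  "l2 k = snd k - fst k"

definition tau :: "real \<Rightarrow> real \<Rightarrow> real \<times> real \<Rightarrow> real" where
  "tau a1 a2 k = a1 * a2 * cos (l1 k) - sb a1 * sb a2 * cos (l2 k)"

definition omega :: "real \<Rightarrow> real \<Rightarrow> real \<times> real \<Rightarrow> real" where
  "omega a1 a2 k = arccos (tau a1 a2 k)"

text \<open>
  For \<open>a + b < 1\<close> the two eigenvalues are distinct, so the eigenvector is determined up to
  a phase, which does not affect \<open>wt\<close>.
\<close>

definition eigvec :: "real \<Rightarrow> real \<Rightarrow> real \<Rightarrow> real \<times> real \<Rightarrow> complex ^ 2" where
  "eigvec a1 a2 s k = (SOME u. norm u = 1 \<and> Uhat a1 a2 k *v u = cis (s * omega a1 a2 k) *s u)"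

definition wt :: "real \<Rightarrow> real \<Rightarrow> (int \<times> int \<Rightarrow> complex ^ 2) \<Rightarrow> real \<Rightarrow> real \<times> real \<Rightarrow> real" where
  "wt a1 a2 \<Psi> s k = (cmod (braket (eigvec a1 a2 s k) (fourier2 \<Psi> k)))\<^sup>2"

definition vel :: "real \<Rightarrow> real \<Rightarrow> real \<times> real \<Rightarrow> real \<times> real" where
  "vel a1 a2 k =
     (let A = a1 * a2 * sin (l1 k); B = sb a1 * sb a2 * sin (l2 k); d = sqrt (1 - (tau a1 a2 k)\<^sup>2)
      in (- (A + B) / d, - (A - B) / d))"


subsection \<open>The densities \<open>f\<^sub>\<plusminus>\<close>\<close>

definition ellF :: "real \<Rightarrow> real \<times> real \<Rightarrow> real" where
  "ellF c v = 1 - (fst v + snd v)\<^sup>2 / (4 * c\<^sup>2) - (fst v - snd v)\<^sup>2 / (4 * (sb c)\<^sup>2)"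

definition ellE :: "real \<Rightarrow> (real \<times> real) set" where
  "ellE c = {v. ellF c v \<ge> 0}"

definition F0 :: "real \<Rightarrow> real \<Rightarrow> real \<times> real \<Rightarrow> real" where
  "F0 a1 a2 v =
     (let b1 = sb a1; b2 = sb a2; q = (a1 * b2)\<^sup>2 + (a2 * b1)\<^sup>2;
          a0sq = q / (b1\<^sup>2 + b2\<^sup>2); b0sq = q / (a1\<^sup>2 + a2\<^sup>2)
      in q / (2 * (a1 * a2) * (b1 * b2)) *
         (1 - (fst v + snd v)\<^sup>2 / (4 * a0sq) - (fst v - snd v)\<^sup>2 / (4 * b0sq)))"

definition fpm :: "real \<Rightarrow> real \<Rightarrow> real \<Rightarrow> real \<times> real \<Rightarrow> real" where
  "fpm a1 a2 s v =
     (let r = sqrt (ellF a1 v * ellF a2 v)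
      in (F0 a1 a2 v + s * r) / (2 * pi\<^sup>2 * (1 - (fst v)\<^sup>2) * (1 - (snd v)\<^sup>2) * r)
         * indicator (ellE a1 \<inter> ellE a2) v)"


subsection \<open>Inverse branches of the velocity map and the density \<open>\<rho>\<close>\<close>

definition Lbox :: "nat \<Rightarrow> (real \<times> real) set" where
  "Lbox n =
     [{0..pi} \<times> {0..pi}, {- pi..0} \<times> {0..pi}, {- pi..0} \<times> {- pi..0}, {0..pi} \<times> {- pi..0},
      {- 2 * pi..- pi} \<times> {0..pi}, {- pi..0} \<times> {- 2 * pi..- pi},
      {pi..2 * pi} \<times> {- pi..0}, {0..pi} \<times> {pi..2 * pi}] ! (n - 1)"

definition Kbox :: "nat \<Rightarrow> (real \<times> real) set" where
  "Kbox n = {((x - y) / 2, (x + y) / 2) |x y. (x, y) \<in> Lbox n}"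

definition phi :: "real \<Rightarrow> real \<Rightarrow> real \<times> real \<Rightarrow> real" where
  "phi a b c = a * b * (fst c)\<^sup>2 + (1 - a\<^sup>2 - b\<^sup>2) * fst c * snd c + a * b * (snd c)\<^sup>2"

definition Creg :: "real \<Rightarrow> real \<Rightarrow> nat \<Rightarrow> (real \<times> real) set" where
  "Creg a b m = {c \<in> {- 1..1} \<times> {- 1..1}.
     if m = 1 then phi a b c \<le> 0 \<and> fst c \<le> 0 \<and> 0 \<le> snd c
     else if m = 3 then phi a b c \<le> 0 \<and> snd c \<le> 0 \<and> 0 \<le> fst c
     else if m = 2 then phi a b c \<ge> 0 \<and> fst c + snd c \<le> 0
     else m = 4 \<and> phi a b c \<ge> 0 \<and> fst c + snd c \<ge> 0}"

definition Kreg :: "real \<Rightarrow> real \<Rightarrow> nat \<Rightarrow> nat \<Rightarrow> nat \<Rightarrow> (real \<times> real) set" where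
  "Kreg a1 a2 \<mu> \<nu> \<xi> = {k \<in> (\<Union>n\<in>{1..4}. Kbox (n + 4 * \<mu>)).
     (cos (l1 k), cos (l2 k)) \<in> Creg (a1 * a2) (sb a1 * sb a2) (2 * (\<nu> + 1) - \<xi>)}"

text \<open>
  The inverse branches; \<open>s = 1\<close> corresponds to \<open>\<xi> = 0\<close> and \<open>s = - 1\<close> to \<open>\<xi> = 1\<close>.  The
  velocity map is injective on \<open>Kreg\<close> only up to null sets; on the exceptional null set the
  value is irrelevant.
\<close>

definition kbranch :: "real \<Rightarrow> real \<Rightarrow> real \<Rightarrow> nat \<times> nat \<Rightarrow> real \<times> real \<Rightarrow> real \<times> real" where
  "kbranch a1 a2 s lam v =
     inv_into (Kreg a1 a2 (fst lam) (snd lam) (if s = 1 then 0 else 1)) (vel a1 a2) v"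

text \<open>
  The eigenvalue \<open>cis (t * omega k)\<close> moves with group velocity \<open>t * vel k\<close>.  So, for \<open>v\<close> to be
  the velocity of the \<open>t\<close>-component, its weight is taken at the solutions of \<open>t * vel k = v\<close>, that
  is of \<open>vel k = t * v\<close>.  (With \<open>v\<close> in place of \<open>t *\<^sub>R v\<close> the sum over \<open>t\<close> would collapse
  to the squared norm of the Fourier transform, and \<open>rho\<close> would not be the limiting density of
  the walk: started at the origin in the state \<open>(1,0)\<close>, it would get mean velocity \<open>0\<close>.)
\<close>

definition wpm :: "real \<Rightarrow> real \<Rightarrow> (int \<times> int \<Rightarrow> complex ^ 2) \<Rightarrow> real \<Rightarrow> real \<times> real \<Rightarrow> real" where
  "wpm a1 a2 \<Psi> s v =
     (1 / 4) * (\<Sum>t\<in>{1, - 1}. \<Sum>lam\<in>{0, 1} \<times> {0, 1}. wt a1 a2 \<Psi> t (kbranch a1 a2 s lam (t *\<^sub>R v)))"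

definition rho :: "real \<Rightarrow> real \<Rightarrow> (int \<times> int \<Rightarrow> complex ^ 2) \<Rightarrow> real \<times> real \<Rightarrow> real" where
  "rho a1 a2 \<Psi> v = wpm a1 a2 \<Psi> 1 v * fpm a1 a2 1 v + wpm a1 a2 \<Psi> (- 1) v * fpm a1 a2 (- 1) v"


subsection \<open>One-dimensional objects\<close>

definition diag_state :: "(int \<times> int \<Rightarrow> complex ^ 2) \<Rightarrow> int \<Rightarrow> int \<Rightarrow> complex ^ 2" where
  "diag_state \<Psi> n m = \<Psi> (m, n + m)"

definition velK :: "real \<Rightarrow> real \<Rightarrow> real" where
  "velK a1 k = - (a1 * sin k) / sqrt (1 - (a1 * cos k)\<^sup>2)"

definition eigvecK :: "real \<Rightarrow> real \<Rightarrow> real \<Rightarrow> complex ^ 2" where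
  "eigvecK a1 s k = of_real (1 / sqrt 2) *s
     vector [cis k * of_real (sqrt (1 - s * velK a1 k)),
             of_real s * \<i> * of_real (sqrt (1 + s * velK a1 k))]"

definition wtK :: "real \<Rightarrow> (int \<times> int \<Rightarrow> complex ^ 2) \<Rightarrow> int \<Rightarrow> real \<Rightarrow> real \<Rightarrow> real" where
  "wtK a1 \<Psi> n s k = (cmod (braket (eigvecK a1 s k) (fourier1 (diag_state \<Psi> n) k)))\<^sup>2"

definition kK :: "real \<Rightarrow> real \<Rightarrow> nat \<Rightarrow> real \<Rightarrow> real" where
  "kK a1 s m v = of_nat m * pi + arcsin (- s * (- 1) ^ m * sb a1 * v / (a1 * sqrt (1 - v\<^sup>2)))"

definition w1 :: "real \<Rightarrow> (int \<times> int \<Rightarrow> complex ^ 2) \<Rightarrow> real \<Rightarrow> real" where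
  "w1 a1 \<Psi> v = (1 / 2) * (\<Sum>\<^sub>\<infinity>n::int. \<Sum>s\<in>{1, - 1}. \<Sum>m\<in>{0, 1}. wtK a1 \<Psi> n s (kK a1 s m v))"

definition konno :: "real \<Rightarrow> real \<Rightarrow> real" where
  "konno r v = sqrt (1 - r\<^sup>2) / (pi * (1 - v\<^sup>2) * sqrt (r\<^sup>2 - v\<^sup>2)) * indicator {- r<..<r} v"

definition prob_density :: "(real \<Rightarrow> real) \<Rightarrow> bool" where
  "prob_density f \<longleftrightarrow> f \<in> borel_measurable lebesgue \<and> (\<forall>v. 0 \<le> f v) \<and> (\<integral>\<^sup>+ v. ennreal (f v) \<partial>lebesgue) = 1"

end

theory Submission
  imports Defs
begin

text \<open>
  Write \<open>x = l1 k\<close>, \<open>y = l2 k\<close> and \<open>T = 1 - tau\<^sup>2\<close>.  Everything about the velocity map rests on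
  two factorisations: with \<open>L1 = a2 b1 cos x + a1 b2 cos y\<close> and \<open>L2 = a1 b2 cos x + a2 b1 cos y\<close>,
  where \<open>bj = sb aj\<close>, one has \<open>phi = L1 L2\<close> and, at the velocity of \<open>k\<close>, \<open>ellF aj = Lj\<^sup>2 / T\<close>.
  Hence the regions \<open>Creg\<close> are the four sign patterns of \<open>(L1, L2)\<close>.  Given the signs, a velocity
  determines \<open>Lj / sqrt T\<close>, thus \<open>cos x / sqrt T\<close> and \<open>cos y / sqrt T\<close> by a linear system, thus \<open>T\<close>,
  and finally the sines from the velocity itself.  The Jacobian is \<open>2 a b \<bar>phi\<bar> / T\<^sup>2\<close>, which cancels
  \<open>fpm\<close> up to the constant \<open>2 pi\<^sup>2\<close>.  Therefore the integral of \<open>g\<close> against \<open>rho\<close> is the mean over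
  the momentum torus of \<open>g (t *\<^sub>R vel k)\<close> weighted by \<open>wt t k\<close>, summed over the signs \<open>t\<close>.

  As \<open>b2\<close> tends to \<open>0\<close>, the momentum matrix, the weights and the velocities converge pointwise to
  those of the one-dimensional walk in the variable \<open>x\<close>, and the weights are dominated by the squared
  norm of the Fourier transform.  In the coordinates \<open>(x, snd k)\<close>, Parseval's identity in the second
  variable turns the limiting weight into the sum over \<open>n\<close> of the weights of the diagonal states, and
  the substitution \<open>v = t * velK x\<close> on the two halves of the circle produces the Konno function.
\<close>

subsection \<open>Spectral weights of the momentum matrices\<close>

text \<open>Eigenvectors and both Fourier transforms are defined by choice, and this shapes the
  proof. The eigenvectors disappear into \<open>eigen_weight\<close>, a closed formula that is
  continuous in the parameters. The transforms are fixed only up to null sets, so Parseval's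
  identity is first obtained in integrated form and then localised by testing on Borel sets. Hence
  \<open>w1\<close> is controlled only for almost every velocity, and an auxiliary function
  \<open>density1\<close> carries the integrals.

  The limit is not taken in the velocity plane because \<open>ellE a1 \<inter> ellE a2\<close>
  collapses onto the diagonal and the inverse branches move with \<open>b2\<close>. On the momentum
  side the domain is a fixed torus and one dominating function serves all \<open>b2\<close>.

  Constants: the factor \<open>1 / 4\<close> in \<open>wpm\<close> times
  \<open>1 / (2 * pi\<^sup>2)\<close> from the Jacobian is \<open>1 / (8 * pi\<^sup>2)\<close>. The
  eight boxes have total area \<open>8 * pi\<^sup>2\<close> in the coordinates
  \<open>(l1 k, l2 k)\<close>, which double areas, so they cover the torus exactly once and the
  result is a mean over it.\<close>

definition eigen_weight :: "real \<Rightarrow> complex \<Rightarrow> complex \<Rightarrow> complex ^ 2 \<Rightarrow> real" where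
  "eigen_weight s p q w =
     (1 + s * Im p / sqrt (1 - (Re p)\<^sup>2)) / 2 * (cmod (w $ 1))\<^sup>2 +
     (1 - s * Im p / sqrt (1 - (Re p)\<^sup>2)) / 2 * (cmod (w $ 2))\<^sup>2 +
     s * Re (- \<i> * q * cnj (w $ 1) * w $ 2) / sqrt (1 - (Re p)\<^sup>2)"

lemma norm_vec2_squared: "(norm (w :: complex ^ 2))\<^sup>2 = (cmod (w $ 1))\<^sup>2 + (cmod (w $ 2))\<^sup>2"
  by (simp add: norm_vec_def L2_set_def sum_2)

lemma cmod_braket_squared:
  fixes w :: "complex ^ 2"
  assumes u1: "(cmod (u $ 1))\<^sup>2 = (1 + s * Im p / sqrt (1 - (Re p)\<^sup>2)) / 2"
    and u2: "(cmod (u $ 2))\<^sup>2 = (1 - s * Im p / sqrt (1 - (Re p)\<^sup>2)) / 2"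
    and u12: "u $ 1 * cnj (u $ 2) = - \<i> * of_real s * q / of_real (2 * sqrt (1 - (Re p)\<^sup>2))"
  shows "(cmod (braket u w))\<^sup>2 = eigen_weight s p q w"
proof -
  define S where "S = sqrt (1 - (Re p)\<^sup>2)"
  have "(cmod (braket u w))\<^sup>2 = (cmod (u $ 1))\<^sup>2 * (cmod (w $ 1))\<^sup>2 + (cmod (u $ 2))\<^sup>2 * (cmod (w $ 2))\<^sup>2 +
     2 * Re ((u $ 1 * cnj (u $ 2)) * cnj (w $ 1) * w $ 2)"
    unfolding braket_def sum_2 cmod_power2 by (simp add: power2_eq_square algebra_simps)
  also have "2 * Re ((u $ 1 * cnj (u $ 2)) * cnj (w $ 1) * w $ 2) = s * Re (- \<i> * q * cnj (w $ 1) * w $ 2) / S"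
  proof -
    have "(u $ 1 * cnj (u $ 2)) * cnj (w $ 1) * w $ 2 = of_real (s / (2 * S)) * (- \<i> * q * cnj (w $ 1) * w $ 2)"
      unfolding u12 S_def[symmetric] by (simp add: field_simps)
    then show ?thesis by (simp only: Re_complex_of_real Im_complex_of_real times_complex.sel) simp
  qed
  finally show ?thesis unfolding u1 u2 eigen_weight_def S_def by simp
qed

text \<open>The two rows of the eigenvalue equation determine the ratio of the squared moduli and
  the relative phase, and the normalisation fixes the rest. Positivity of \<open>S\<close> means
  that the two eigenvalues differ.\<close>

lemma SU2_unit_eigenvector:
  fixes p q u1 u2 :: complex
  defines "S \<equiv> sqrt (1 - (Re p)\<^sup>2)"
  assumes S: "0 < S" and s: "s = 1 \<or> s = - 1"
    and e1: "p * u1 + q * u2 = Complex (Re p) (s * S) * u1"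
    and e2: "- cnj q * u1 + cnj p * u2 = Complex (Re p) (s * S) * u2"
    and n: "(cmod u1)\<^sup>2 + (cmod u2)\<^sup>2 = 1"
  shows "(cmod u1)\<^sup>2 = (1 + s * Im p / S) / 2"
    and "(cmod u2)\<^sup>2 = (1 - s * Im p / S) / 2"
    and "u1 * cnj u2 = - \<i> * of_real s * q / of_real (2 * S)"
proof -
  define y where "y = Im p"
  have f1: "q * u2 = \<i> * of_real (s * S - y) * u1"
  proof -
    have "Complex (Re p) (s * S) - p = \<i> * of_real (s * S - y)" by (simp add: complex_eq_iff y_def)
    with e1 show ?thesis by (metis add_diff_cancel_left' left_diff_distrib)
  qed
  have f2: "q * cnj u1 = \<i> * of_real (s * S + y) * cnj u2"
  proof -
    have "Complex (Re p) (s * S) - cnj p = \<i> * of_real (s * S + y)" by (simp add: complex_eq_iff y_def)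
    with e2 have "- cnj q * u1 = \<i> * of_real (s * S + y) * u2"
      by (metis add_diff_cancel_right' left_diff_distrib)
    then have "cnj (- cnj q * u1) = cnj (\<i> * of_real (s * S + y) * u2)" by simp
    then show ?thesis by simp
  qed
  have N1: "u1 * cnj u1 = of_real ((cmod u1)\<^sup>2)" and N2: "u2 * cnj u2 = of_real ((cmod u2)\<^sup>2)"
    by (simp_all add: complex_norm_square del: of_real_power)
  \<comment> \<open>Both sides are \<open>q * u2 * cnj u1\<close>: multiply \<open>f1\<close> by
    \<open>cnj u1\<close> and \<open>f2\<close> by \<open>u2\<close>.\<close>
  have "\<i> * of_real (s * S - y) * (u1 * cnj u1) = \<i> * of_real (s * S + y) * (u2 * cnj u2)"
    using f1 f2 by (metis mult.assoc mult.commute)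
  then have "of_real ((s * S - y) * (cmod u1)\<^sup>2) = (of_real ((s * S + y) * (cmod u2)\<^sup>2) :: complex)"
    unfolding N1 N2 by simp
  then have r: "(s * S - y) * (cmod u1)\<^sup>2 = (s * S + y) * (cmod u2)\<^sup>2" by (simp only: of_real_eq_iff)
  then have "2 * (s * S) * (cmod u1)\<^sup>2 = s * S + y" using n by algebra
  then show 1: "(cmod u1)\<^sup>2 = (1 + s * Im p / S) / 2"
    using s S unfolding y_def by (auto simp: field_simps)
  show "(cmod u2)\<^sup>2 = (1 - s * Im p / S) / 2" using n 1 by (simp add: field_simps)
  \<comment> \<open>Add \<open>f2\<close> times \<open>u1\<close> to \<open>f1\<close> times
    \<open>cnj u2\<close>; the terms with \<open>y\<close> cancel.\<close>
  have "q * (u1 * cnj u1 + u2 * cnj u2) = 2 * \<i> * of_real (s * S) * (u1 * cnj u2)"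
    using f1 f2 by (simp add: algebra_simps) algebra
  also have "u1 * cnj u1 + u2 * cnj u2 = 1" unfolding N1 N2 using n by (metis of_real_1 of_real_add)
  finally have "q = 2 * \<i> * of_real (s * S) * (u1 * cnj u2)" by simp
  then show "u1 * cnj u2 = - \<i> * of_real s * q / of_real (2 * S)"
    using s S by (auto simp: field_simps)
qed

lemma SU2_unit_eigenvector_exists:
  fixes p q :: complex
  defines "S \<equiv> sqrt (1 - (Re p)\<^sup>2)"
  assumes pq: "(cmod p)\<^sup>2 + (cmod q)\<^sup>2 = 1" and s: "s = 1 \<or> s = - 1"
  shows "\<exists>u1 u2. (cmod u1)\<^sup>2 + (cmod u2)\<^sup>2 = 1 \<and> p * u1 + q * u2 = Complex (Re p) (s * S) * u1 \<and>
    - cnj q * u1 + cnj p * u2 = Complex (Re p) (s * S) * u2"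
proof -
  define l where "l = Complex (Re p) (s * S)"
  have "(Re p)\<^sup>2 \<le> 1" using pq unfolding cmod_power2 by (smt (verit) zero_le_power2)
  then have "(s * S)\<^sup>2 = 1 - (Re p)\<^sup>2" using s by (auto simp: S_def)
  moreover have "1 = (Re p)\<^sup>2 + (Im p)\<^sup>2 + (Re q)\<^sup>2 + (Im q)\<^sup>2" using pq unfolding cmod_power2 by simp
  ultimately have "l * (l - p) = - cnj q * q + cnj p * (l - p)"
    unfolding l_def by (simp add: complex_eq_iff power2_eq_square algebra_simps)
  \<comment> \<open>This is the characteristic equation, with determinant 1. It says that
    \<open>(q, l - p)\<close>, which solves the first row identically, solves the second one too.
    That vector vanishes only if \<open>q = 0\<close> and \<open>l = p\<close>, and then
    \<open>(1, 0)\<close> is an eigenvector.\<close>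
  then have char: "- cnj q * q + cnj p * (l - p) = l * (l - p)" by simp
  obtain x y where xy: "x \<noteq> 0 \<or> y \<noteq> 0" "p * x + q * y = l * x" "- cnj q * x + cnj p * y = l * y"
  proof (cases "q = 0 \<and> l = p")
    case True then show ?thesis using that[of 1 0] by simp
  next
    case False then show ?thesis using that[of q "l - p"] char by (auto simp: algebra_simps)
  qed
  define r where "r = sqrt ((cmod x)\<^sup>2 + (cmod y)\<^sup>2)"
  have "(cmod x)\<^sup>2 + (cmod y)\<^sup>2 > 0" using xy(1) by (auto simp: add_pos_nonneg add_nonneg_pos)
  then have r: "r > 0" "r\<^sup>2 = (cmod x)\<^sup>2 + (cmod y)\<^sup>2" by (auto simp: r_def)
  have "(cmod (x / of_real r))\<^sup>2 + (cmod (y / of_real r))\<^sup>2 = 1"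
    using r(1) by (simp add: norm_divide power_divide add_divide_distrib[symmetric] r(2)[symmetric])
  moreover have "p * (x / of_real r) + q * (y / of_real r) = l * (x / of_real r)"
    using xy(2) by (metis add_divide_distrib times_divide_eq_right)
  moreover have "- cnj q * (x / of_real r) + cnj p * (y / of_real r) = l * (y / of_real r)"
    using xy(3) by (metis add_divide_distrib times_divide_eq_right)
  ultimately show ?thesis unfolding l_def by blast
qed

section \<open>Entries of the momentum matrix and the gap between its eigenvalues\<close>

definition Up :: "real \<Rightarrow> real \<Rightarrow> real \<times> real \<Rightarrow> complex" where
  "Up a1 a2 k = of_real (a1 * a2) * cis (l1 k) - of_real (sb a1 * sb a2) * cis (l2 k)"

definition Uq :: "real \<Rightarrow> real \<Rightarrow> real \<times> real \<Rightarrow> complex" where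
  "Uq a1 a2 k = of_real (sb a1 * a2) * cis (l1 k) + of_real (a1 * sb a2) * cis (l2 k)"

lemma Uhat_entries:
  "Uhat a1 a2 k *v u = (vector [Up a1 a2 k * u $ 1 + Uq a1 a2 k * u $ 2,
      - cnj (Uq a1 a2 k) * u $ 1 + cnj (Up a1 a2 k) * u $ 2] :: complex ^ 2)"
  unfolding Uhat_def coin_def shift_phase_def Up_def Uq_def l1_def l2_def
  by (simp add: vec_eq_iff forall_2 matrix_vector_mult_def matrix_matrix_mult_def sum_2 cis_cnj
      complex_eq_iff cos_add sin_add cos_diff sin_diff) (simp add: algebra_simps)

lemma sb_pos: "0 < c \<Longrightarrow> c < 1 \<Longrightarrow> 0 < sb c"
  by (simp add: sb_def power_less_one_iff)

lemma sb_squared: "0 < c \<Longrightarrow> c < 1 \<Longrightarrow> (sb c)\<^sup>2 = 1 - c\<^sup>2"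
  by (simp add: sb_def power_le_one)

lemma Re_Up: "Re (Up a1 a2 k) = tau a1 a2 k"
  and Im_Up: "Im (Up a1 a2 k) = a1 * a2 * sin (l1 k) - sb a1 * sb a2 * sin (l2 k)"
  by (simp_all add: Up_def tau_def)

lemma Up_Uq_norm:
  assumes "0 < a1" "a1 < 1" "0 < a2" "a2 < 1"
  shows "(cmod (Up a1 a2 k))\<^sup>2 + (cmod (Uq a1 a2 k))\<^sup>2 = 1"
proof -
  have b: "(sb a1)\<^sup>2 = 1 - a1\<^sup>2" "(sb a2)\<^sup>2 = 1 - a2\<^sup>2" using assms by (simp_all add: sb_squared)
  have t: "(sin (l1 k))\<^sup>2 + (cos (l1 k))\<^sup>2 = 1" "(sin (l2 k))\<^sup>2 + (cos (l2 k))\<^sup>2 = 1" by simp_all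
  have "(cmod (Up a1 a2 k))\<^sup>2 + (cmod (Uq a1 a2 k))\<^sup>2 =
     (a1 * a2 * cos (l1 k) - sb a1 * sb a2 * cos (l2 k))\<^sup>2 + (a1 * a2 * sin (l1 k) - sb a1 * sb a2 * sin (l2 k))\<^sup>2 +
     ((sb a1 * a2 * cos (l1 k) + a1 * sb a2 * cos (l2 k))\<^sup>2 + (sb a1 * a2 * sin (l1 k) + a1 * sb a2 * sin (l2 k))\<^sup>2)"
    unfolding cmod_power2 Up_def Uq_def by simp
  also have "\<dots> = (a1\<^sup>2 + (sb a1)\<^sup>2) * a2\<^sup>2 + (a1\<^sup>2 + (sb a1)\<^sup>2) * (sb a2)\<^sup>2"
    using t by algebra
  finally show ?thesis unfolding b by simp
qed

text \<open>Twice the defect \<open>1 - a1 * a2 - sb a1 * sb a2\<close> equals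
  \<open>(a1 - a2)\<^sup>2 + (sb a1 - sb a2)\<^sup>2\<close>. Strictness keeps \<open>tau\<close>
  inside the open unit interval, so the eigenvalues never meet.\<close>

lemma sum_ab_less_1:
  assumes "0 < a1" "a1 < a2" "a2 < 1"
  shows "a1 * a2 + sb a1 * sb a2 < 1"
proof -
  have "(a1 - a2)\<^sup>2 > 0" using assms by simp
  moreover have "(sb a1 - sb a2)\<^sup>2 \<ge> 0" by simp
  ultimately show ?thesis using sb_squared[of a1] sb_squared[of a2] assms
    by (simp add: power2_diff)
qed

lemma abs_tau_less_1:
  assumes "0 < a1" "a1 < a2" "a2 < 1"
  shows "\<bar>tau a1 a2 k\<bar> < 1"
proof -
  have "0 < a1" "0 < a2" "0 < sb a1" "0 < sb a2" using assms sb_pos by simp_all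
  then have "\<bar>a1 * a2 * cos (l1 k)\<bar> \<le> a1 * a2" "\<bar>sb a1 * sb a2 * cos (l2 k)\<bar> \<le> sb a1 * sb a2"
    by (simp_all add: abs_mult mult_left_le)
  then show ?thesis unfolding tau_def using sum_ab_less_1[OF assms] by linarith
qed

text \<open>No measurability or continuity can be read off the chosen vector \<open>eigvec\<close>.
  The closed form makes the weight measurable, bounds it, and allows passing to the limit in
  \<open>a2\<close>.\<close>

lemma wt_eq:
  assumes a: "0 < a1" "a1 < a2" "a2 < 1" and s: "s = 1 \<or> s = - 1"
  shows "wt a1 a2 \<Psi> s k = eigen_weight s (Up a1 a2 k) (Uq a1 a2 k) (fourier2 \<Psi> k)"
proof -
  let ?p = "Up a1 a2 k" and ?q = "Uq a1 a2 k"
  define S where "S = sqrt (1 - (Re ?p)\<^sup>2)"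
  have t: "\<bar>tau a1 a2 k\<bar> < 1" by (rule abs_tau_less_1[OF a])
  then have S0: "0 < S" by (simp add: S_def Re_Up abs_square_less_1)
  have l: "cis (s * omega a1 a2 k) = Complex (Re ?p) (s * S)"
    using s t unfolding omega_def S_def Re_Up complex_eq_iff
    by (auto simp: sin_arccos)
  define Q where "Q u \<longleftrightarrow> norm u = 1 \<and> Uhat a1 a2 k *v u = cis (s * omega a1 a2 k) *s u" for u
  have Q: "Q u \<longleftrightarrow> (cmod (u $ 1))\<^sup>2 + (cmod (u $ 2))\<^sup>2 = 1 \<and>
     ?p * u $ 1 + ?q * u $ 2 = Complex (Re ?p) (s * S) * u $ 1 \<and>
    - cnj ?q * u $ 1 + cnj ?p * u $ 2 = Complex (Re ?p) (s * S) * u $ 2" for u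
    unfolding Q_def l Uhat_entries
    by (simp add: vec_eq_iff forall_2 norm_vec2_squared[symmetric] abs_square_eq_1 power2_eq_1_iff)
  obtain u1 u2 where "(cmod u1)\<^sup>2 + (cmod u2)\<^sup>2 = 1" "?p * u1 + ?q * u2 = Complex (Re ?p) (s * S) * u1"
    "- cnj ?q * u1 + cnj ?p * u2 = Complex (Re ?p) (s * S) * u2"
    using SU2_unit_eigenvector_exists[of ?p ?q s] Up_Uq_norm[of a1 a2 k] a s unfolding S_def by auto
  then have "Q (vector [u1, u2])" unfolding Q by simp
  then have "Q (eigvec a1 a2 s k)" unfolding eigvec_def Q_def[symmetric] by (rule someI)
  then have E: "(cmod (eigvec a1 a2 s k $ 1))\<^sup>2 + (cmod (eigvec a1 a2 s k $ 2))\<^sup>2 = 1"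
     "?p * eigvec a1 a2 s k $ 1 + ?q * eigvec a1 a2 s k $ 2 = Complex (Re ?p) (s * S) * eigvec a1 a2 s k $ 1"
    "- cnj ?q * eigvec a1 a2 s k $ 1 + cnj ?p * eigvec a1 a2 s k $ 2 = Complex (Re ?p) (s * S) * eigvec a1 a2 s k $ 2"
    unfolding Q by auto
  show ?thesis unfolding wt_def
    by (rule cmod_braket_squared; unfold S_def[symmetric])
       (use SU2_unit_eigenvector[of ?p s "eigvec a1 a2 s k $ 1" ?q "eigvec a1 a2 s k $ 2"] E S0 s in \<open>simp_all add: S_def\<close>)
qed

text \<open>The entries \<open>a1 * cis k\<close> and \<open>sb a1 * cis k\<close> are the values of
  \<open>Up\<close> and \<open>Uq\<close> at \<open>a2 = 1\<close> with \<open>l1\<close> equal to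
  \<open>k\<close>. Expressing both weights by \<open>eigen_weight\<close> therefore identifies the
  limit without comparing eigenvectors.\<close>

lemma wtK_eq:
  assumes a: "0 < a1" "a1 < 1" and s: "s = 1 \<or> s = - 1"
  shows "(cmod (braket (eigvecK a1 s k) w))\<^sup>2 = eigen_weight s (of_real a1 * cis k) (of_real (sb a1) * cis k) w"
proof -
  define S where "S = sqrt (1 - (a1 * cos k)\<^sup>2)"
  have "\<bar>a1 * cos k\<bar> \<le> a1" using a by (simp add: abs_mult mult_left_le)
  then have "\<bar>a1 * cos k\<bar> < 1" using a by simp
  then have S: "S > 0" "S\<^sup>2 = 1 - (a1 * cos k)\<^sup>2" by (simp_all add: S_def abs_square_less_1 abs_square_le_1)
  have v: "velK a1 k = - (a1 * sin k) / S" by (simp add: velK_def S_def)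
  have "(a1 * sin k)\<^sup>2 + (sb a1)\<^sup>2 = S\<^sup>2"
    using a by (simp add: S sb_squared power_mult_distrib sin_squared_eq algebra_simps)
  then have v2: "1 - (velK a1 k)\<^sup>2 = (sb a1 / S)\<^sup>2"
    unfolding v using S(1) by (simp add: power_divide field_simps)
  have "(velK a1 k)\<^sup>2 \<le> 1" using v2 by (smt (verit) zero_le_power2)
  then have vle: "\<bar>velK a1 k\<bar> \<le> 1" by (simp add: abs_square_le_1)
  have sv: "0 \<le> 1 - s * velK a1 k" "0 \<le> 1 + s * velK a1 k" using vle s by auto
  have R: "Re (of_real a1 * cis k) = a1 * cos k" "Im (of_real a1 * cis k) = a1 * sin k" by auto
  have u1: "(cmod (eigvecK a1 s k $ 1))\<^sup>2 = (1 - s * velK a1 k) / 2"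
    and u2: "(cmod (eigvecK a1 s k $ 2))\<^sup>2 = (1 + s * velK a1 k) / 2"
    using sv s by (auto simp: eigvecK_def norm_mult norm_divide power_mult_distrib power_divide)
  have "sqrt (1 - s * velK a1 k) * sqrt (1 + s * velK a1 k) = sqrt (1 - (velK a1 k)\<^sup>2)"
    unfolding real_sqrt_mult[symmetric] using s by (auto simp: algebra_simps power2_eq_square)
  also have "\<dots> = sb a1 / S" unfolding v2 using sb_pos[OF a] S by simp
  finally have "eigvecK a1 s k $ 1 * cnj (eigvecK a1 s k $ 2) = - \<i> * of_real s * (of_real (sb a1) * cis k) / of_real (2 * S)"
    unfolding eigvecK_def
    by (simp add: field_simps flip: of_real_mult)
  then show ?thesis using u1 u2 unfolding v
    by (intro cmod_braket_squared) (simp_all add: R S_def)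
qed

subsection \<open>A change of variables in the plane\<close>

text \<open>The general change of variables theorem is stated on \<open>real ^ 'n\<close>, while the
  walk lives on pairs; \<open>cart\<close> and \<open>uncart\<close> carry integrals between the
  two.\<close>

definition cart :: "real \<times> real \<Rightarrow> real ^ 2" where
  "cart z = (\<chi> i. if i = 1 then fst z else snd z)"

definition uncart :: "real ^ 2 \<Rightarrow> real \<times> real" where
  "uncart x = (x $ 1, x $ 2)"

lemma cart_uncart [simp]: "cart (uncart x) = x" "uncart (cart z) = z"
  using exhaust_2 by (auto simp: cart_def uncart_def vec_eq_iff)

lemma cart_nth [simp]: "cart z $ 1 = fst z" "cart z $ 2 = snd z"
  by (simp_all add: cart_def)

lemma cart_measurable [measurable]: "cart \<in> borel_measurable borel"
proof (intro borel_measurable_continuous_onI)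
  show "continuous_on UNIV cart" unfolding cart_def
  proof (rule continuous_on_vec_lambda)
    fix i :: 2
    show "continuous_on UNIV (\<lambda>z :: real \<times> real. if i = 1 then fst z else snd z)"
      by (cases "i = 1") (auto intro: continuous_intros)
  qed
qed

lemma uncart_measurable [measurable]: "uncart \<in> borel_measurable borel"
  unfolding uncart_def
  by (intro borel_measurable_continuous_onI continuous_intros)

lemma lborel_uncart: "distr lborel borel uncart = lborel"
proof (rule lborel_eqI[symmetric])
  fix l u :: "real \<times> real"
  assume lu: "\<And>b. b \<in> Basis \<Longrightarrow> l \<bullet> b \<le> u \<bullet> b"
  have le: "fst l \<le> fst u" "snd l \<le> snd u"
    using lu[of "(1, 0)"] lu[of "(0, 1)"] by (auto simp: Basis_prod_def inner_prod_def)
  have "uncart -` box l u = box (cart l) (cart u)"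
    by (auto simp: box_def Basis_prod_def inner_prod_def uncart_def Basis_vec_def inner_axis forall_2 ball_Un)
  then have "emeasure (distr lborel borel uncart) (box l u) = emeasure lborel (box (cart l) (cart u))"
    by (simp add: emeasure_distr)
  also have "\<dots> = ennreal (\<Prod>b\<in>Basis. (cart u - cart l) \<bullet> b)"
    using le by (subst emeasure_lborel_box) (auto simp: Basis_vec_def inner_axis cart_def)
  also have "(\<Prod>b\<in>(Basis :: (real^2) set). (cart u - cart l) \<bullet> b) = (fst u - fst l) * (snd u - snd l)"
  proof -
    have B: "(Basis :: (real^2) set) = {axis 1 1, axis 2 1}"
      by (auto simp: Basis_vec_def UNIV_2)
    show ?thesis unfolding B
      by (subst prod.insert) (auto simp: inner_axis axis_eq_axis)
  qed
  also have "\<dots> = (\<Prod>b\<in>Basis. (u - l) \<bullet> b)"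
  proof -
    have B: "(Basis :: (real \<times> real) set) = {(1, 0), (0, 1)}"
      by (auto simp: Basis_prod_def)
    show ?thesis unfolding B by (simp add: inner_prod_def)
  qed
  finally show "emeasure (distr lborel borel uncart) (box l u) = ennreal (\<Prod>b\<in>Basis. (u - l) \<bullet> b)" .
qed simp

lemma lborel_cart: "distr lborel borel cart = lborel"
proof -
  have "distr lborel borel cart = distr (distr lborel borel uncart) borel cart" by (simp add: lborel_uncart)
  also have "\<dots> = distr lborel borel (cart \<circ> uncart)" by (rule distr_distr) simp_all
  also have "\<dots> = distr lborel lborel (\<lambda>x. x)" by (rule distr_cong) simp_all
  also have "\<dots> = lborel" by (simp add: distr_id2)
  finally show ?thesis .
qed

text \<open>Borel measurability of \<open>T\<close> alone does not give measurability between the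
  completed sigma-algebras. It does here, because a map that preserves \<open>lborel\<close> pulls
  null sets back to null sets.\<close>

lemma lebesgue_measure_preserving:
  fixes T :: "'a::euclidean_space \<Rightarrow> 'b::euclidean_space"
  assumes [measurable]: "T \<in> borel_measurable borel" and T: "distr lborel borel T = lborel"
  shows "T \<in> lebesgue \<rightarrow>\<^sub>M lebesgue" "distr lebesgue lebesgue T = lebesgue"
proof -
  have m: "T \<in> lebesgue \<rightarrow>\<^sub>M lborel" by (intro measurable_completion) simp
  have "distr lebesgue lborel T = distr lborel lborel T" by (rule distr_completion) simp
  also have "\<dots> = lborel" using T by (simp cong: distr_cong)
  finally have eq: "distr lebesgue lborel T = lborel" .
  show "T \<in> lebesgue \<rightarrow>\<^sub>M lebesgue"
    by (rule completion.measurable_completion2[OF m]) (simp add: eq)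
  show "distr lebesgue lebesgue T = lebesgue"
    using completion.completion_distr_eq[OF m] by (simp add: eq)
qed

lemmas lebesgue_cart = lebesgue_measure_preserving[OF cart_measurable lborel_cart]
lemmas lebesgue_uncart = lebesgue_measure_preserving[OF uncart_measurable lborel_uncart]

text \<open>No measurability is assumed of \<open>f\<close> or \<open>S\<close>: pulling back along
  \<open>uncart\<close> gives one direction of the equivalence, pulling back along
  \<open>cart\<close> the other.\<close>

lemma set_integral_uncart:
  fixes f :: "real \<times> real \<Rightarrow> real"
  shows "set_integrable lebesgue (cart ` S) (\<lambda>x. f (uncart x)) \<longleftrightarrow> set_integrable lebesgue S f"
    and "(LINT x:cart ` S|lebesgue. f (uncart x)) = (LINT z:S|lebesgue. f z)"
proof -
  define h where "h z = indicator S z *\<^sub>R f z" for z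
  have h: "indicator (cart ` S) x *\<^sub>R f (uncart x) = h (uncart x)" for x
    unfolding h_def by (metis cart_uncart image_eqI imageE indicator_simps(1) indicator_simps(2))
  have hh: "(\<lambda>z. indicator S z *\<^sub>R f z) = h" by (simp add: h_def fun_eq_iff)
  have 1: "integrable lebesgue h \<Longrightarrow> integrable lebesgue (\<lambda>x. h (uncart x))"
    using integrable_distr[OF lebesgue_uncart(1), of h] by (simp add: lebesgue_uncart(2))
  have 2: "integrable lebesgue (\<lambda>x. h (uncart x)) \<Longrightarrow> integrable lebesgue h"
    using integrable_distr[OF lebesgue_cart(1), of "\<lambda>x. h (uncart x)"] by (simp add: lebesgue_cart(2))
  show iff: "set_integrable lebesgue (cart ` S) (\<lambda>x. f (uncart x)) \<longleftrightarrow> set_integrable lebesgue S f"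
    unfolding set_integrable_def h hh using 1 2 by blast
  show "(LINT x:cart ` S|lebesgue. f (uncart x)) = (LINT z:S|lebesgue. f z)"
  proof (cases "set_integrable lebesgue S f")
    case True
    then have "h \<in> borel_measurable lebesgue" unfolding set_integrable_def hh by simp
    then have "integral\<^sup>L (distr lebesgue lebesgue uncart) h = (LINT x|lebesgue. h (uncart x))"
      by (intro integral_distr lebesgue_uncart(1))
    then show ?thesis unfolding set_lebesgue_integral_def h hh by (simp only: lebesgue_uncart(2))
  next
    case False
    \<comment> \<open>Both integrals have the default value 0 of a function that is not
      integrable.\<close>
    with iff show ?thesis unfolding set_lebesgue_integral_def set_integrable_def
      by (simp add: not_integrable_integral_eq)
  qed
qed

text \<open>The derivative is given by its four entries, so that the Jacobian is a plain scalar
  formula. Integrability is assumed on the parameter side, where it is easy to check, and is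
  concluded on the image.\<close>

theorem plane_change_of_variables:
  fixes f :: "real \<times> real \<Rightarrow> real" and G :: "real \<times> real \<Rightarrow> real \<times> real"
  assumes S: "S \<in> sets lebesgue" and inj: "inj_on G S"
    and der: "\<And>z. z \<in> S \<Longrightarrow> (G has_derivative (\<lambda>h. (A z * fst h + B z * snd h, C z * fst h + D z * snd h))) (at z within S)"
    and int: "set_integrable lebesgue S (\<lambda>z. \<bar>A z * D z - B z * C z\<bar> * f (G z))"
  shows "set_integrable lebesgue (G ` S) f"
    and "(LINT v:G ` S|lebesgue. f v) = (LINT z:S|lebesgue. \<bar>A z * D z - B z * C z\<bar> * f (G z))"
proof -
  define g where "g x = cart (G (uncart x))" for x
  define g' where "g' x h = cart (A (uncart x) * h $ 1 + B (uncart x) * h $ 2, C (uncart x) * h $ 1 + D (uncart x) * h $ 2)" for x and h :: "real ^ 2"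
  \<comment> \<open>The theorem on \<open>real ^ 2\<close> integrates vector-valued functions, so
    \<open>f\<close> becomes a vector with one component.\<close>
  define F where "F x = (vec (f (uncart x)) :: real ^ 1)" for x
  have lin_cart: "bounded_linear cart"
    by (rule linear_conv_bounded_linear[THEN iffD1], rule linearI) (auto simp: cart_def vec_eq_iff)
  have lin_uncart: "bounded_linear uncart"
    by (rule linear_conv_bounded_linear[THEN iffD1], rule linearI) (auto simp: uncart_def)
  have S': "cart ` S \<in> sets lebesgue"
  proof -
    have "cart ` S = uncart -` S \<inter> space lebesgue" by (auto simp: image_iff) (metis cart_uncart(1))
    then show ?thesis using measurable_sets[OF lebesgue_uncart(1) S] by simp
  qed
  have inj': "inj_on g (cart ` S)"
    using inj unfolding g_def inj_on_def by (auto) (metis cart_uncart(2))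
  have der': "(g has_derivative g' x) (at x within cart ` S)" if "x \<in> cart ` S" for x
  proof -
    have ux: "uncart x \<in> S" "uncart ` cart ` S = S" using that by (auto simp: image_image)
    have "((G \<circ> uncart) has_derivative (\<lambda>h. (A (uncart x) * fst h + B (uncart x) * snd h, C (uncart x) * fst h + D (uncart x) * snd h)) \<circ> uncart) (at x within cart ` S)"
      by (rule diff_chain_within) (use der[OF ux(1)] ux(2) bounded_linear_imp_has_derivative[OF lin_uncart] in auto)
    then have "((cart \<circ> (G \<circ> uncart)) has_derivative cart \<circ> ((\<lambda>h. (A (uncart x) * fst h + B (uncart x) * snd h, C (uncart x) * fst h + D (uncart x) * snd h)) \<circ> uncart)) (at x within cart ` S)"
      by (rule diff_chain_within) (rule bounded_linear_imp_has_derivative[OF lin_cart])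
    then show ?thesis unfolding g_def g'_def o_def by (simp add: uncart_def)
  qed
  have det: "det (matrix (g' x)) = A (uncart x) * D (uncart x) - B (uncart x) * C (uncart x)" for x
    unfolding det_2 by (simp add: matrix_def g'_def axis_def)
  have gS: "g ` cart ` S = cart ` G ` S" unfolding g_def by (simp add: image_image)
  have "set_integrable lebesgue (cart ` S) (\<lambda>x. \<bar>A (uncart x) * D (uncart x) - B (uncart x) * C (uncart x)\<bar> * f (G (uncart x)))"
    using int set_integral_uncart(1)[of S "\<lambda>z. \<bar>A z * D z - B z * C z\<bar> * f (G z)"] by simp
  then have i0: "(\<lambda>x. \<bar>det (matrix (g' x))\<bar> * f (uncart (g x))) absolutely_integrable_on (cart ` S)"
    unfolding det g_def by simp
  have v: "\<bar>det (matrix (g' x))\<bar> *\<^sub>R F (g x) = vec (\<bar>det (matrix (g' x))\<bar> * f (uncart (g x)))" for x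
    unfolding F_def by (simp add: vec_eq_iff)
  have i1: "(\<lambda>x. \<bar>det (matrix (g' x))\<bar> *\<^sub>R F (g x)) absolutely_integrable_on (cart ` S)"
    unfolding v using i0 by (simp add: absolutely_integrable_on_1_iff)
  have cv: "F absolutely_integrable_on (g ` cart ` S) \<and>
    integral (g ` cart ` S) F = integral (cart ` S) (\<lambda>x. \<bar>det (matrix (g' x))\<bar> *\<^sub>R F (g x))"
    using has_absolute_integral_change_of_variables[OF S' der' inj', of F] i1 by blast
  then have "(\<lambda>x. f (uncart x)) absolutely_integrable_on (cart ` G ` S)"
    unfolding gS F_def by (simp add: absolutely_integrable_on_1_iff)
  then show I: "set_integrable lebesgue (G ` S) f" by (simp add: set_integral_uncart(1))
  have a1: "(\<lambda>x. f (uncart x)) absolutely_integrable_on (cart ` G ` S)" using I by (simp add: set_integral_uncart(1))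
  have "integral (cart ` G ` S) F $ 1 = integral (cart ` S) (\<lambda>x. \<bar>det (matrix (g' x))\<bar> *\<^sub>R F (g x)) $ 1"
    using cv gS by simp
  then have "integral (cart ` G ` S) (\<lambda>x. f (uncart x)) = integral (cart ` S) (\<lambda>x. \<bar>det (matrix (g' x))\<bar> * f (uncart (g x)))"
    unfolding v F_def by (simp add: integral_on_1_eq)
  then have "(LINT x:cart ` G ` S|lebesgue. f (uncart x)) = (LINT x:cart ` S|lebesgue. \<bar>det (matrix (g' x))\<bar> * f (uncart (g x)))"
    using set_lebesgue_integral_eq_integral(2)[OF a1] set_lebesgue_integral_eq_integral(2)[OF i0] by simp
  then show "(LINT v:G ` S|lebesgue. f v) = (LINT z:S|lebesgue. \<bar>A z * D z - B z * C z\<bar> * f (G z))"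
    unfolding det g_def by (simp add: set_integral_uncart(2) set_integral_uncart(2)[of S "\<lambda>z. \<bar>A z * D z - B z * C z\<bar> * f (G z)"])
qed

subsection \<open>The velocity map\<close>

lemma sin_cos_eq_imp_eq:
  fixes x y :: real
  assumes "sin x = sin y" "cos x = cos y" "\<bar>x - y\<bar> < 2 * pi"
  shows "x = y"
proof -
  obtain n :: int where n: "x = y + 2 * pi * n"
    using sin_cos_eq_iff[of x y] assms by auto
  then have "\<bar>real_of_int n\<bar> * (2 * pi) < 1 * (2 * pi)" using assms(3) by (simp add: abs_mult)
  then have "\<bar>real_of_int n\<bar> < 1" using pi_gt_zero by (subst (asm) mult_less_cancel_right) auto
  then have "n = 0" by linarith
  then show ?thesis using n by simp
qed

text \<open>The inverse of \<open>k \<mapsto> (l1 k, l2 k)\<close>; it halves areas.\<close>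

definition momentum :: "real \<times> real \<Rightarrow> real \<times> real" where
  "momentum z = ((fst z - snd z) / 2, (fst z + snd z) / 2)"

lemma l1_momentum [simp]: "l1 (momentum z) = fst z" and l2_momentum [simp]: "l2 (momentum z) = snd z"
  by (simp_all add: momentum_def l1_def l2_def field_simps)

lemma momentum_l: "momentum (l1 k, l2 k) = k"
  by (simp add: momentum_def l1_def l2_def prod_eq_iff field_simps)

lemma inj_momentum: "inj momentum"
  by (metis injI l1_momentum l2_momentum prod_eqI)

lemma Kbox_eq: "Kbox n = momentum ` Lbox n"
  by (auto simp: Kbox_def momentum_def image_iff prod_eq_iff) force+

lemma two_by_two_unique:
  fixes p q :: real
  assumes "p * x + q * y = p * x' + q * y'" "q * x + p * y = q * x' + p * y'" "p\<^sup>2 \<noteq> q\<^sup>2"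
  shows "x = x'" "y = y'"
proof -
  have "(p\<^sup>2 - q\<^sup>2) * (x - x') = 0" "(p\<^sup>2 - q\<^sup>2) * (y - y') = 0" using assms(1,2) by algebra+
  then show "x = x'" "y = y'" using assms(3) by auto
qed

locale walk =
  fixes a1 a2 :: real
  assumes a1: "0 < a1" and a12: "a1 < a2" and a2: "a2 < 1"
begin

definition "b1 = sb a1"
definition "b2 = sb a2"
definition "M1 = a2 * b1"
definition "M2 = a1 * b2"
definition "L1 z = M1 * cos (fst z) + M2 * cos (snd z)"
definition "L2 z = M2 * cos (fst z) + M1 * cos (snd z)"
definition "A z = a1 * a2 * sin (fst z)"
definition "B z = b1 * b2 * sin (snd z)"
definition "t z = a1 * a2 * cos (fst z) - b1 * b2 * cos (snd z)"
definition "d z = sqrt (1 - (t z)\<^sup>2)"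
definition "V z = vel a1 a2 (momentum z)"

lemma pos: "0 < a1" "a1 < 1" "0 < a2" "a2 < 1" "0 < b1" "0 < b2"
  using a1 a12 a2 sb_pos by (auto simp: b1_def b2_def)

lemma b_squared: "b1\<^sup>2 = 1 - a1\<^sup>2" "b2\<^sup>2 = 1 - a2\<^sup>2"
  using pos sb_squared by (simp_all add: b1_def b2_def)

text \<open>The order \<open>a1 < a2\<close> enters here: it makes the linear system from the two
  cosines to \<open>(L1, L2)\<close>, with determinant \<open>M1\<^sup>2 - M2\<^sup>2\<close>,
  invertible.\<close>

lemma M_less: "0 < M2" "M2 < M1"
proof -
  show "0 < M2" using pos by (simp add: M2_def)
  have "a1\<^sup>2 < a2\<^sup>2" using a1 a12 by (simp add: power_strict_mono)
  then have "b2\<^sup>2 < b1\<^sup>2" unfolding b_squared by simp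
  then have "b2 < b1" using pos(5) by (simp add: power2_less_imp_less)
  then show "M2 < M1" unfolding M1_def M2_def using a12 pos by (intro mult_strict_mono) auto
qed

lemma M_squared_neq: "M1\<^sup>2 \<noteq> M2\<^sup>2"
  using M_less by (smt (verit) power2_eq_iff)

lemma abs_t: "\<bar>t z\<bar> < 1"
  using abs_tau_less_1[OF a1 a12 a2, of "momentum z"] by (simp add: tau_def t_def b1_def b2_def)

lemma d_pos: "0 < d z" and d_squared: "(d z)\<^sup>2 = 1 - (t z)\<^sup>2"
  using abs_t[of z] by (simp_all add: d_def abs_square_less_1 abs_square_le_1)

lemma V_eq: "V z = (- (A z + B z) / d z, - (A z - B z) / d z)"
  by (simp add: V_def vel_def Let_def A_def B_def d_def t_def tau_def b1_def b2_def)

text \<open>Write \<open>c1\<close>, \<open>c2\<close> for the cosines. In \<open>d\<^sup>2 -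
  a2\<^sup>2 * (1 - c1\<^sup>2) - b2\<^sup>2 * (1 - c2\<^sup>2)\<close> the constant term cancels by
  \<open>a2\<^sup>2 + b2\<^sup>2 = 1\<close>, and \<open>a1\<^sup>2 + b1\<^sup>2 = 1\<close> turns
  the remaining quadratic form into a square. Exchanging the indices gives the second
  identity.\<close>

lemma ellF_V: "ellF a1 (V z) = (L1 z)\<^sup>2 / (d z)\<^sup>2" "ellF a2 (V z) = (L2 z)\<^sup>2 / (d z)\<^sup>2"
proof -
  have s: "(sin (fst z))\<^sup>2 = 1 - (cos (fst z))\<^sup>2" "(sin (snd z))\<^sup>2 = 1 - (cos (snd z))\<^sup>2"
    by (simp_all add: sin_squared_eq)
  have F: "ellF c (V z) = ((d z)\<^sup>2 - (A z)\<^sup>2 / c\<^sup>2 - (B z)\<^sup>2 / (sb c)\<^sup>2) / (d z)\<^sup>2" for c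
  proof -
    have v: "fst (V z) + snd (V z) = - 2 * A z / d z" "fst (V z) - snd (V z) = - 2 * B z / d z"
      using d_pos[of z] by (simp_all add: V_eq field_simps)
    show ?thesis unfolding ellF_def v using d_pos[of z] by (simp add: power_divide power_mult_distrib diff_divide_distrib mult.commute)
  qed
  have A1: "(A z)\<^sup>2 / a1\<^sup>2 = a2\<^sup>2 * (1 - (cos (fst z))\<^sup>2)" "(A z)\<^sup>2 / a2\<^sup>2 = a1\<^sup>2 * (1 - (cos (fst z))\<^sup>2)"
    and B1: "(B z)\<^sup>2 / (sb a1)\<^sup>2 = b2\<^sup>2 * (1 - (cos (snd z))\<^sup>2)" "(B z)\<^sup>2 / (sb a2)\<^sup>2 = b1\<^sup>2 * (1 - (cos (snd z))\<^sup>2)"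
    using pos unfolding A_def B_def power_mult_distrib s b1_def[symmetric] b2_def[symmetric] by (simp_all add: field_simps)
  have "(d z)\<^sup>2 - a2\<^sup>2 * (1 - (cos (fst z))\<^sup>2) - b2\<^sup>2 * (1 - (cos (snd z))\<^sup>2) = (L1 z)\<^sup>2"
    unfolding d_squared L1_def t_def M1_def M2_def using b_squared by algebra
  then show "ellF a1 (V z) = (L1 z)\<^sup>2 / (d z)\<^sup>2" unfolding F A1 B1 by simp
  have "(d z)\<^sup>2 - a1\<^sup>2 * (1 - (cos (fst z))\<^sup>2) - b1\<^sup>2 * (1 - (cos (snd z))\<^sup>2) = (L2 z)\<^sup>2"
    unfolding d_squared L2_def t_def M1_def M2_def using b_squared by algebra
  then show "ellF a2 (V z) = (L2 z)\<^sup>2 / (d z)\<^sup>2" unfolding F A1 B1 by simp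
qed

lemma phi_eq: "phi (a1 * a2) (b1 * b2) (cos (fst z), cos (snd z)) = L1 z * L2 z"
  unfolding phi_def L1_def L2_def M1_def M2_def fst_conv snd_conv using b_squared by algebra

text \<open>\<open>N1\<close> and \<open>N2\<close> are the numerators of
  \<open>1 - v\<^sup>2\<close> for the two velocity components, over the denominator
  \<open>d\<^sup>2\<close>. The sum and difference of the coordinates are \<open>2 * k2\<close> and
  \<open>2 * k1\<close>, so each numerator depends on one momentum component only.\<close>

definition "N1 z = 1 - (a1 * a2)\<^sup>2 - (b1 * b2)\<^sup>2 + 2 * (a1 * a2 * (b1 * b2)) * cos (fst z + snd z)"
definition "N2 z = 1 - (a1 * a2)\<^sup>2 - (b1 * b2)\<^sup>2 + 2 * (a1 * a2 * (b1 * b2)) * cos (fst z - snd z)"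

lemma N_pos: "0 < N1 z" "0 < N2 z"
proof -
  have p: "0 \<le> a1 * a2 * (b1 * b2)" using pos by simp
  have "a1 * a2 + b1 * b2 < 1" using sum_ab_less_1[OF a1 a12 a2] by (simp add: b1_def b2_def)
  then have "(a1 * a2 + b1 * b2)\<^sup>2 < 1" using pos by (simp add: abs_square_less_1)
  then have *: "0 < 1 - (a1 * a2)\<^sup>2 - (b1 * b2)\<^sup>2 + 2 * (a1 * a2 * (b1 * b2)) * - 1"
    by (simp add: power2_sum algebra_simps)
  show "0 < N1 z" unfolding N1_def by (rule less_le_trans[OF *]) (intro add_left_mono mult_left_mono; use p in simp)
  show "0 < N2 z" unfolding N2_def by (rule less_le_trans[OF *]) (intro add_left_mono mult_left_mono; use p in simp)
qed

lemma one_minus_V: "1 - (fst (V z))\<^sup>2 = N1 z / (d z)\<^sup>2" "1 - (snd (V z))\<^sup>2 = N2 z / (d z)\<^sup>2"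
proof -
  have s: "(sin (fst z))\<^sup>2 = 1 - (cos (fst z))\<^sup>2" "(sin (snd z))\<^sup>2 = 1 - (cos (snd z))\<^sup>2"
    by (simp_all add: sin_squared_eq)
  have "(d z)\<^sup>2 - (A z + B z)\<^sup>2 = N1 z" "(d z)\<^sup>2 - (A z - B z)\<^sup>2 = N2 z"
    unfolding d_squared t_def A_def B_def N1_def N2_def cos_add cos_diff using s by algebra+
  then show "1 - (fst (V z))\<^sup>2 = N1 z / (d z)\<^sup>2" "1 - (snd (V z))\<^sup>2 = N2 z / (d z)\<^sup>2"
    using d_pos[of z] by (auto simp: V_eq power_divide divide_simps power2_commute[of "B z"] minus_add_distrib[symmetric] simp del: minus_add_distrib)
qed

text \<open>This explains the shape of \<open>F0\<close>: adding \<open>L1 * L2 / d\<^sup>2\<close>,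
  which is the signed square root of the product of the \<open>ellF\<close>, makes it factor as
  \<open>N1 * N2\<close>. These are the factors \<open>1 - v\<^sup>2\<close> in the denominator of
  \<open>fpm\<close>, which thereby cancel. The identity is multiplied through by \<open>2ab\<close>
  to stay polynomial.\<close>

lemma F0_V: "2 * (a1 * a2 * (b1 * b2)) * F0 a1 a2 (V z) + 2 * (a1 * a2 * (b1 * b2)) * (L1 z * L2 z) / (d z)\<^sup>2 = N1 z * N2 z / (d z)\<^sup>2"
proof -
  have s: "(sin (fst z))\<^sup>2 = 1 - (cos (fst z))\<^sup>2" "(sin (snd z))\<^sup>2 = 1 - (cos (snd z))\<^sup>2"
    by (simp_all add: sin_squared_eq)
  define q where "q = (a1 * b2)\<^sup>2 + (a2 * b1)\<^sup>2"
  have q: "q > 0" using pos by (simp add: q_def add_pos_pos)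
  have v: "fst (V z) + snd (V z) = - 2 * A z / d z" "fst (V z) - snd (V z) = - 2 * B z / d z"
    using d_pos[of z] by (simp_all add: V_eq field_simps)
  have "2 * (a1 * a2 * (b1 * b2)) * F0 a1 a2 (V z) = q * (1 - (- 2 * A z / d z)\<^sup>2 / (4 * (q / (b1\<^sup>2 + b2\<^sup>2))) - (- 2 * B z / d z)\<^sup>2 / (4 * (q / (a1\<^sup>2 + a2\<^sup>2))))"
    using pos unfolding F0_def Let_def v b1_def[symmetric] b2_def[symmetric] q_def[symmetric] by simp
  also have "\<dots> = q - (A z / d z)\<^sup>2 * (b1\<^sup>2 + b2\<^sup>2) - (B z / d z)\<^sup>2 * (a1\<^sup>2 + a2\<^sup>2)"
  proof -
    have e: "(- 2 * A z / d z)\<^sup>2 = 4 * (A z / d z)\<^sup>2" "(- 2 * B z / d z)\<^sup>2 = 4 * (B z / d z)\<^sup>2"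
      by (simp_all add: power_mult_distrib power_divide)
    show ?thesis unfolding e using q by (simp add: right_diff_distrib)
  qed
  also have "\<dots> = (q * (d z)\<^sup>2 - (A z)\<^sup>2 * (b1\<^sup>2 + b2\<^sup>2) - (B z)\<^sup>2 * (a1\<^sup>2 + a2\<^sup>2)) / (d z)\<^sup>2"
    using d_pos[of z] by (simp add: power_divide diff_divide_distrib)
  finally have F: "2 * (a1 * a2 * (b1 * b2)) * F0 a1 a2 (V z) = \<dots>" .
  have "q * (d z)\<^sup>2 - (A z)\<^sup>2 * (b1\<^sup>2 + b2\<^sup>2) - (B z)\<^sup>2 * (a1\<^sup>2 + a2\<^sup>2) + 2 * (a1 * a2 * (b1 * b2)) * (L1 z * L2 z) = N1 z * N2 z"
  proof -
    define c1 c2 s1 s2 where "c1 = cos (fst z)" and "c2 = cos (snd z)" and "s1 = sin (fst z)" and "s2 = sin (snd z)"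
    have A2: "(A z)\<^sup>2 = (a1 * a2)\<^sup>2 * (1 - c1\<^sup>2)" and B2: "(B z)\<^sup>2 = (b1 * b2)\<^sup>2 * (1 - c2\<^sup>2)"
      unfolding A_def B_def c1_def c2_def power_mult_distrib s by simp_all
    \<comment> \<open>By the addition formulas \<open>N1\<close> and \<open>N2\<close> have the form
      \<open>u - w\<close> and \<open>u + w\<close>, so their product is a difference of squares and
      the sines occur only squared.\<close>
    have N: "N1 z * N2 z = (1 - (a1 * a2)\<^sup>2 - (b1 * b2)\<^sup>2 + 2 * (a1 * a2 * (b1 * b2)) * (c1 * c2))\<^sup>2
       - (2 * (a1 * a2 * (b1 * b2)))\<^sup>2 * ((1 - c1\<^sup>2) * (1 - c2\<^sup>2))"
      unfolding N1_def N2_def cos_add cos_diff s[symmetric] c1_def c2_def by (simp add: power2_eq_square algebra_simps)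
    show ?thesis unfolding N A2 B2 d_squared q_def t_def L1_def L2_def M1_def M2_def c1_def[symmetric] c2_def[symmetric]
      using b_squared by algebra
  qed
  then show ?thesis unfolding F add_divide_distrib[symmetric] by simp
qed

text \<open>On this branch \<open>s\<close> is the sign of \<open>L1 * L2\<close>, so
  \<open>s\<close> times the square root in \<open>fpm\<close> is \<open>L1 * L2 / d\<^sup>2\<close>
  itself. The factor next to \<open>fpm\<close> is the Jacobian of \<open>V\<close> up to sign (see
  \<open>V_det\<close>), and all dependence on the velocity cancels.\<close>

lemma fpm_V:
  assumes nz: "s * (L1 z * L2 z) > 0" and s: "s = 1 \<or> s = - 1"
  shows "fpm a1 a2 s (V z) * (2 * (a1 * a2 * (b1 * b2)) * \<bar>L1 z * L2 z\<bar> / (d z)^4) = 1 / (2 * pi\<^sup>2)"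
proof -
  define p where "p = L1 z * L2 z"
  define ab where "ab = a1 * a2 * (b1 * b2)"
  define T where "T = (d z)\<^sup>2"
  have T: "T > 0" using d_pos[of z] by (simp add: T_def)
  have ab: "ab > 0" using pos by (simp add: ab_def)
  have sp: "\<bar>p\<bar> = s * p" "p \<noteq> 0" using nz s by (auto simp: p_def)
  have E: "V z \<in> ellE a1 \<inter> ellE a2" unfolding ellE_def by (simp add: ellF_V)
  have "sqrt (ellF a1 (V z) * ellF a2 (V z)) = sqrt ((p / T)\<^sup>2)"
    unfolding ellF_V p_def T_def by (simp add: power2_eq_square)
  also have "\<dots> = \<bar>p\<bar> / T" using T by simp
  finally have r: "sqrt (ellF a1 (V z) * ellF a2 (V z)) = \<bar>p\<bar> / T" .
  have "2 * ab * F0 a1 a2 (V z) + 2 * ab * p / T = N1 z * N2 z / T"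
    using F0_V[of z] by (simp add: p_def ab_def T_def)
  then have "F0 a1 a2 (V z) + p / T = N1 z * N2 z / (2 * ab * T)" using ab T by (simp add: field_simps)
  moreover have "s * (\<bar>p\<bar> / T) = p / T" using s sp by auto
  ultimately have F: "F0 a1 a2 (V z) + s * (\<bar>p\<bar> / T) = N1 z * N2 z / (2 * ab * T)" by (simp only:)
  have T4: "(d z)^4 = T * T" unfolding T_def by (simp add: power2_eq_square power4_eq_xxxx)
  have "fpm a1 a2 s (V z) = N1 z * N2 z / (2 * ab * T) / (2 * pi\<^sup>2 * (N1 z / T) * (N2 z / T) * (\<bar>p\<bar> / T))"
    unfolding fpm_def Let_def r F one_minus_V T_def[symmetric] using E by simp
  then show ?thesis unfolding T4 p_def[symmetric] ab_def[symmetric]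
    using N_pos[of z] T ab sp(2) by (simp add: field_simps)
qed

lemma V_unique:
  assumes V: "V z = V z'" and L: "L1 z * L1 z' > 0" "L2 z * L2 z' > 0"
  shows "sin (fst z) = sin (fst z')" "sin (snd z) = sin (snd z')" "cos (fst z) = cos (fst z')" "cos (snd z) = cos (snd z')"
proof -
  have q: "u / w = u' / w'" if "u\<^sup>2 / w\<^sup>2 = u'\<^sup>2 / w'\<^sup>2" "u * u' > 0" "w > 0" "w' > 0" for u u' w w' :: real
  proof -
    have "(u / w)\<^sup>2 = (u' / w')\<^sup>2" using that(1) by (simp add: power_divide)
    then have "u / w = u' / w' \<or> u / w = - (u' / w')" by (simp add: power2_eq_iff)
    moreover have "(u / w) * (u' / w') > 0" using that by simp
    ultimately show ?thesis by (smt (verit) mult_minus_left not_square_less_zero)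
  qed
  have "L1 z / d z = L1 z' / d z'" "L2 z / d z = L2 z' / d z'"
    using q[OF _ L(1) d_pos d_pos] q[OF _ L(2) d_pos d_pos] ellF_V[of z] ellF_V[of z'] V by simp_all
  then have "M1 * (cos (fst z) / d z) + M2 * (cos (snd z) / d z) = M1 * (cos (fst z') / d z') + M2 * (cos (snd z') / d z')"
    "M2 * (cos (fst z) / d z) + M1 * (cos (snd z) / d z) = M2 * (cos (fst z') / d z') + M1 * (cos (snd z') / d z')"
    by (simp_all add: L1_def L2_def add_divide_distrib)
  then have c: "cos (fst z) / d z = cos (fst z') / d z'" "cos (snd z) / d z = cos (snd z') / d z'"
    using two_by_two_unique M_squared_neq by blast+
  then have "t z / d z = t z' / d z'" unfolding t_def diff_divide_distrib by (metis times_divide_eq_right)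
  then have "(t z)\<^sup>2 / (d z)\<^sup>2 = (t z')\<^sup>2 / (d z')\<^sup>2" by (metis power_divide)
  \<comment> \<open>The quotient \<open>t / d\<close> is already known to agree at both points; this
    identity recovers \<open>d\<close> from it.\<close>
  moreover have "1 / (d w)\<^sup>2 = 1 + (t w)\<^sup>2 / (d w)\<^sup>2" for w
  proof -
    have "1 = (d w)\<^sup>2 + (t w)\<^sup>2" using d_squared[of w] by simp
    then show ?thesis using d_pos[of w] by (simp add: field_simps)
  qed
  ultimately have "1 / (d z)\<^sup>2 = 1 / (d z')\<^sup>2" by metis
  then have "(d z)\<^sup>2 = (d z')\<^sup>2" by simp
  then have dd: "d z = d z'" using d_pos[of z] d_pos[of z'] by (simp add: power2_eq_iff)
  then show "cos (fst z) = cos (fst z')" "cos (snd z) = cos (snd z')" using c d_pos[of z'] by auto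
  have "A z + B z = A z' + B z'" "A z - B z = A z' - B z'" using V d_pos[of z'] unfolding V_eq dd by auto
  then have "A z = A z'" "B z = B z'" by auto
  then show "sin (fst z) = sin (fst z')" "sin (snd z) = sin (snd z')" using pos by (auto simp: A_def B_def)
qed

text \<open>Surjectivity for a prescribed pair of signs. Only sines and cosines are produced, and
  the claim holds for all angles that realise them, because the angles are chosen afterwards inside
  a prescribed box.\<close>

lemma V_solution:
  assumes s: "s1 = 1 \<or> s1 = - 1" "s2 = 1 \<or> s2 = - 1" and F: "ellF a1 v \<ge> 0" "ellF a2 v \<ge> 0"
  obtains c1 c2 S1 S2 where "c1\<^sup>2 + S1\<^sup>2 = 1" "c2\<^sup>2 + S2\<^sup>2 = 1"
    "\<And>x y. cos x = c1 \<Longrightarrow> sin x = S1 \<Longrightarrow> cos y = c2 \<Longrightarrow> sin y = S2 \<Longrightarrow>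
       V (x, y) = v \<and> L1 (x, y) = s1 * sqrt (ellF a1 v) * d (x, y) \<and> L2 (x, y) = s2 * sqrt (ellF a2 v) * d (x, y)"
proof -
  define p q where "p = (fst v + snd v) / 2" and "q = (fst v - snd v) / 2"
  define u1 u2 where "u1 = s1 * sqrt (ellF a1 v)" and "u2 = s2 * sqrt (ellF a2 v)"
  define D where "D = M1\<^sup>2 - M2\<^sup>2"
  \<comment> \<open>Cramer's rule: \<open>g1\<close> and \<open>g2\<close> stand for the two cosines
    divided by \<open>d\<close>. Below, \<open>e\<close> stands for \<open>t / d\<close> and
    \<open>R\<close> for \<open>1 / d\<close>.\<close>
  define g1 g2 where "g1 = (M1 * u1 - M2 * u2) / D" and "g2 = (M1 * u2 - M2 * u1) / D"
  have D: "D \<noteq> 0" using M_squared_neq by (simp add: D_def)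
  have Dg: "D * g1 = M1 * u1 - M2 * u2" "D * g2 = M1 * u2 - M2 * u1" using D by (simp_all add: g1_def g2_def)
  have "D * (M1 * g1 + M2 * g2) = D * u1" "D * (M2 * g1 + M1 * g2) = D * u2"
    using Dg unfolding D_def by algebra+
  then have u: "u1 = M1 * g1 + M2 * g2" "u2 = M2 * g1 + M1 * g2" using D by simp_all
  define e where "e = a1 * a2 * g1 - b1 * b2 * g2"
  define R where "R = sqrt (1 + e\<^sup>2)"
  have R: "R > 0" "R\<^sup>2 = 1 + e\<^sup>2" by (simp_all add: R_def add_pos_nonneg)
  have "u1\<^sup>2 = ellF a1 v" "u2\<^sup>2 = ellF a2 v" using s F by (auto simp: u1_def u2_def power_mult_distrib)
  then have f: "u1\<^sup>2 = 1 - p\<^sup>2 / a1\<^sup>2 - q\<^sup>2 / b1\<^sup>2" "u2\<^sup>2 = 1 - p\<^sup>2 / a2\<^sup>2 - q\<^sup>2 / b2\<^sup>2"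
    by (simp_all add: ellF_def p_def q_def power_divide b1_def b2_def)
  have f': "a1\<^sup>2 * b1\<^sup>2 * u1\<^sup>2 = a1\<^sup>2 * b1\<^sup>2 - p\<^sup>2 * b1\<^sup>2 - q\<^sup>2 * a1\<^sup>2"
    "a2\<^sup>2 * b2\<^sup>2 * u2\<^sup>2 = a2\<^sup>2 * b2\<^sup>2 - p\<^sup>2 * b2\<^sup>2 - q\<^sup>2 * a2\<^sup>2"
    unfolding f using pos by (simp_all add: field_simps)
  \<comment> \<open>\<open>X\<close> and \<open>Y\<close> measure the failure of
    \<open>sin\<^sup>2 + cos\<^sup>2 = 1\<close> for the two candidate angles. The two ellipse
    equations become a homogeneous linear system for them with determinant \<open>D\<close>, up to
    sign, which is not 0.\<close>
  define X Y where "X = p\<^sup>2 - (a1 * a2)\<^sup>2 * (1 + e\<^sup>2 - g1\<^sup>2)" and "Y = q\<^sup>2 - (b1 * b2)\<^sup>2 * (1 + e\<^sup>2 - g2\<^sup>2)"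
  have i: "u1\<^sup>2 = a2\<^sup>2 * g1\<^sup>2 + b2\<^sup>2 * g2\<^sup>2 - e\<^sup>2" "u2\<^sup>2 = a1\<^sup>2 * g1\<^sup>2 + b1\<^sup>2 * g2\<^sup>2 - e\<^sup>2"
    unfolding u e_def M1_def M2_def using b_squared by algebra+
  have "X * b1\<^sup>2 + Y * a1\<^sup>2 = 0" using f'(1) b_squared unfolding X_def Y_def i by algebra
  moreover have "X * b2\<^sup>2 + Y * a2\<^sup>2 = 0" using f'(2) b_squared unfolding X_def Y_def i by algebra
  ultimately have "X * (a2\<^sup>2 * b1\<^sup>2 - a1\<^sup>2 * b2\<^sup>2) = 0" "Y * (a2\<^sup>2 * b1\<^sup>2 - a1\<^sup>2 * b2\<^sup>2) = 0" by algebra+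
  moreover have "a2\<^sup>2 * b1\<^sup>2 - a1\<^sup>2 * b2\<^sup>2 = D" by (simp add: D_def M1_def M2_def power_mult_distrib)
  ultimately have XY: "X = 0" "Y = 0" using D by auto
  have c1: "(g1 / R)\<^sup>2 + (- p / (a1 * a2 * R))\<^sup>2 = 1"
  proof -
    have "p\<^sup>2 = (a1 * a2)\<^sup>2 * (R\<^sup>2 - g1\<^sup>2)" using XY(1) R by (simp add: X_def)
    then show ?thesis using R(1) pos by (simp add: power_divide power_mult_distrib field_simps)
  qed
  have c2: "(g2 / R)\<^sup>2 + (- q / (b1 * b2 * R))\<^sup>2 = 1"
  proof -
    have "q\<^sup>2 = (b1 * b2)\<^sup>2 * (R\<^sup>2 - g2\<^sup>2)" using XY(2) R by (simp add: Y_def)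
    then show ?thesis using R(1) pos by (simp add: power_divide power_mult_distrib field_simps)
  qed
  show ?thesis
  proof (rule that[OF c1 c2])
    fix x y assume xy: "cos x = g1 / R" "sin x = - p / (a1 * a2 * R)" "cos y = g2 / R" "sin y = - q / (b1 * b2 * R)"
    have t: "t (x, y) = e / R" by (simp add: t_def xy e_def diff_divide_distrib)
    have "1 - (t (x, y))\<^sup>2 = (R\<^sup>2 - e\<^sup>2) / R\<^sup>2" unfolding t using R(1) by (simp add: power_divide diff_divide_distrib)
    then have "1 - (t (x, y))\<^sup>2 = (1 / R)\<^sup>2" using R(2) by (simp add: power_divide)
    then have d: "d (x, y) = 1 / R" using R(1) by (simp add: d_def)
    have AB: "A (x, y) = - p / R" "B (x, y) = - q / R" using pos by (simp_all add: A_def B_def xy)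
    have "V (x, y) = (p + q, p - q)" unfolding V_eq AB d using R(1) by (simp add: field_simps)
    then have "V (x, y) = v" by (simp add: p_def q_def prod_eq_iff field_simps)
    moreover have "L1 (x, y) = u1 * d (x, y)" "L2 (x, y) = u2 * d (x, y)"
      unfolding d by (simp_all add: L1_def L2_def xy u add_divide_distrib)
    ultimately show "V (x, y) = v \<and> L1 (x, y) = s1 * sqrt (ellF a1 v) * d (x, y) \<and> L2 (x, y) = s2 * sqrt (ellF a2 v) * d (x, y)"
      by (simp add: u1_def u2_def)
  qed
qed

end

section \<open>The eight momentum boxes and the angles they contain\<close>

definition Lboxes :: "nat \<Rightarrow> (real \<times> real) set" where
  "Lboxes \<mu> = (\<Union>n\<in>{1..4}. Lbox (n + 4 * \<mu>))"

lemma Lboxes_0: "Lboxes 0 = {- pi..pi} \<times> {- pi..pi}"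
proof -
  have "{1..4::nat} = {1, 2, 3, 4}" by auto
  then have "Lboxes 0 = {0..pi} \<times> {0..pi} \<union> {- pi..0} \<times> {0..pi} \<union> {- pi..0} \<times> {- pi..0} \<union> {0..pi} \<times> {- pi..0}"
    unfolding Lboxes_def Lbox_def by (simp add: numeral_eq_Suc Un_assoc)
  also have "\<dots> = ({- pi..0} \<union> {0..pi}) \<times> ({- pi..0} \<union> {0..pi})" by blast
  also have "{- pi..0} \<union> {0..pi} = {- pi..pi}" by (rule ivl_disj_un_two_touch) simp_all
  finally show ?thesis .
qed

lemma Lboxes_1: "Lboxes 1 = {- 2 * pi..- pi} \<times> {0..pi} \<union> {- pi..0} \<times> {- 2 * pi..- pi} \<union>
      {pi..2 * pi} \<times> {- pi..0} \<union> {0..pi} \<times> {pi..2 * pi}"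
proof -
  have "{1..4::nat} = {1, 2, 3, 4}" by auto
  then show ?thesis unfolding Lboxes_def Lbox_def by (auto simp: numeral_eq_Suc)
qed

lemma sin_shifted_sign:
  shows "- 2 * pi \<le> x \<Longrightarrow> x \<le> - pi \<Longrightarrow> 0 \<le> sin x"
    and "- pi \<le> x \<Longrightarrow> x \<le> 0 \<Longrightarrow> sin x \<le> 0"
    and "0 \<le> x \<Longrightarrow> x \<le> pi \<Longrightarrow> 0 \<le> sin x"
    and "pi \<le> x \<Longrightarrow> x \<le> 2 * pi \<Longrightarrow> sin x \<le> 0"
proof -
  show "- 2 * pi \<le> x \<Longrightarrow> x \<le> - pi \<Longrightarrow> 0 \<le> sin x" using sin_ge_zero[of "x + 2 * pi"] by simp
  show "- pi \<le> x \<Longrightarrow> x \<le> 0 \<Longrightarrow> sin x \<le> 0" using sin_ge_zero[of "- x"] by simp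
  show "0 \<le> x \<Longrightarrow> x \<le> pi \<Longrightarrow> 0 \<le> sin x" by (rule sin_ge_zero)
  show "pi \<le> x \<Longrightarrow> x \<le> 2 * pi \<Longrightarrow> sin x \<le> 0" using sin_ge_zero[of "x - pi"] by simp
qed

text \<open>In each of the four outer boxes both sines have constant sign, and the four sign
  patterns are different, so the signs single out the box.\<close>

lemma Lboxes_1_iff:
  assumes "sin (fst z) \<noteq> 0" "sin (snd z) \<noteq> 0"
  shows "z \<in> Lboxes 1 \<longleftrightarrow>
     (if sin (snd z) > 0 then (if sin (fst z) > 0 then fst z \<in> {- 2 * pi..- pi} \<and> snd z \<in> {0..pi} else fst z \<in> {- pi..0} \<and> snd z \<in> {- 2 * pi..- pi})
      else (if sin (fst z) > 0 then fst z \<in> {0..pi} \<and> snd z \<in> {pi..2 * pi} else fst z \<in> {pi..2 * pi} \<and> snd z \<in> {- pi..0}))"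
proof -
  note sg = sin_shifted_sign[of "fst z"] sin_shifted_sign[of "snd z"]
  show ?thesis unfolding Lboxes_1 using assms sg
    by (cases z) (auto simp: not_less)
qed

text \<open>Equal sines and cosines leave only multiples of \<open>2 * pi\<close>. In the central
  square the nonzero sines keep \<open>z\<close> off the edges; among the outer boxes equal signs
  put both points into the same box of side \<open>pi\<close>.\<close>

lemma Lboxes_unique:
  assumes \<mu>: "\<mu> \<in> {0, 1}" and z: "z \<in> Lboxes \<mu>" "z' \<in> Lboxes \<mu>"
    and nz: "sin (fst z) \<noteq> 0" "sin (snd z) \<noteq> 0"
    and eq: "sin (fst z) = sin (fst z')" "sin (snd z) = sin (snd z')" "cos (fst z) = cos (fst z')" "cos (snd z) = cos (snd z')"
  shows "z = z'"
proof -
  have "\<bar>fst z - fst z'\<bar> < 2 * pi \<and> \<bar>snd z - snd z'\<bar> < 2 * pi"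
  proof (cases "\<mu> = 0")
    case True
    have "fst z \<noteq> pi" "fst z \<noteq> - pi" "snd z \<noteq> pi" "snd z \<noteq> - pi" using nz by auto
    then show ?thesis using z unfolding True Lboxes_0 by (auto simp: mem_Times_iff)
  next
    case False
    then have \<mu>: "\<mu> = 1" using \<mu> by simp
    show ?thesis using z nz eq(1,2) pi_gt_zero unfolding \<mu>
      by (auto simp: Lboxes_1_iff simp del: pi_gt_zero One_nat_def split: if_splits)
  qed
  then show ?thesis using sin_cos_eq_imp_eq eq by (auto intro!: prod_eqI)
qed

lemma sin_cos_interval:
  assumes "c\<^sup>2 + s\<^sup>2 = (1::real)"
  obtains x where "u \<le> x" "x < u + 2 * pi" "cos x = c" "sin x = s"
proof -
  have "(c * cos u + s * sin u)\<^sup>2 + (s * cos u - c * sin u)\<^sup>2 = (c\<^sup>2 + s\<^sup>2) * ((cos u)\<^sup>2 + (sin u)\<^sup>2)" by algebra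
  also have "\<dots> = 1" using assms by simp
  finally obtain r where r: "0 \<le> r" "r < 2 * pi" "c * cos u + s * sin u = cos r" "s * cos u - c * sin u = sin r"
    using sincos_total_2pi by metis
  have cu: "(cos u)\<^sup>2 + (sin u)\<^sup>2 = 1" by simp
  have "cos (u + r) = c" "sin (u + r) = s"
    unfolding cos_add sin_add r(3)[symmetric] r(4)[symmetric] using cu by algebra+
  then show ?thesis using that[of "u + r"] r by simp
qed

lemma sin_sign_interval:
  shows "sin x > 0 \<Longrightarrow> - 2 * pi \<le> x \<Longrightarrow> x \<le> 0 \<Longrightarrow> x \<le> - pi"
    and "sin x < 0 \<Longrightarrow> - 2 * pi \<le> x \<Longrightarrow> x \<le> 0 \<Longrightarrow> - pi \<le> x"
    and "sin x > 0 \<Longrightarrow> 0 \<le> x \<Longrightarrow> x \<le> 2 * pi \<Longrightarrow> x \<le> pi"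
    and "sin x < 0 \<Longrightarrow> 0 \<le> x \<Longrightarrow> x \<le> 2 * pi \<Longrightarrow> pi \<le> x"
  using sin_shifted_sign[of x] by linarith+

lemma Lboxes_exists:
  assumes \<mu>: "\<mu> \<in> {0, 1}" and c: "c1\<^sup>2 + s1\<^sup>2 = 1" "c2\<^sup>2 + s2\<^sup>2 = 1" and nz: "s1 \<noteq> 0" "s2 \<noteq> 0"
  obtains z where "z \<in> Lboxes \<mu>" "cos (fst z) = c1" "sin (fst z) = s1" "cos (snd z) = c2" "sin (snd z) = s2"
proof (cases "\<mu> = 0")
  case True
  obtain x where x: "- pi \<le> x" "x < - pi + 2 * pi" "cos x = c1" "sin x = s1" using sin_cos_interval[OF c(1), of "- pi"] .
  obtain y where y: "- pi \<le> y" "y < - pi + 2 * pi" "cos y = c2" "sin y = s2" using sin_cos_interval[OF c(2), of "- pi"] .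
  show ?thesis using that[of "(x, y)"] x y unfolding True Lboxes_0 by auto
next
  case False
  then have \<mu>: "\<mu> = 1" using \<mu> by simp
  \<comment> \<open>\<open>u\<close> and \<open>w\<close> are the left ends of windows of length
    \<open>2 * pi\<close>. The signs of \<open>s1\<close> and \<open>s2\<close> determine the outer
    box, and inside its windows the signs of the sines cut the angles down to that box.\<close>
  define u where "u = (if s1 > 0 \<longleftrightarrow> s2 > 0 then (if s1 > 0 then - 2 * pi else 0) else (if s1 > 0 then 0 else - 2 * pi))"
  define w where "w = (if s1 > 0 \<longleftrightarrow> s2 > 0 then (if s1 > 0 then 0 else - 2 * pi) else (if s1 > 0 then 0 else - 2 * pi))"
  obtain x where x: "u \<le> x" "x < u + 2 * pi" "cos x = c1" "sin x = s1" using sin_cos_interval[OF c(1), of u] .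
  obtain y where y: "w \<le> y" "y < w + 2 * pi" "cos y = c2" "sin y = s2" using sin_cos_interval[OF c(2), of w] .
  have "(x, y) \<in> Lboxes 1"
    using x y nz sin_sign_interval[of x] sin_sign_interval[of y]
    by (subst Lboxes_1_iff) (auto simp: u_def w_def split: if_splits)
  then show ?thesis using that[of "(x, y)"] x y \<mu> by auto
qed

text \<open>The sign of \<open>L1\<close> on the branch: \<open>\<nu> = 0\<close> selects the
  regions \<open>Creg\<close> with index 1 or 2, where \<open>L1\<close> is negative, and
  \<open>\<nu> = 1\<close> those with index 3 or 4.\<close>

definition branch_sign :: "nat \<Rightarrow> real" where "branch_sign \<nu> = (if \<nu> = 0 then - 1 else 1)"

section \<open>The velocity map on the branch regions\<close>

context walk
begin

text \<open>In the coordinates \<open>(l1 k, l2 k)\<close> this is \<open>Kreg\<close> without the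
  null set where a sine or one of \<open>L1\<close>, \<open>L2\<close> vanishes. On what remains
  \<open>V\<close> is injective without exception.\<close>

definition region :: "real \<Rightarrow> nat \<times> nat \<Rightarrow> (real \<times> real) set" where
  "region s lam = {z \<in> Lboxes (fst lam). sin (fst z) \<noteq> 0 \<and> sin (snd z) \<noteq> 0 \<and>
     branch_sign (snd lam) * L1 z > 0 \<and> s * branch_sign (snd lam) * L2 z > 0}"

text \<open>The sign of \<open>phi = L1 * L2\<close> tells whether \<open>L1\<close> and
  \<open>L2\<close> agree in sign; the side conditions decide which of the two remaining patterns
  holds. For this, \<open>c1 + c2\<close> has the sign of \<open>L1 + L2\<close>, and solving the
  linear system shows that \<open>c1\<close> has the sign of \<open>M1 * l1 - M2 * l2\<close>, and
  \<open>c2\<close> that of \<open>M1 * l2 - M2 * l1\<close>.\<close>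

lemma Creg_iff:
  assumes nz: "L1 z \<noteq> 0" "L2 z \<noteq> 0" and \<nu>: "\<nu> \<in> {0, 1}" and s: "s \<in> {1, - 1}"
  shows "(cos (fst z), cos (snd z)) \<in> Creg (a1 * a2) (sb a1 * sb a2) (2 * (\<nu> + 1) - (if s = 1 then 0 else 1))
     \<longleftrightarrow> branch_sign \<nu> * L1 z > 0 \<and> s * branch_sign \<nu> * L2 z > 0"
proof -
  define c1 c2 l1 l2 where "c1 = cos (fst z)" and "c2 = cos (snd z)" and "l1 = L1 z" and "l2 = L2 z"
  have nz': "l1 \<noteq> 0" "l2 \<noteq> 0" using nz by (simp_all add: l1_def l2_def)
  have box: "(c1, c2) \<in> {- 1..1} \<times> {- 1..1}" by (simp add: c1_def c2_def)
  have ph: "phi (a1 * a2) (sb a1 * sb a2) (c1, c2) = l1 * l2"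
    using phi_eq[of z] by (simp add: c1_def c2_def l1_def l2_def b1_def b2_def)
  have D: "M1\<^sup>2 - M2\<^sup>2 > 0" using M_less by (simp add: power_strict_mono)
  have M: "M1 > 0" "M2 > 0" using M_less by simp_all
  have sum: "l1 + l2 = (M1 + M2) * (c1 + c2)" and
    c1: "(M1\<^sup>2 - M2\<^sup>2) * c1 = M1 * l1 - M2 * l2" and c2: "(M1\<^sup>2 - M2\<^sup>2) * c2 = M1 * l2 - M2 * l1"
    by (simp_all add: l1_def l2_def c1_def c2_def L1_def L2_def power2_eq_square algebra_simps)
  have sg: "c1 + c2 \<le> 0 \<longleftrightarrow> l1 + l2 \<le> 0" "c1 + c2 \<ge> 0 \<longleftrightarrow> l1 + l2 \<ge> 0"
    unfolding sum using M by (auto simp: mult_le_0_iff zero_le_mult_iff)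
  have sc: "c1 \<le> 0 \<longleftrightarrow> M1 * l1 \<le> M2 * l2" "c2 \<le> 0 \<longleftrightarrow> M1 * l2 \<le> M2 * l1"
    "c1 \<ge> 0 \<longleftrightarrow> M1 * l1 \<ge> M2 * l2" "c2 \<ge> 0 \<longleftrightarrow> M1 * l2 \<ge> M2 * l1"
  proof -
    have "c1 \<le> 0 \<longleftrightarrow> (M1\<^sup>2 - M2\<^sup>2) * c1 \<le> 0" "c2 \<le> 0 \<longleftrightarrow> (M1\<^sup>2 - M2\<^sup>2) * c2 \<le> 0"
      "c1 \<ge> 0 \<longleftrightarrow> (M1\<^sup>2 - M2\<^sup>2) * c1 \<ge> 0" "c2 \<ge> 0 \<longleftrightarrow> (M1\<^sup>2 - M2\<^sup>2) * c2 \<ge> 0"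
      using D by (auto simp: mult_le_0_iff zero_le_mult_iff)
    then show "c1 \<le> 0 \<longleftrightarrow> M1 * l1 \<le> M2 * l2" "c2 \<le> 0 \<longleftrightarrow> M1 * l2 \<le> M2 * l1"
      "c1 \<ge> 0 \<longleftrightarrow> M1 * l1 \<ge> M2 * l2" "c2 \<ge> 0 \<longleftrightarrow> M1 * l2 \<ge> M2 * l1"
      unfolding c1 c2 by auto
  qed
  have m1: "l1 * l2 \<le> 0 \<and> c1 \<le> 0 \<and> 0 \<le> c2 \<longleftrightarrow> l1 < 0 \<and> l2 > 0"
  proof
    assume h: "l1 * l2 \<le> 0 \<and> c1 \<le> 0 \<and> 0 \<le> c2"
    show "l1 < 0 \<and> l2 > 0"
    proof (rule ccontr)
      assume "\<not> (l1 < 0 \<and> l2 > 0)"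
      then have "l1 > 0" "l2 < 0" using h nz' by (auto simp: mult_le_0_iff)
      then have "M1 * l1 > 0" "M2 * l2 < 0" using M by (simp_all add: mult_pos_neg)
      then show False using h sc(1) by linarith
    qed
  next
    assume h: "l1 < 0 \<and> l2 > 0"
    then have "M1 * l1 < 0" "M2 * l2 > 0" "M2 * l1 < 0" "M1 * l2 > 0" using M by (simp_all add: mult_pos_neg)
    then show "l1 * l2 \<le> 0 \<and> c1 \<le> 0 \<and> 0 \<le> c2" using h sc by (auto simp: mult_le_0_iff)
  qed
  have m3: "l1 * l2 \<le> 0 \<and> c2 \<le> 0 \<and> 0 \<le> c1 \<longleftrightarrow> l1 > 0 \<and> l2 < 0"
  proof
    assume h: "l1 * l2 \<le> 0 \<and> c2 \<le> 0 \<and> 0 \<le> c1"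
    show "l1 > 0 \<and> l2 < 0"
    proof (rule ccontr)
      assume "\<not> (l1 > 0 \<and> l2 < 0)"
      then have "l1 < 0" "l2 > 0" using h nz' by (auto simp: mult_le_0_iff)
      then have "M1 * l1 < 0" "M2 * l2 > 0" using M by (simp_all add: mult_pos_neg)
      then show False using h sc(3) by linarith
    qed
  next
    assume h: "l1 > 0 \<and> l2 < 0"
    then have "M1 * l1 > 0" "M2 * l2 < 0" "M2 * l1 > 0" "M1 * l2 < 0" using M by (simp_all add: mult_pos_neg)
    then show "l1 * l2 \<le> 0 \<and> c2 \<le> 0 \<and> 0 \<le> c1" using h sc by (auto simp: mult_le_0_iff)
  qed
  have m2: "l1 * l2 \<ge> 0 \<and> c1 + c2 \<le> 0 \<longleftrightarrow> l1 < 0 \<and> l2 < 0" unfolding sg using nz' by (auto simp: zero_le_mult_iff)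
  have m4: "l1 * l2 \<ge> 0 \<and> c1 + c2 \<ge> 0 \<longleftrightarrow> l1 > 0 \<and> l2 > 0" unfolding sg using nz' by (auto simp: zero_le_mult_iff)
  show ?thesis unfolding c1_def[symmetric] c2_def[symmetric] l1_def[symmetric] l2_def[symmetric]
  proof -
    from \<nu> s consider "\<nu> = 0" "s = 1" | "\<nu> = 0" "s = - 1" | "\<nu> = 1" "s = 1" | "\<nu> = 1" "s = - 1" by blast
    then show "(c1, c2) \<in> Creg (a1 * a2) (sb a1 * sb a2) (2 * (\<nu> + 1) - (if s = 1 then 0 else 1)) \<longleftrightarrow> branch_sign \<nu> * l1 > 0 \<and> s * branch_sign \<nu> * l2 > 0"
      by cases (use m1 m2 m3 m4 box in \<open>simp_all add: Creg_def ph branch_sign_def\<close>)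
  qed
qed

lemma Kreg_iff: "k \<in> Kreg a1 a2 \<mu> \<nu> \<xi> \<longleftrightarrow> (l1 k, l2 k) \<in> Lboxes \<mu> \<and>
    (cos (l1 k), cos (l2 k)) \<in> Creg (a1 * a2) (sb a1 * sb a2) (2 * (\<nu> + 1) - \<xi>)"
proof -
  have "k \<in> Kbox n \<longleftrightarrow> (l1 k, l2 k) \<in> Lbox n" for n
    unfolding Kbox_eq by (metis image_iff inj_image_mem_iff inj_momentum momentum_l)
  then show ?thesis by (auto simp: Kreg_def Lboxes_def)
qed

text \<open>\<open>Kreg\<close> contains its boundary, so \<open>inv_into\<close> could have picked
  a different preimage. But the common velocity has nonzero \<open>ellF\<close>, hence the picked
  point has nonzero \<open>L1\<close> and \<open>L2\<close>, lies in the same sign pattern, and is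
  forced to be \<open>z\<close>.\<close>

lemma kbranch_V:
  assumes z: "z \<in> region s lam" and lam: "fst lam \<in> {0, 1}" "snd lam \<in> {0, 1}" and s: "s \<in> {1, - 1}"
  shows "kbranch a1 a2 s lam (V z) = momentum z"
proof -
  let ?K = "Kreg a1 a2 (fst lam) (snd lam) (if s = 1 then 0 else 1)"
  have nz: "L1 z \<noteq> 0" "L2 z \<noteq> 0" using z by (auto simp: region_def)
  have "momentum z \<in> ?K" using z Creg_iff[OF nz lam(2) s] by (simp add: Kreg_iff region_def)
  then have im: "V z \<in> vel a1 a2 ` ?K" by (auto simp: V_def)
  define y where "y = kbranch a1 a2 s lam (V z)"
  define z' where "z' = (l1 y, l2 y)"
  have y: "y \<in> ?K" "vel a1 a2 y = V z"
    unfolding y_def kbranch_def using im by (rule inv_into_into, rule f_inv_into_f)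
  have kz': "momentum z' = y" by (simp add: z'_def momentum_l)
  have V: "V z' = V z" using y kz' by (simp add: V_def)
  have "(L1 z')\<^sup>2 / (d z')\<^sup>2 \<noteq> 0" "(L2 z')\<^sup>2 / (d z')\<^sup>2 \<noteq> 0"
    unfolding ellF_V[symmetric] V unfolding ellF_V using nz d_pos[of z] by auto
  then have nz': "L1 z' \<noteq> 0" "L2 z' \<noteq> 0" by auto
  have sg': "branch_sign (snd lam) * L1 z' > 0" "s * branch_sign (snd lam) * L2 z' > 0" and box: "z' \<in> Lboxes (fst lam)"
    using y(1) Creg_iff[OF nz' lam(2) s] by (auto simp: Kreg_iff z'_def)
  have "L1 z' * L1 z > 0" "L2 z' * L2 z > 0"
    using sg' z s by (auto simp: region_def branch_sign_def zero_less_mult_iff split: if_splits)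
  then have "sin (fst z) = sin (fst z')" "sin (snd z) = sin (snd z')" "cos (fst z) = cos (fst z')" "cos (snd z) = cos (snd z')"
    using V_unique[OF V] by auto
  then have "z = z'" using z box by (intro Lboxes_unique[OF lam(1)]) (auto simp: region_def)
  then show ?thesis using kz' y_def by simp
qed

text \<open>The excluded lines \<open>fst v = - snd v\<close> and \<open>fst v = snd v\<close> are
  the velocities at which one of the two sines vanishes.\<close>

definition velocity_region :: "(real \<times> real) set" where
  "velocity_region = {v. ellF a1 v > 0 \<and> ellF a2 v > 0 \<and> fst v + snd v \<noteq> 0 \<and> fst v - snd v \<noteq> 0}"

text \<open>The image is the same for every branch, which is what lets all branches contribute to
  one density.\<close>

lemma V_region:
  assumes lam: "fst lam \<in> {0, 1}" "snd lam \<in> {0, 1}" and s: "s \<in> {1, - 1}"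
  shows "V ` region s lam = velocity_region"
proof (intro set_eqI iffI)
  fix v assume "v \<in> V ` region s lam"
  then obtain z where z: "z \<in> region s lam" "v = V z" by auto
  have "L1 z \<noteq> 0" "L2 z \<noteq> 0" "A z \<noteq> 0" "B z \<noteq> 0" using z(1) pos by (auto simp: region_def A_def B_def)
  moreover have "fst (V z) + snd (V z) = - 2 * A z / d z" "fst (V z) - snd (V z) = - 2 * B z / d z"
    using d_pos[of z] by (simp_all add: V_eq field_simps)
  ultimately show "v \<in> velocity_region" unfolding z(2) velocity_region_def using d_pos[of z] by (auto simp: ellF_V)
next
  fix v assume v: "v \<in> velocity_region"
  obtain c1 c2 S1 S2 where c: "c1\<^sup>2 + S1\<^sup>2 = 1" "c2\<^sup>2 + S2\<^sup>2 = 1" and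
    sol: "\<And>x y. cos x = c1 \<Longrightarrow> sin x = S1 \<Longrightarrow> cos y = c2 \<Longrightarrow> sin y = S2 \<Longrightarrow>
       V (x, y) = v \<and> L1 (x, y) = branch_sign (snd lam) * sqrt (ellF a1 v) * d (x, y) \<and> L2 (x, y) = (s * branch_sign (snd lam)) * sqrt (ellF a2 v) * d (x, y)"
    by (rule V_solution[of "branch_sign (snd lam)" "s * branch_sign (snd lam)" v]) (use v s in \<open>auto simp: velocity_region_def branch_sign_def\<close>)
  obtain x y where xy: "cos x = c1" "sin x = S1" "cos y = c2" "sin y = S2"
    using sin_cos_interval[OF c(1)] sin_cos_interval[OF c(2)] by metis
  have Vxy: "V (x, y) = v" using sol[OF xy] by simp
  have "S1 \<noteq> 0" "S2 \<noteq> 0"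
    using v d_pos[of "(x, y)"] unfolding velocity_region_def Vxy[symmetric] V_eq by (auto simp: A_def B_def xy)
  then obtain z where z: "z \<in> Lboxes (fst lam)" "cos (fst z) = c1" "sin (fst z) = S1" "cos (snd z) = c2" "sin (snd z) = S2"
    using Lboxes_exists[OF lam(1) c] by metis
  have s': "V z = v" "L1 z = branch_sign (snd lam) * sqrt (ellF a1 v) * d z" "L2 z = (s * branch_sign (snd lam)) * sqrt (ellF a2 v) * d z"
    using sol[OF z(2-5)] by simp_all
  have sq: "branch_sign (snd lam) * branch_sign (snd lam) = 1" "s * s = 1" using s by (auto simp: branch_sign_def)
  have "branch_sign (snd lam) * L1 z = (branch_sign (snd lam) * branch_sign (snd lam)) * (sqrt (ellF a1 v) * d z)"
    "s * branch_sign (snd lam) * L2 z = (s * s) * (branch_sign (snd lam) * branch_sign (snd lam)) * (sqrt (ellF a2 v) * d z)"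
    unfolding s'(2,3) by (simp_all add: algebra_simps)
  then have "branch_sign (snd lam) * L1 z > 0" "s * branch_sign (snd lam) * L2 z > 0"
    unfolding sq using v d_pos[of z] by (simp_all add: velocity_region_def)
  then have "z \<in> region s lam" using z \<open>S1 \<noteq> 0\<close> \<open>S2 \<noteq> 0\<close> by (simp add: region_def)
  then show "v \<in> V ` region s lam" using s'(1) by force
qed

lemma inj_on_V_region:
  assumes lam: "fst lam \<in> {0, 1}" "snd lam \<in> {0, 1}" and s: "s \<in> {1, - 1}"
  shows "inj_on V (region s lam)"
  by (rule inj_onI) (metis kbranch_V[OF _ lam s] l1_momentum l2_momentum prod_eqI)

section \<open>The differential of the velocity map\<close>

lemma d_has_derivative:
  "(d has_derivative (\<lambda>h. (t z * A z * fst h - t z * B z * snd h) / d z)) (at z within S)"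
proof -
  have t: "(t has_derivative (\<lambda>h. - A z * fst h + B z * snd h)) (at z within S)"
    unfolding t_def A_def B_def by (auto intro!: derivative_eq_intros)
  have "((\<lambda>z. 1 - (t z)\<^sup>2) has_derivative (\<lambda>h. - (2 * (- A z * fst h + B z * snd h) * t z))) (at z within S)"
    by (rule derivative_eq_intros t refl)+ (auto simp: fun_eq_iff)
  moreover have "1 - (t z)\<^sup>2 > 0" using abs_t[of z] by (simp add: abs_square_less_1)
  ultimately have "((\<lambda>z. sqrt (1 - (t z)\<^sup>2)) has_derivative
      (\<lambda>h. - (2 * (- A z * fst h + B z * snd h) * t z) * (inverse (sqrt (1 - (t z)\<^sup>2)) / 2))) (at z within S)"
    by (intro has_derivative_real_sqrt)
  then show ?thesis unfolding d_def[symmetric]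
    by (rule has_derivative_eq_rhs) (use d_pos[of z] in \<open>simp add: fun_eq_iff field_simps\<close>)
qed

lemma V_has_derivative:
  "(V has_derivative (\<lambda>h.
     ((- (a1 * a2 * cos (fst z) / d z - t z * (A z + B z) * A z / (d z)^3)) * fst h +
      (- (b1 * b2 * cos (snd z) / d z + t z * (A z + B z) * B z / (d z)^3)) * snd h,
      (- (a1 * a2 * cos (fst z) / d z - t z * (A z - B z) * A z / (d z)^3)) * fst h +
      (- (- b1 * b2 * cos (snd z) / d z + t z * (A z - B z) * B z / (d z)^3)) * snd h))) (at z within S)"
proof -
  have A': "(A has_derivative (\<lambda>h. a1 * a2 * cos (fst z) * fst h)) (at z within S)"
    unfolding A_def by (auto intro!: derivative_eq_intros)
  have B': "(B has_derivative (\<lambda>h. b1 * b2 * cos (snd z) * snd h)) (at z within S)"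
    unfolding B_def by (auto intro!: derivative_eq_intros)
  have dz: "d z \<noteq> 0" using d_pos[of z] by simp
  have 1: "((\<lambda>z. - (A z + B z) / d z) has_derivative (\<lambda>h. (- (a1 * a2 * cos (fst z) / d z - t z * (A z + B z) * A z / (d z)^3)) * fst h +
      (- (b1 * b2 * cos (snd z) / d z + t z * (A z + B z) * B z / (d z)^3)) * snd h)) (at z within S)"
    by (rule has_derivative_eq_rhs[OF has_derivative_divide'[OF has_derivative_minus[OF has_derivative_add[OF A' B']] d_has_derivative dz]])
      (use dz in \<open>simp add: fun_eq_iff power3_eq_cube field_simps\<close>)
  have 2: "((\<lambda>z. - (A z - B z) / d z) has_derivative (\<lambda>h. (- (a1 * a2 * cos (fst z) / d z - t z * (A z - B z) * A z / (d z)^3)) * fst h +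
      (- (- b1 * b2 * cos (snd z) / d z + t z * (A z - B z) * B z / (d z)^3)) * snd h)) (at z within S)"
    by (rule has_derivative_eq_rhs[OF has_derivative_divide'[OF has_derivative_minus[OF has_derivative_diff[OF A' B']] d_has_derivative dz]])
      (use dz in \<open>simp add: fun_eq_iff power3_eq_cube field_simps\<close>)
  have "V = (\<lambda>z. (- (A z + B z) / d z, - (A z - B z) / d z))" using V_eq by auto
  then show ?thesis using has_derivative_Pair[OF 1 2] by simp
qed

end

section \<open>Exceptional null sets in the plane\<close>

lemma countable_cos_eq: "countable {x :: real. cos x = c}"
proof -
  have c: "countable {x :: real. cos x = c \<and> sin x = s}" for s
  proof (cases "{x :: real. cos x = c \<and> sin x = s} = {}")
    case True
    then show ?thesis by (simp only: countable_empty)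
  next
    case False
    then obtain x0 where x0: "cos x0 = c" "sin x0 = s" by auto
    have "{x. cos x = c \<and> sin x = s} \<subseteq> range (\<lambda>n :: int. x0 + 2 * pi * of_int n)"
      using x0 sin_cos_eq_iff by fastforce
    then show ?thesis by (rule countable_subset) simp
  qed
  have "{x. cos x = c} \<subseteq> {x. cos x = c \<and> sin x = sqrt (1 - c\<^sup>2)} \<union> {x. cos x = c \<and> sin x = - sqrt (1 - c\<^sup>2)}"
  proof
    fix x :: real assume "x \<in> {x. cos x = c}"
    then have "(sin x)\<^sup>2 = 1 - c\<^sup>2" by (simp add: sin_squared_eq)
    then have "\<bar>sin x\<bar> = sqrt (1 - c\<^sup>2)" by (metis real_sqrt_abs)
    then show "x \<in> {x. cos x = c \<and> sin x = sqrt (1 - c\<^sup>2)} \<union> {x. cos x = c \<and> sin x = - sqrt (1 - c\<^sup>2)}"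
      using \<open>x \<in> _\<close> by auto
  qed
  then show ?thesis by (rule countable_subset) (intro countable_Un c)
qed

lemma countable_sin_eq_0: "countable {x :: real. sin x = 0}"
proof -
  have "{x :: real. sin x = 0} \<subseteq> range (\<lambda>i :: int. of_int i * pi)" by (auto simp: sin_zero_iff_int2)
  then show ?thesis by (rule countable_subset) simp
qed

text \<open>Countable sections have length 0, so Fubini gives area 0. The zero sets of the sines and
  of \<open>L1\<close>, \<open>L2\<close> have countable sections.\<close>

lemma AE_plane_fst:
  fixes P :: "real \<times> real \<Rightarrow> bool"
  assumes S: "{z. P z} \<in> sets borel" and c: "\<And>y. countable {x. P (x, y)}"
  shows "AE z in lborel. \<not> P z"
proof -
  have S': "{z. P z} \<in> sets (lborel \<Otimes>\<^sub>M lborel)" unfolding lborel_prod using S by simp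
  have "emeasure (lborel \<Otimes>\<^sub>M lborel) {z. P z} = (\<integral>\<^sup>+ y. emeasure lborel ((\<lambda>x. (x, y)) -` {z. P z}) \<partial>lborel)"
    by (rule lborel_pair.emeasure_pair_measure_alt2[OF S'])
  also have "\<dots> = 0" using c by (simp add: vimage_def emeasure_lborel_countable)
  finally have "emeasure lborel {z. P z} = 0" by (simp add: lborel_prod)
  then show ?thesis using S by (intro AE_I[of _ _ "{z. P z}"]) auto
qed

lemma AE_plane_snd:
  fixes P :: "real \<times> real \<Rightarrow> bool"
  assumes S: "{z. P z} \<in> sets borel" and c: "\<And>x. countable {y. P (x, y)}"
  shows "AE z in lborel. \<not> P z"
proof -
  have S': "{z. P z} \<in> sets (lborel \<Otimes>\<^sub>M lborel)" unfolding lborel_prod using S by simp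
  have "emeasure (lborel \<Otimes>\<^sub>M lborel) {z. P z} = (\<integral>\<^sup>+ x. emeasure lborel (Pair x -` {z. P z}) \<partial>lborel)"
    by (rule lborel.emeasure_pair_measure_alt[OF S'])
  also have "\<dots> = 0" using c by (simp add: vimage_def emeasure_lborel_countable)
  finally have "emeasure lborel {z. P z} = 0" by (simp add: lborel_prod)
  then show ?thesis using S by (intro AE_I[of _ _ "{z. P z}"]) auto
qed

lemma closed_Lboxes: "\<mu> \<in> {0, 1} \<Longrightarrow> closed (Lboxes \<mu>)"
  by (auto simp: Lboxes_0 Lboxes_1 simp del: One_nat_def intro!: closed_Un closed_Times)

section \<open>Integrals over one branch and over all branches\<close>

context walk
begin

lemma continuous_on_L: "continuous_on S L1" "continuous_on S L2"
  unfolding L1_def L2_def by (intro continuous_intros)+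

lemma region_borel: "fst lam \<in> {0, 1} \<Longrightarrow> region s lam \<in> sets borel"
proof -
  assume lam: "fst lam \<in> {0, 1}"
  have "region s lam = Lboxes (fst lam) \<inter> ({z. sin (fst z) \<noteq> 0} \<inter> {z. sin (snd z) \<noteq> 0} \<inter>
     {z. 0 < branch_sign (snd lam) * L1 z} \<inter> {z. 0 < s * branch_sign (snd lam) * L2 z})"
    by (auto simp: region_def)
  moreover have "open {z :: real \<times> real. sin (fst z) \<noteq> 0}" "open {z :: real \<times> real. sin (snd z) \<noteq> 0}"
    "open {z. 0 < branch_sign (snd lam) * L1 z}" "open {z. 0 < s * branch_sign (snd lam) * L2 z}"
    by (intro open_Collect_neq open_Collect_less continuous_intros continuous_on_L)+
  ultimately show ?thesis using closed_Lboxes[OF lam] by (auto intro!: sets.Int)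
qed

lemma ellF_scale: "\<tau> \<in> {1, - 1} \<Longrightarrow> ellF c (\<tau> *\<^sub>R v) = ellF c v"
proof -
  assume "\<tau> \<in> {1, - 1}"
  moreover have "(- fst v - snd v)\<^sup>2 = (fst v + snd v)\<^sup>2" "(- fst v + snd v)\<^sup>2 = (fst v - snd v)\<^sup>2"
    by (simp_all add: power2_eq_square algebra_simps)
  ultimately show ?thesis by (auto simp: ellF_def)
qed

text \<open>For the eigenvalue with \<open>\<tau> = - 1\<close> the branches are evaluated at
  \<open>- v\<close>, so the change of variables is reflected there; \<open>fpm\<close> is even and
  does not notice.\<close>

lemma fpm_scale: "\<tau> \<in> {1, - 1} \<Longrightarrow> fpm c1 c2 s (\<tau> *\<^sub>R v) = fpm c1 c2 s v"
proof -
  assume t: "\<tau> \<in> {1, - 1}"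
  have "(- fst v - snd v)\<^sup>2 = (fst v + snd v)\<^sup>2" "(- fst v + snd v)\<^sup>2 = (fst v - snd v)\<^sup>2"
    by (simp_all add: power2_eq_square algebra_simps)
  then have "F0 c1 c2 (\<tau> *\<^sub>R v) = F0 c1 c2 v" using t by (auto simp: F0_def Let_def)
  moreover have "indicator (ellE c1 \<inter> ellE c2) (\<tau> *\<^sub>R v) = (indicator (ellE c1 \<inter> ellE c2) v :: real)"
    unfolding indicator_def ellE_def using ellF_scale[OF t] by simp
  moreover have "(fst (\<tau> *\<^sub>R v))\<^sup>2 = (fst v)\<^sup>2" "(snd (\<tau> *\<^sub>R v))\<^sup>2 = (snd v)\<^sup>2" using t by auto
  ultimately show ?thesis unfolding fpm_def Let_def ellF_scale[OF t] by simp
qed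

text \<open>The part of the differential that comes from differentiating \<open>d\<close> has rank
  one. Its determinant therefore vanishes, no term with \<open>d\<close> to the power 6 survives in
  the denominator, and the remaining numerator is \<open>phi\<close> up to the factor
  \<open>2ab\<close>.\<close>

lemma V_det:
  "(- (a1 * a2 * cos (fst z) / d z - t z * (A z + B z) * A z / (d z)^3)) * (- (- b1 * b2 * cos (snd z) / d z + t z * (A z - B z) * B z / (d z)^3))
   - (- (b1 * b2 * cos (snd z) / d z + t z * (A z + B z) * B z / (d z)^3)) * (- (a1 * a2 * cos (fst z) / d z - t z * (A z - B z) * A z / (d z)^3))
   = - (2 * (a1 * a2 * (b1 * b2)) * (L1 z * L2 z) / (d z)^4)"
proof -
  define \<alpha> \<beta> where "\<alpha> = a1 * a2 * cos (fst z)" and "\<beta> = b1 * b2 * cos (snd z)"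
  have s: "(sin (fst z))\<^sup>2 = 1 - (cos (fst z))\<^sup>2" "(sin (snd z))\<^sup>2 = 1 - (cos (snd z))\<^sup>2"
    by (simp_all add: sin_squared_eq)
  have dz: "d z \<noteq> 0" using d_pos[of z] by simp
  have A2: "(A z)\<^sup>2 = (a1 * a2)\<^sup>2 * (1 - (cos (fst z))\<^sup>2)" and B2: "(B z)\<^sup>2 = (b1 * b2)\<^sup>2 * (1 - (cos (snd z))\<^sup>2)"
    unfolding A_def B_def power_mult_distrib s by simp_all
  have "a1 * a2 * (b1 * b2) * (L1 z * L2 z) = \<alpha> * \<beta> * (d z)\<^sup>2 + t z * (\<alpha> * (B z)\<^sup>2 - \<beta> * (A z)\<^sup>2)"
    unfolding A2 B2 d_squared \<alpha>_def \<beta>_def phi_eq[symmetric] phi_def fst_conv snd_conv t_def by algebra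
  then have e: "2 * (a1 * a2 * (b1 * b2) * (L1 z * L2 z)) = 2 * (\<alpha> * \<beta> * (d z)\<^sup>2 + t z * (\<alpha> * (B z)\<^sup>2 - \<beta> * (A z)\<^sup>2))" by simp
  have "(- (\<alpha> / d z - t z * (A z + B z) * A z / (d z)^3)) * (- (- \<beta> / d z + t z * (A z - B z) * B z / (d z)^3))
   - (- (\<beta> / d z + t z * (A z + B z) * B z / (d z)^3)) * (- (\<alpha> / d z - t z * (A z - B z) * A z / (d z)^3))
   = - (2 * (a1 * a2 * (b1 * b2) * (L1 z * L2 z)) / (d z)^4)"
    unfolding e using dz by (simp add: field_simps power2_eq_square power3_eq_cube power4_eq_xxxx)
  then show ?thesis by (simp add: \<alpha>_def \<beta>_def mult.assoc)
qed

text \<open>The weight \<open>u\<close> is an arbitrary function of the momentum: after the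
  substitution \<open>fpm\<close> and the Jacobian leave only the constant of \<open>fpm_V\<close>,
  and \<open>kbranch\<close> undoes \<open>V\<close>.\<close>

lemma branch_integral:
  fixes g u :: "real \<times> real \<Rightarrow> real"
  assumes lam: "fst lam \<in> {0, 1}" "snd lam \<in> {0, 1}" and s: "s \<in> {1, - 1}" and \<tau>: "\<tau> \<in> {1, - 1}"
    and int: "set_integrable lebesgue (region s lam) (\<lambda>z. g (\<tau> *\<^sub>R V z) * u (momentum z))"
  shows "set_integrable lebesgue (ellE a1 \<inter> ellE a2) (\<lambda>v. g v * (u (kbranch a1 a2 s lam (\<tau> *\<^sub>R v)) * fpm a1 a2 s v))"
    and "(LINT v:ellE a1 \<inter> ellE a2|lebesgue. g v * (u (kbranch a1 a2 s lam (\<tau> *\<^sub>R v)) * fpm a1 a2 s v)) =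
       1 / (2 * pi\<^sup>2) * (LINT z:region s lam|lebesgue. g (\<tau> *\<^sub>R V z) * u (momentum z))"
proof -
  define f where "f v = g v * (u (kbranch a1 a2 s lam (\<tau> *\<^sub>R v)) * fpm a1 a2 s v)" for v
  \<comment> \<open>The entries of the differential of \<open>\<tau> *\<^sub>R V\<close>; since
    \<open>\<tau> * \<tau> = 1\<close>, its determinant is that of \<open>V\<close>.\<close>
  define J11 J12 J21 J22 where
    "J11 z = \<tau> * (- (a1 * a2 * cos (fst z) / d z - t z * (A z + B z) * A z / (d z)^3))" and
    "J12 z = \<tau> * (- (b1 * b2 * cos (snd z) / d z + t z * (A z + B z) * B z / (d z)^3))" and
    "J21 z = \<tau> * (- (a1 * a2 * cos (fst z) / d z - t z * (A z - B z) * A z / (d z)^3))" and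
    "J22 z = \<tau> * (- (- b1 * b2 * cos (snd z) / d z + t z * (A z - B z) * B z / (d z)^3))" for z
  have \<tau>2: "\<tau> * \<tau> = 1" using \<tau> by auto
  have S: "region s lam \<in> sets lebesgue" using region_borel[OF lam(1), of s] by simp
  have inj: "inj_on (\<lambda>z. \<tau> *\<^sub>R V z) (region s lam)"
    using inj_on_V_region[OF lam s] \<tau> by (auto simp: inj_on_def)
  have der: "((\<lambda>z. \<tau> *\<^sub>R V z) has_derivative (\<lambda>h. (J11 z * fst h + J12 z * snd h, J21 z * fst h + J22 z * snd h))) (at z within region s lam)" for z
    by (rule has_derivative_eq_rhs[OF has_derivative_scaleR_right[OF V_has_derivative]])
      (simp add: fun_eq_iff J11_def J12_def J21_def J22_def algebra_simps)
  have "J11 z * J22 z - J12 z * J21 z = (\<tau> * \<tau>) * - (2 * (a1 * a2 * (b1 * b2)) * (L1 z * L2 z) / (d z)^4)" for z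
  proof -
    have e: "(\<tau> * p) * (\<tau> * q) - (\<tau> * r) * (\<tau> * w) = (\<tau> * \<tau>) * (p * q - r * w)" for p q r w by algebra
    show ?thesis unfolding J11_def J12_def J21_def J22_def e V_det ..
  qed
  then have det: "\<bar>J11 z * J22 z - J12 z * J21 z\<bar> = 2 * (a1 * a2 * (b1 * b2)) * \<bar>L1 z * L2 z\<bar> / (d z)^4" for z
    unfolding \<tau>2 using pos by (simp add: abs_mult)
  have fG: "\<bar>J11 z * J22 z - J12 z * J21 z\<bar> * f (\<tau> *\<^sub>R V z) = 1 / (2 * pi\<^sup>2) * (g (\<tau> *\<^sub>R V z) * u (momentum z))"
    if z: "z \<in> region s lam" for z
  proof -
    have "0 < (branch_sign (snd lam) * L1 z) * (s * branch_sign (snd lam) * L2 z)" using z by (simp add: region_def)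
    also have "\<dots> = s * (L1 z * L2 z)" by (simp add: branch_sign_def)
    finally have e1: "fpm a1 a2 s (V z) * (2 * (a1 * a2 * (b1 * b2)) * \<bar>L1 z * L2 z\<bar> / (d z)^4) = 1 / (2 * pi\<^sup>2)"
      using s by (intro fpm_V) auto
    have e2: "f (\<tau> *\<^sub>R V z) = g (\<tau> *\<^sub>R V z) * (u (momentum z) * fpm a1 a2 s (V z))"
      unfolding f_def fpm_scale[OF \<tau>] scaleR_scaleR \<tau>2 using kbranch_V[OF z lam s] by simp
    have "\<bar>J11 z * J22 z - J12 z * J21 z\<bar> * f (\<tau> *\<^sub>R V z) =
      fpm a1 a2 s (V z) * (2 * (a1 * a2 * (b1 * b2)) * \<bar>L1 z * L2 z\<bar> / (d z)^4) * (g (\<tau> *\<^sub>R V z) * u (momentum z))"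
      unfolding det e2 by (simp only: ac_simps)
    then show ?thesis unfolding e1 .
  qed
  have int': "set_integrable lebesgue (region s lam) (\<lambda>z. \<bar>J11 z * J22 z - J12 z * J21 z\<bar> * f (\<tau> *\<^sub>R V z))"
    using set_integrable_mult_right[OF int, of "1 / (2 * pi\<^sup>2)"]
    by (subst set_integrable_cong[OF refl refl fG]) auto
  note cv = plane_change_of_variables[OF S inj der int']
  have im: "(\<lambda>z. \<tau> *\<^sub>R V z) ` region s lam = velocity_region"
  proof -
    have "(\<lambda>z. \<tau> *\<^sub>R V z) ` region s lam = (\<lambda>v. \<tau> *\<^sub>R v) ` velocity_region"
      using V_region[OF lam s] by (metis image_image)
    also have "\<dots> = velocity_region"
    proof (intro set_eqI iffI)
      fix v assume "v \<in> (\<lambda>v. \<tau> *\<^sub>R v) ` velocity_region"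
      then show "v \<in> velocity_region" using \<tau> ellF_scale[OF \<tau>] by (auto simp: velocity_region_def)
    next
      fix v assume "v \<in> velocity_region"
      then have "\<tau> *\<^sub>R v \<in> velocity_region" using \<tau> ellF_scale[OF \<tau>] by (auto simp: velocity_region_def)
      moreover have "v = \<tau> *\<^sub>R (\<tau> *\<^sub>R v)" using \<tau>2 by simp
      ultimately show "v \<in> (\<lambda>v. \<tau> *\<^sub>R v) ` velocity_region" by blast
    qed
    finally show ?thesis .
  qed
  have fW: "f absolutely_integrable_on velocity_region" "(LINT v:velocity_region|lebesgue. f v) = 1 / (2 * pi\<^sup>2) * (LINT z:region s lam|lebesgue. g (\<tau> *\<^sub>R V z) * u (momentum z))"
  proof -
    show "f absolutely_integrable_on velocity_region" using cv(1) unfolding im .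
    have "(LINT z:region s lam|lebesgue. \<bar>J11 z * J22 z - J12 z * J21 z\<bar> * f (\<tau> *\<^sub>R V z)) =
      (LINT z:region s lam|lebesgue. 1 / (2 * pi\<^sup>2) * (g (\<tau> *\<^sub>R V z) * u (momentum z)))"
      by (rule set_lebesgue_integral_cong[OF S]) (use fG in blast)
    also have "\<dots> = 1 / (2 * pi\<^sup>2) * (LINT z:region s lam|lebesgue. g (\<tau> *\<^sub>R V z) * u (momentum z))"
      by (rule set_integral_mult_right)
    finally show "(LINT v:velocity_region|lebesgue. f v) = 1 / (2 * pi\<^sup>2) * (LINT z:region s lam|lebesgue. g (\<tau> *\<^sub>R V z) * u (momentum z))"
      using cv(2) unfolding im by simp
  qed
  \<comment> \<open>On the boundary ellipses the square root in the denominator of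
    \<open>fpm\<close> is 0, so \<open>fpm\<close> is 0 there by the convention for division. Only
    the two excluded lines remain, which are null sets.\<close>
  have sub: "{v \<in> ellE a1 \<inter> ellE a2 - velocity_region. f v \<noteq> 0} \<subseteq> {v. (1, 1) \<bullet> v = 0} \<union> {v. (1, - 1) \<bullet> v = 0}"
  proof
    fix v assume v: "v \<in> {v \<in> ellE a1 \<inter> ellE a2 - velocity_region. f v \<noteq> 0}"
    then have "ellF a1 v * ellF a2 v \<noteq> 0" by (auto simp: f_def fpm_def Let_def)
    then have "ellF a1 v > 0" "ellF a2 v > 0" using v by (auto simp: ellE_def less_le)
    then show "v \<in> {v. (1, 1) \<bullet> v = 0} \<union> {v. (1, - 1) \<bullet> v = 0}" using v by (auto simp: velocity_region_def inner_prod_def)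
  qed
  have n1: "negligible {v \<in> ellE a1 \<inter> ellE a2 - velocity_region. f v \<noteq> 0}"
    by (rule negligible_subset[OF negligible_Un sub]) (rule negligible_hyperplane; simp add: zero_prod_def)+
  have WE: "velocity_region \<subseteq> ellE a1 \<inter> ellE a2" by (auto simp: velocity_region_def ellE_def)
  then have n2: "negligible {v \<in> velocity_region - ellE a1 \<inter> ellE a2. f v \<noteq> 0}" by (simp add: Diff_eq_empty_iff[THEN iffD2])
  have I: "f absolutely_integrable_on (ellE a1 \<inter> ellE a2)"
    by (rule absolutely_integrable_spike_set[OF fW(1) n2 n1])
  then show "set_integrable lebesgue (ellE a1 \<inter> ellE a2) (\<lambda>v. g v * (u (kbranch a1 a2 s lam (\<tau> *\<^sub>R v)) * fpm a1 a2 s v))"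
    unfolding f_def .
  have "(LINT v:ellE a1 \<inter> ellE a2|lebesgue. f v) = (LINT v:velocity_region|lebesgue. f v)"
    using integral_spike_set[OF n2 n1] set_lebesgue_integral_eq_integral(2)[OF I] set_lebesgue_integral_eq_integral(2)[OF fW(1)]
    by simp
  then show "(LINT v:ellE a1 \<inter> ellE a2|lebesgue. g v * (u (kbranch a1 a2 s lam (\<tau> *\<^sub>R v)) * fpm a1 a2 s v)) =
       1 / (2 * pi\<^sup>2) * (LINT z:region s lam|lebesgue. g (\<tau> *\<^sub>R V z) * u (momentum z))"
    unfolding fW(2) unfolding f_def .
qed

lemma AE_generic: "AE z in lborel. sin (fst z) \<noteq> 0 \<and> sin (snd z) \<noteq> 0 \<and> L1 z \<noteq> 0 \<and> L2 z \<noteq> 0"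
proof -
  have M: "M1 \<noteq> 0" "M2 \<noteq> 0" using M_less by auto
  have "AE z in (lborel :: (real \<times> real) measure). sin (fst z) \<noteq> 0"
    by (rule AE_plane_fst[of "\<lambda>z. sin (fst z) = 0"]) (auto intro!: borel_closed closed_Collect_eq continuous_intros simp: countable_sin_eq_0)
  moreover have "AE z in (lborel :: (real \<times> real) measure). sin (snd z) \<noteq> 0"
    by (rule AE_plane_snd[of "\<lambda>z. sin (snd z) = 0"]) (auto intro!: borel_closed closed_Collect_eq continuous_intros simp: countable_sin_eq_0)
  moreover have "AE z in lborel. \<not> L1 z = 0"
  proof (rule AE_plane_fst)
    show "{z. L1 z = 0} \<in> sets borel" by (intro borel_closed closed_Collect_eq continuous_intros continuous_on_L)
    have "{x. L1 (x, y) = 0} = {x. cos x = - M2 * cos y / M1}" for y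
      using M by (auto simp: L1_def field_simps)
    then show "countable {x. L1 (x, y) = 0}" for y by (simp only: countable_cos_eq)
  qed
  moreover have "AE z in lborel. \<not> L2 z = 0"
  proof (rule AE_plane_fst)
    show "{z. L2 z = 0} \<in> sets borel" by (intro borel_closed closed_Collect_eq continuous_intros continuous_on_L)
    have "{x. L2 (x, y) = 0} = {x. cos x = - M1 * cos y / M2}" for y
      using M by (auto simp: L2_def field_simps)
    then show "countable {x. L2 (x, y) = 0}" for y by (simp only: countable_cos_eq)
  qed
  ultimately show ?thesis by eventually_elim simp
qed

lemma region_subset: "region s lam \<subseteq> Lboxes (fst lam)"
  by (auto simp: region_def)

text \<open>For fixed \<open>\<mu>\<close> the four pairs \<open>(s, \<nu>)\<close> are the four
  sign patterns of \<open>(L1, L2)\<close>, so the regions partition the boxes up to a null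
  set.\<close>

lemma sum_region_integrals:
  fixes h :: "real \<times> real \<Rightarrow> real"
  assumes \<mu>: "\<mu> \<in> {0, 1}" and int: "set_integrable lebesgue (Lboxes \<mu>) h"
  shows "(\<Sum>s\<in>{1, - 1}. \<Sum>\<nu>\<in>{0, 1}. LINT z:region s (\<mu>, \<nu>)|lebesgue. h z) = (LINT z:Lboxes \<mu>|lebesgue. h z)"
proof -
  have I: "integrable lebesgue (\<lambda>z. indicator (region s (\<mu>, \<nu>)) z *\<^sub>R h z)" for s \<nu>
    using set_integrable_subset[OF int, of "region s (\<mu>, \<nu>)"] region_borel[of "(\<mu>, \<nu>)" s] region_subset[of s "(\<mu>, \<nu>)"] \<mu>
    unfolding set_integrable_def by auto
  have "(\<Sum>s\<in>{1, - 1}. \<Sum>\<nu>\<in>{0, 1}. LINT z:region s (\<mu>, \<nu>)|lebesgue. h z) =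
    (LINT z|lebesgue. (\<Sum>s\<in>{1, - 1}. \<Sum>\<nu>\<in>{0, 1}. indicator (region s (\<mu>, \<nu>)) z *\<^sub>R h z))"
    unfolding set_lebesgue_integral_def
    by (subst Bochner_Integration.integral_sum, rule Bochner_Integration.integrable_sum, rule I)
      (intro sum.cong refl Bochner_Integration.integral_sum[symmetric] I)
  also have "\<dots> = (LINT z|lebesgue. indicator (Lboxes \<mu>) z *\<^sub>R h z)"
  proof (rule integral_cong_AE)
    show "(\<lambda>z. \<Sum>s\<in>{1, - 1}. \<Sum>\<nu>\<in>{0, 1}. indicator (region s (\<mu>, \<nu>)) z *\<^sub>R h z) \<in> borel_measurable lebesgue"
      by (intro borel_measurable_sum borel_measurable_integrable I)
    show "(\<lambda>z. indicator (Lboxes \<mu>) z *\<^sub>R h z) \<in> borel_measurable lebesgue"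
      using int unfolding set_integrable_def by (rule borel_measurable_integrable)
    show "AE z in lebesgue. (\<Sum>s\<in>{1, - 1}. \<Sum>\<nu>\<in>{0, 1}. indicator (region s (\<mu>, \<nu>)) z *\<^sub>R h z) = indicator (Lboxes \<mu>) z *\<^sub>R h z"
      using AE_completion[OF AE_generic]
    proof eventually_elim
      case (elim z)
      have "(\<Sum>s\<in>{1, - 1}. \<Sum>\<nu>\<in>{0, 1}. indicator (region s (\<mu>, \<nu>)) z) = (indicator (Lboxes \<mu>) z :: real)"
      proof (cases "z \<in> Lboxes \<mu>")
        case True
        from elim consider "L1 z > 0" "L2 z > 0" | "L1 z > 0" "L2 z < 0" | "L1 z < 0" "L2 z > 0" | "L1 z < 0" "L2 z < 0"
          by (meson linorder_neqE_linordered_idom)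
        then show ?thesis using True elim
          by cases (auto simp: region_def branch_sign_def indicator_def)
      qed (auto simp: region_def)
      then show ?case by (simp only: scaleR_sum_left[symmetric])
    qed
  qed
  finally show ?thesis unfolding set_lebesgue_integral_def .
qed

text \<open>The signs \<open>s\<close> and the index \<open>\<nu>\<close> are absorbed by
  \<open>sum_region_integrals\<close>; the eigenvalue sign \<open>\<tau>\<close> and the box family
  \<open>\<mu>\<close> remain. The constant is \<open>1 / 4\<close> from \<open>wpm\<close> times
  \<open>1 / (2 * pi\<^sup>2)\<close>.\<close>

lemma integral_rho:
  fixes g :: "real \<times> real \<Rightarrow> real"
  assumes int: "\<And>\<tau> \<mu>. \<tau> \<in> {1, - 1} \<Longrightarrow> \<mu> \<in> {0, 1} \<Longrightarrow>
      set_integrable lebesgue (Lboxes \<mu>) (\<lambda>z. g (\<tau> *\<^sub>R V z) * wt a1 a2 \<Psi> \<tau> (momentum z))"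
  shows "(LINT v:ellE a1 \<inter> ellE a2|lebesgue. g v * rho a1 a2 \<Psi> v) =
     1 / (8 * pi\<^sup>2) * (\<Sum>\<tau>\<in>{1, - 1}. \<Sum>\<mu>\<in>{0, 1}. LINT z:Lboxes \<mu>|lebesgue. g (\<tau> *\<^sub>R V z) * wt a1 a2 \<Psi> \<tau> (momentum z))"
proof -
  let ?E = "ellE a1 \<inter> ellE a2" and ?L = "{0, 1} \<times> {0, 1} :: (nat \<times> nat) set"
  define T where "T s \<tau> lam v = g v * (wt a1 a2 \<Psi> \<tau> (kbranch a1 a2 s lam (\<tau> *\<^sub>R v)) * fpm a1 a2 s v)" for s \<tau> lam v
  define H where "H \<tau> z = g (\<tau> *\<^sub>R V z) * wt a1 a2 \<Psi> \<tau> (momentum z)" for \<tau> z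
  have intR: "set_integrable lebesgue (region s lam) (H \<tau>)" if "lam \<in> ?L" "\<tau> \<in> {1, - 1}" for s lam \<tau>
    using set_integrable_subset[OF int[of \<tau> "fst lam"], of "region s lam"] region_borel[of lam s] region_subset[of s lam] that
    unfolding H_def by auto
  have intT: "set_integrable lebesgue ?E (T s \<tau> lam)"
    and T: "(LINT v:?E|lebesgue. T s \<tau> lam v) = 1 / (2 * pi\<^sup>2) * (LINT z:region s lam|lebesgue. H \<tau> z)"
    if "s \<in> {1, - 1}" "\<tau> \<in> {1, - 1}" "lam \<in> ?L" for s \<tau> lam
    using branch_integral[of lam s \<tau> g "wt a1 a2 \<Psi> \<tau>"] intR[OF that(3,2), of s] that
    unfolding T_def H_def by auto
  have rho: "g v * rho a1 a2 \<Psi> v = (\<Sum>s\<in>{1, - 1}. \<Sum>\<tau>\<in>{1, - 1}. \<Sum>lam\<in>?L. (1 / 4) * T s \<tau> lam v)" for v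
  proof -
    have "g v * (wpm a1 a2 \<Psi> s v * fpm a1 a2 s v) = (\<Sum>\<tau>\<in>{1, - 1}. \<Sum>lam\<in>?L. (1 / 4) * T s \<tau> lam v)" for s
      unfolding wpm_def T_def by (simp only: sum_distrib_left sum_distrib_right ac_simps)
    then show ?thesis unfolding rho_def by (simp add: distrib_left)
  qed
  have I4: "integrable lebesgue (\<lambda>v. indicator ?E v *\<^sub>R ((1 / 4) * T s \<tau> lam v))"
    if "s \<in> {1, - 1}" "\<tau> \<in> {1, - 1}" "lam \<in> ?L" for s \<tau> lam
    using set_integrable_mult_right[OF intT[OF that], of "1 / 4"] unfolding set_integrable_def by simp
  have "(LINT v:?E|lebesgue. g v * rho a1 a2 \<Psi> v) =
    (\<Sum>s\<in>{1, - 1}. \<Sum>\<tau>\<in>{1, - 1}. \<Sum>lam\<in>?L. LINT v:?E|lebesgue. (1 / 4) * T s \<tau> lam v)"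
  proof -
    define f where "f s \<tau> lam v = indicator ?E v *\<^sub>R ((1 / 4) * T s \<tau> lam v)" for s \<tau> lam v
    have i4: "integrable lebesgue (f s \<tau> lam)" if "s \<in> {1, - 1}" "\<tau> \<in> {1, - 1}" "lam \<in> ?L" for s \<tau> lam
      using I4[OF that] unfolding f_def .
    have i3: "integrable lebesgue (\<lambda>v. \<Sum>lam\<in>?L. f s \<tau> lam v)" if "s \<in> {1, - 1}" "\<tau> \<in> {1, - 1}" for s \<tau>
      by (rule Bochner_Integration.integrable_sum) (rule i4[OF that])
    have i2: "integrable lebesgue (\<lambda>v. \<Sum>\<tau>\<in>{1, - 1}. \<Sum>lam\<in>?L. f s \<tau> lam v)" if "s \<in> {1, - 1}" for s
      by (rule Bochner_Integration.integrable_sum) (rule i3[OF that])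
    have "(LINT v|lebesgue. (\<Sum>s\<in>{1, - 1}. \<Sum>\<tau>\<in>{1, - 1}. \<Sum>lam\<in>?L. f s \<tau> lam v)) =
       (\<Sum>s\<in>{1, - 1}. LINT v|lebesgue. (\<Sum>\<tau>\<in>{1, - 1}. \<Sum>lam\<in>?L. f s \<tau> lam v))"
      by (rule Bochner_Integration.integral_sum) (rule i2)
    also have "\<dots> = (\<Sum>s\<in>{1, - 1}. \<Sum>\<tau>\<in>{1, - 1}. LINT v|lebesgue. (\<Sum>lam\<in>?L. f s \<tau> lam v))"
      by (rule sum.cong[OF refl], rule Bochner_Integration.integral_sum) (rule i3)
    also have "\<dots> = (\<Sum>s\<in>{1, - 1}. \<Sum>\<tau>\<in>{1, - 1}. \<Sum>lam\<in>?L. LINT v|lebesgue. f s \<tau> lam v)"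
      by (rule sum.cong[OF refl], rule sum.cong[OF refl], rule Bochner_Integration.integral_sum) (rule i4)
    finally show ?thesis unfolding rho set_lebesgue_integral_def scaleR_sum_right f_def .
  qed
  also have "\<dots> = (\<Sum>s\<in>{1, - 1}. \<Sum>\<tau>\<in>{1, - 1}. \<Sum>lam\<in>?L. 1 / (8 * pi\<^sup>2) * (LINT z:region s lam|lebesgue. H \<tau> z))"
    by (intro sum.cong refl) (subst set_integral_mult_right, subst T, auto)
  also have "\<dots> = (\<Sum>s\<in>{1, - 1}. \<Sum>\<tau>\<in>{1, - 1}. \<Sum>\<mu>\<in>{0, 1}. \<Sum>\<nu>\<in>{0, 1}. 1 / (8 * pi\<^sup>2) * (LINT z:region s (\<mu>, \<nu>)|lebesgue. H \<tau> z))"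
  proof -
    have "sum G ?L = (\<Sum>\<mu>\<in>{0, 1}. \<Sum>\<nu>\<in>{0, 1}. G (\<mu>, \<nu>))" for G :: "nat \<times> nat \<Rightarrow> real"
      by (simp add: sum.cartesian_product)
    then show ?thesis by (simp only:)
  qed
  also have "\<dots> = 1 / (8 * pi\<^sup>2) * (\<Sum>\<tau>\<in>{1, - 1}. \<Sum>\<mu>\<in>{0, 1}. \<Sum>s\<in>{1, - 1}. \<Sum>\<nu>\<in>{0, 1}. LINT z:region s (\<mu>, \<nu>)|lebesgue. H \<tau> z)"
  proof -
    have "(\<Sum>s\<in>{1, - 1}. \<Sum>\<tau>\<in>{1, - 1}. \<Sum>\<mu>\<in>{0, 1}. X s \<tau> \<mu>) = (\<Sum>\<tau>\<in>{1, - 1}. \<Sum>\<mu>\<in>{0, 1}. \<Sum>s\<in>{1, - 1}. X s \<tau> \<mu>)"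
      for X :: "real \<Rightarrow> real \<Rightarrow> nat \<Rightarrow> real"
      by (subst sum.swap) (rule sum.cong[OF refl], rule sum.swap)
    then show ?thesis unfolding sum_distrib_left[symmetric] by (rule arg_cong)
  qed
  also have "\<dots> = 1 / (8 * pi\<^sup>2) * (\<Sum>\<tau>\<in>{1, - 1}. \<Sum>\<mu>\<in>{0, 1}. LINT z:Lboxes \<mu>|lebesgue. H \<tau> z)"
    by (intro arg_cong[where f = "(*) (1 / (8 * pi\<^sup>2))"] sum.cong refl sum_region_integrals)
      (use int in \<open>auto simp: H_def\<close>)
  finally show ?thesis unfolding H_def .
qed

end

subsection \<open>Fourier series of square-summable states\<close>

text \<open>Young's inequality with a free parameter: \<open>e\<close> is fixed first to make its
  multiple of the limit norm small, and the large factor \<open>1 + 1 / e\<close> meets a distance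
  that tends to 0.\<close>

lemma abs_diff_norm_squared_le:
  fixes u v :: "'a::real_normed_vector"
  assumes "e > 0"
  shows "\<bar>(norm u)\<^sup>2 - (norm v)\<^sup>2\<bar> \<le> e * (norm v)\<^sup>2 + (1 + 1 / e) * (norm (v - u))\<^sup>2"
proof -
  define d where "d = norm (v - u)"
  have d: "\<bar>norm u - norm v\<bar> \<le> d" unfolding d_def by (metis norm_triangle_ineq3 norm_minus_commute)
  have "\<bar>(norm u)\<^sup>2 - (norm v)\<^sup>2\<bar> = \<bar>norm u - norm v\<bar> * (norm u + norm v)"
    by (simp add: power2_eq_square square_diff_square_factored abs_mult)
  also have "\<dots> \<le> d * (2 * norm v + d)"
    using d by (intro mult_mono) auto
  also have "\<dots> \<le> e * (norm v)\<^sup>2 + (1 + 1 / e) * d\<^sup>2"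
  proof -
    have "0 \<le> (e * norm v - d)\<^sup>2 / e" using assms by simp
    also have "\<dots> = e * (norm v)\<^sup>2 + d\<^sup>2 / e - 2 * (d * norm v)"
      using assms by (simp add: field_simps power2_eq_square)
    finally show ?thesis by (simp add: algebra_simps power2_eq_square)
  qed
  finally show ?thesis unfolding d_def .
qed

abbreviation sq_norm :: "'a measure \<Rightarrow> ('a \<Rightarrow> 'b::real_normed_vector) \<Rightarrow> ennreal" where
  "sq_norm M f \<equiv> \<integral>\<^sup>+ z. ennreal ((norm (f z))\<^sup>2) \<partial>M"

text \<open>Continuity of the mean-square norm. The filter is arbitrary because partial sums are
  indexed by finite subsets, and only the limit function is assumed to have finite norm.\<close>

lemma nn_integral_norm_squared_tendsto:
  fixes f :: "'a \<Rightarrow> 'b::{real_normed_vector, second_countable_topology}"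
  assumes [measurable]: "f \<in> borel_measurable M" "\<And>X. fs X \<in> borel_measurable M"
    and lim: "((\<lambda>X. sq_norm M (\<lambda>z. f z - fs X z)) \<longlongrightarrow> 0) F"
    and fin: "sq_norm M f < \<infinity>"
  shows "((\<lambda>X. sq_norm M (fs X)) \<longlongrightarrow> sq_norm M f) F"
proof -
  define D where "D X = sq_norm M (\<lambda>z. f z - fs X z)" for X
  define A where "A X = sq_norm M (fs X)" for X
  define I where "I = sq_norm M f"
  have up: "A X \<le> I + (ennreal e * I + ennreal (1 + 1 / e) * D X)"
    and lo: "I \<le> A X + (ennreal e * I + ennreal (1 + 1 / e) * D X)" if "e > 0" for e X
  proof -
    have rhs: "ennreal e * I + ennreal (1 + 1 / e) * D X =
      (\<integral>\<^sup>+ z. ennreal (e * (norm (f z))\<^sup>2 + (1 + 1 / e) * (norm (f z - fs X z))\<^sup>2) \<partial>M)"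
    proof -
      define c where "c = 1 + 1 / e"
      have "c \<ge> 0" "e \<ge> 0" using that by (simp_all add: c_def)
      then show ?thesis unfolding I_def D_def c_def[symmetric]
        by (simp add: ennreal_mult nn_integral_cmult nn_integral_add)
    qed
    define r where "r z = e * (norm (f z))\<^sup>2 + (1 + 1 / e) * (norm (f z - fs X z))\<^sup>2" for z
    have [measurable]: "r \<in> borel_measurable M" unfolding r_def by measurable
    have r: "0 \<le> r z" "\<bar>(norm (fs X z))\<^sup>2 - (norm (f z))\<^sup>2\<bar> \<le> r z" for z
      using abs_diff_norm_squared_le[OF that, of "fs X z" "f z"] unfolding r_def by linarith+
    have pw: "ennreal ((norm (fs X z))\<^sup>2) \<le> ennreal ((norm (f z))\<^sup>2) + ennreal (r z)"
      "ennreal ((norm (f z))\<^sup>2) \<le> ennreal ((norm (fs X z))\<^sup>2) + ennreal (r z)" for z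
      using r[of z] by (auto intro!: ennreal_leI simp flip: ennreal_plus)
    show "A X \<le> I + (ennreal e * I + ennreal (1 + 1 / e) * D X)"
      "I \<le> A X + (ennreal e * I + ennreal (1 + 1 / e) * D X)"
      unfolding rhs unfolding A_def I_def r_def[symmetric]
      by (subst nn_integral_add[symmetric]; auto intro: nn_integral_mono pw)+
  qed
  define i where "i = enn2real I"
  have I: "I = ennreal i" "i \<ge> 0" using fin unfolding i_def I_def by auto
  have D0: "(D \<longlongrightarrow> 0) F" using lim unfolding D_def .
  have "eventually (\<lambda>X. D X < 1) F" using order_tendstoD(2)[OF D0, of 1] by simp
  then have evA: "eventually (\<lambda>X. A X = ennreal (enn2real (A X)) \<and> D X = ennreal (enn2real (D X))) F"
  proof eventually_elim
    case (elim X)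
    have Dx: "D X < top" using elim by (rule less_trans) simp
    have "A X \<le> I + (ennreal 1 * I + ennreal (1 + 1 / 1) * D X)" by (rule up) simp
    also have "\<dots> < top" using Dx unfolding I by (simp add: ennreal_mult_less_top)
    finally show ?case using Dx by simp
  qed
  have d0: "((\<lambda>X. enn2real (D X)) \<longlongrightarrow> 0) F"
    using tendsto_enn2real[of D 0 F] D0 by simp
  have "((\<lambda>X. enn2real (A X)) \<longlongrightarrow> i) F"
  proof (rule tendstoI)
    fix r :: real assume r: "r > 0"
    \<comment> \<open>Chosen so that \<open>e * i \<le> r / 2\<close>; adding 1 keeps the
      denominator positive if \<open>i = 0\<close>.\<close>
    define e where "e = r / (2 * (i + 1))"
    have e: "e > 0" using r I by (simp add: e_def)
    have ei: "e * i \<le> r / 2" using r I(2) unfolding e_def by (simp add: field_simps)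
    have "eventually (\<lambda>X. enn2real (D X) < r / 2 / (1 + 1 / e)) F"
      using r e by (intro order_tendstoD(2)[OF d0] divide_pos_pos add_pos_pos) auto
    with evA show "eventually (\<lambda>X. dist (enn2real (A X)) i < r) F"
    proof eventually_elim
      case (elim X)
      define a d where "a = enn2real (A X)" and "d = enn2real (D X)"
      have ad: "A X = ennreal a" "D X = ennreal d" "a \<ge> 0" "d \<ge> 0" using elim by (auto simp: a_def d_def)
      have dl: "(1 + 1 / e) * d < r / 2" using elim(2) e unfolding d_def[symmetric]
        by (simp only: pos_less_divide_eq[OF add_pos_pos[OF zero_less_one divide_pos_pos[OF zero_less_one e]]] mult.commute)
      have "a \<le> i + (e * i + (1 + 1 / e) * d)"
        using up[OF e, of X] e I(2) ad(3,4) unfolding ad I(1)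
        by (simp add: ennreal_mult[symmetric] flip: ennreal_plus)
      moreover have "i \<le> a + (e * i + (1 + 1 / e) * d)"
        using lo[OF e, of X] e I(2) ad(3,4) unfolding ad I(1)
        by (simp add: ennreal_mult[symmetric] flip: ennreal_plus)
      ultimately show ?case using dl ei unfolding dist_real_def a_def[symmetric] by linarith
    qed
  qed
  then have "((\<lambda>X. ennreal (enn2real (A X))) \<longlongrightarrow> I) F" unfolding I(1) by (rule tendsto_ennrealI)
  moreover have "eventually (\<lambda>X. ennreal (enn2real (A X)) = A X) F" using evA by eventually_elim simp
  ultimately have "(A \<longlongrightarrow> I) F" by (rule Lim_transform_eventually)
  then show ?thesis unfolding A_def I_def .
qed

lemma nn_integral_norm_squared_add_le:
  fixes f g :: "'a \<Rightarrow> 'b::{real_normed_vector, second_countable_topology}"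
  assumes [measurable]: "f \<in> borel_measurable M" "g \<in> borel_measurable M"
  shows "sq_norm M (\<lambda>z. f z + g z) \<le>
     2 * sq_norm M f + 2 * sq_norm M g"
proof -
  have "(norm (f z + g z))\<^sup>2 \<le> 2 * (norm (f z))\<^sup>2 + 2 * (norm (g z))\<^sup>2" for z
  proof -
    have "(norm (f z + g z))\<^sup>2 \<le> (norm (f z) + norm (g z))\<^sup>2"
      by (intro power_mono norm_triangle_ineq) simp
    also have "\<dots> \<le> 2 * (norm (f z))\<^sup>2 + 2 * (norm (g z))\<^sup>2"
      using sum_squares_bound[of "norm (f z)" "norm (g z)"] by (simp add: power2_sum)
    finally show ?thesis .
  qed
  then have "ennreal ((norm (f z + g z))\<^sup>2) \<le> 2 * ennreal ((norm (f z))\<^sup>2) + 2 * ennreal ((norm (g z))\<^sup>2)" for z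
    using ennreal_leI[of "(norm (f z + g z))\<^sup>2" "2 * (norm (f z))\<^sup>2 + 2 * (norm (g z))\<^sup>2"] by (simp add: ennreal_mult)
  then have "sq_norm M (\<lambda>z. f z + g z) \<le>
     (\<integral>\<^sup>+ z. 2 * ennreal ((norm (f z))\<^sup>2) + 2 * ennreal ((norm (g z))\<^sup>2) \<partial>M)"
    by (intro nn_integral_mono)
  also have "\<dots> = 2 * sq_norm M f + 2 * sq_norm M g"
    by (simp add: nn_integral_add nn_integral_cmult)
  finally show ?thesis .
qed

lemma summable_on_tail_finite:
  fixes w :: "'i \<Rightarrow> real"
  assumes w: "w summable_on UNIV" "\<And>i. 0 \<le> w i" and e: "e > 0"
  obtains F where "finite F" "\<And>X. finite X \<Longrightarrow> X \<inter> F = {} \<Longrightarrow> sum w X < e"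
proof -
  have "(sum w \<longlongrightarrow> infsum w UNIV) (finite_subsets_at_top UNIV)"
    using has_sum_infsum[OF w(1)] by (simp add: has_sum_def)
  then have "eventually (\<lambda>X. infsum w UNIV - e < sum w X) (finite_subsets_at_top UNIV)"
    using e by (intro order_tendstoD) auto
  then obtain F where F: "finite F" "\<And>Y. finite Y \<Longrightarrow> F \<subseteq> Y \<Longrightarrow> infsum w UNIV - e < sum w Y"
    by (auto simp: eventually_finite_subsets_at_top)
  have "sum w X < e" if X: "finite X" "X \<inter> F = {}" for X
  proof -
    have "sum w (X \<union> F) \<le> infsum w UNIV"
      using X F w by (intro finite_sum_le_infsum) auto
    moreover have "sum w (X \<union> F) = sum w X + sum w F" using X F by (intro sum.union_disjoint) auto
    ultimately show ?thesis using F(2)[of F] F(1) by simp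
  qed
  with F(1) that show ?thesis by blast
qed

text \<open>Completeness: along sets with geometrically small tails the partial sums converge almost
  everywhere, and Fatou's lemma turns this into convergence in the mean.\<close>
lemma riesz_fischer:
  fixes f :: "'i \<Rightarrow> 'a \<Rightarrow> 'b::{banach, second_countable_topology}"
  assumes [measurable]: "\<And>i. f i \<in> borel_measurable M"
    and bd: "\<And>X. finite X \<Longrightarrow> sq_norm M (\<lambda>z. \<Sum>i\<in>X. f i z) \<le> ennreal (sum w X)"
    and w: "w summable_on UNIV" "\<And>i. 0 \<le> w i"
  obtains X where "\<And>j::nat. finite (X j)"
    "((\<lambda>Y. sq_norm M (\<lambda>z. lim (\<lambda>j. \<Sum>i\<in>X j. f i z) - (\<Sum>i\<in>Y. f i z))) \<longlongrightarrow> 0)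
       (finite_subsets_at_top UNIV)"
proof -
  have "\<exists>F. finite F \<and> (\<forall>X. finite X \<longrightarrow> X \<inter> F = {} \<longrightarrow> sum w X < (1/4)^j)" for j :: nat
    by (rule summable_on_tail_finite[OF w, of "(1/4)^j"]) auto
  then obtain F where F: "\<And>j. finite (F j)" "\<And>j X. finite X \<Longrightarrow> X \<inter> F j = {} \<Longrightarrow> sum w X < (1/4)^j"
    by metis
  define X where "X j = (\<Union>i\<le>j. F i)" for j :: nat
  have Xfin: "finite (X j)" for j using F by (simp add: X_def)
  have Xmono: "X i \<subseteq> X j" if "i \<le> j" for i j using that unfolding X_def by (meson UN_mono atMost_subset_iff order_refl)
  have XF: "F j \<subseteq> X j" for j unfolding X_def by auto
  define S where "S Y z = (\<Sum>i\<in>Y. f i z)" for Y z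
  define G where "G z = lim (\<lambda>j. S (X j) z)" for z
  have [measurable]: "S Y \<in> borel_measurable M" for Y unfolding S_def by measurable
  have [measurable]: "G \<in> borel_measurable M" unfolding G_def by measurable
  have diff: "sq_norm M (\<lambda>z. S Y z - S (X j) z) \<le> ennreal ((1/4)^j)"
    if Y: "finite Y" "X j \<subseteq> Y" for Y j
  proof -
    have "S Y z - S (X j) z = (\<Sum>i\<in>Y - X j. f i z)" for z
      unfolding S_def using Y by (simp add: sum_diff)
    then have "sq_norm M (\<lambda>z. S Y z - S (X j) z) \<le> ennreal (sum w (Y - X j))"
      using bd[of "Y - X j"] Y by simp
    also have "\<dots> \<le> ennreal ((1/4)^j)"
      using F(2)[of "Y - X j" j] Y XF[of j] by (intro ennreal_leI less_imp_le) blast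
    finally show ?thesis .
  qed
  define d where "d j z = S (X (Suc j)) z - S (X j) z" for j z
  have [measurable]: "d j \<in> borel_measurable M" for j unfolding d_def by measurable
  \<comment> \<open>The tails are below \<open>(1/4)^j\<close>, so the weights \<open>2 ^ j\<close>
    can be inserted and the series still converges. The weights pay for the passage from squares to
    norms below.\<close>
  have "(\<integral>\<^sup>+ z. (\<Sum>j. ennreal (2 ^ j * (norm (d j z))\<^sup>2)) \<partial>M) = (\<Sum>j. \<integral>\<^sup>+ z. ennreal (2 ^ j * (norm (d j z))\<^sup>2) \<partial>M)"
    by (intro nn_integral_suminf) measurable
  also have "\<dots> \<le> (\<Sum>j. ennreal ((1/2)^j))"
  proof (intro suminf_le allI)
    fix j
    have "(\<integral>\<^sup>+ z. ennreal (2 ^ j * (norm (d j z))\<^sup>2) \<partial>M) = ennreal (2 ^ j) * sq_norm M (\<lambda>z. d j z)"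
      by (subst nn_integral_cmult[symmetric]) (auto simp: ennreal_mult)
    also have "\<dots> \<le> ennreal (2 ^ j) * ennreal ((1/4)^j)"
      unfolding d_def using Xmono[of j "Suc j"] Xfin by (intro mult_left_mono diff) auto
    also have "\<dots> = ennreal ((1/2)^j)"
      by (simp add: ennreal_mult[symmetric] power_mult_distrib[symmetric])
    finally show "(\<integral>\<^sup>+ z. ennreal (2 ^ j * (norm (d j z))\<^sup>2) \<partial>M) \<le> ennreal ((1/2)^j)" .
  qed auto
  also have "\<dots> = ennreal (\<Sum>j. (1/2)^j)" by (intro suminf_ennreal2) (auto simp: summable_geometric)
  also have "\<dots> < \<infinity>" by simp
  finally have "AE z in M. (\<Sum>j. ennreal (2 ^ j * (norm (d j z))\<^sup>2)) \<noteq> \<infinity>"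
    by (intro nn_integral_PInf_AE) auto
  then have conv: "AE z in M. (\<lambda>j. S (X j) z) \<longlonglongrightarrow> G z"
  proof eventually_elim
    case (elim z)
    have s1: "summable (\<lambda>j. 2 ^ j * (norm (d j z))\<^sup>2)"
      using elim by (intro summable_suminf_not_top) auto
    have s2: "summable (\<lambda>j. ((1/2)^j + 2 ^ j * (norm (d j z))\<^sup>2) / 2)"
      by (intro summable_divide summable_add s1 summable_geometric) auto
    \<comment> \<open>Arithmetic-geometric mean inequality: weighted summability of the squares
      gives absolute summability of the increments.\<close>
    have "norm (d j z) \<le> ((1/2)^j + 2 ^ j * (norm (d j z))\<^sup>2) / 2" for j
    proof -
      define n p where "n = norm (d j z)" and "p = (2::real) ^ j"
      have p: "p > 0" "(1/2)^j = 1 / p" by (simp_all add: p_def power_divide)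
      have "0 \<le> (1 - p * n)\<^sup>2 / p" using p by simp
      also have "(1 - p * n)\<^sup>2 / p = (1 + p * (p * n\<^sup>2) - p * (2 * n)) / p"
        by (simp add: power2_eq_square algebra_simps)
      also have "\<dots> = 1 / p + p * n\<^sup>2 - 2 * n"
        using p(1) by (simp add: add_divide_distrib diff_divide_distrib)
      finally show ?thesis unfolding p(2) n_def[symmetric] p_def[symmetric] by simp
    qed
    then have "summable (\<lambda>j. d j z)" by (intro summable_norm_cancel[OF summable_comparison_test'[OF s2]]) auto
    then have "convergent (\<lambda>n. S (X 0) z + (\<Sum>j<n. d j z))"
      using convergent_add[OF convergent_const] summable_iff_convergent by blast
    moreover have "S (X 0) z + (\<Sum>j<n. d j z) = S (X n) z" for n
      unfolding d_def using sum_lessThan_telescope[of "\<lambda>j. S (X j) z" n] by simp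
    ultimately show ?case unfolding G_def by (simp add: convergent_LIMSEQ_iff)
  qed
  have GX: "sq_norm M (\<lambda>z. G z - S (X J) z) \<le> ennreal ((1/4)^J)" for J
  proof -
    have "sq_norm M (\<lambda>z. G z - S (X J) z) =
       (\<integral>\<^sup>+ z. liminf (\<lambda>j. ennreal ((norm (S (X j) z - S (X J) z))\<^sup>2)) \<partial>M)"
    proof (rule nn_integral_cong_AE)
      show "AE z in M. ennreal ((norm (G z - S (X J) z))\<^sup>2) = liminf (\<lambda>j. ennreal ((norm (S (X j) z - S (X J) z))\<^sup>2))"
        using conv
      proof eventually_elim
        case (elim z)
        have "(\<lambda>j. ennreal ((norm (S (X j) z - S (X J) z))\<^sup>2)) \<longlonglongrightarrow> ennreal ((norm (G z - S (X J) z))\<^sup>2)"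
          by (intro tendsto_intros elim)
        then show ?case using lim_imp_Liminf[OF sequentially_bot] by metis
      qed
    qed
    also have "\<dots> \<le> liminf (\<lambda>j. sq_norm M (\<lambda>z. S (X j) z - S (X J) z))"
      by (intro nn_integral_liminf) measurable
    also have "\<dots> \<le> ennreal ((1/4)^J)"
    proof (rule Liminf_le)
      show "eventually (\<lambda>j. sq_norm M (\<lambda>z. S (X j) z - S (X J) z) \<le> ennreal ((1/4)^J)) sequentially"
        using eventually_ge_at_top[of J] by eventually_elim (intro diff Xfin Xmono)
    qed simp
    finally show ?thesis .
  qed
  have main: "sq_norm M (\<lambda>z. G z - S Y z) \<le> ennreal (4 * (1/4)^J)" if Y: "finite Y" "X J \<subseteq> Y" for Y J
  proof -
    have "sq_norm M (\<lambda>z. G z - S Y z) =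
       sq_norm M (\<lambda>z. (G z - S (X J) z) + - (S Y z - S (X J) z))"
      by simp
    also have "\<dots> \<le> 2 * sq_norm M (\<lambda>z. G z - S (X J) z) + 2 * sq_norm M (\<lambda>z. - (S Y z - S (X J) z))"
      by (intro nn_integral_norm_squared_add_le) measurable
    also have "\<dots> \<le> 2 * ennreal ((1/4)^J) + 2 * ennreal ((1/4)^J)"
      unfolding norm_minus_cancel by (intro add_mono mult_left_mono GX diff Y) auto
    also have "\<dots> = ennreal (4 * (1/4)^J)" by (simp add: ennreal_mult flip: distrib_right)
    finally show ?thesis .
  qed
  have "((\<lambda>Y. sq_norm M (\<lambda>z. G z - S Y z)) \<longlongrightarrow> 0) (finite_subsets_at_top UNIV)"
  proof (rule order_tendstoI)
    fix a :: ennreal assume a: "0 < a"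
    have "(\<lambda>J. ennreal (4 * (1/4)^J)) \<longlonglongrightarrow> ennreal (4 * 0)"
      by (intro tendsto_intros LIMSEQ_power_zero) auto
    then have "eventually (\<lambda>J. ennreal (4 * (1/4)^J) < a) sequentially"
      using a by (intro order_tendstoD) auto
    then obtain J where J: "ennreal (4 * (1/4)^J) < a" by (auto simp: eventually_sequentially)
    show "eventually (\<lambda>Y. sq_norm M (\<lambda>z. G z - S Y z) < a) (finite_subsets_at_top UNIV)"
      unfolding eventually_finite_subsets_at_top using main J Xfin[of J]
      by (intro exI[of _ "X J"]) (auto intro: le_less_trans)
  qed auto
  then show ?thesis using that[of X] Xfin unfolding G_def S_def by blast
qed

section \<open>Orthogonal expansions with two-component coefficients\<close>

lemma vector_scalar_mult_measurable [measurable]: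
  fixes c :: "complex ^ 2"
  assumes [measurable]: "f \<in> borel_measurable M"
  shows "(\<lambda>z. f z *s c) \<in> borel_measurable M"
proof -
  have "continuous_on UNIV (\<lambda>x :: complex. x *s c)"
    unfolding vector_scalar_mult_def by (intro continuous_intros)
  then show ?thesis by (rule borel_measurable_continuous_on) measurable
qed

text \<open>Instantiated by the characters of the circle and of the torus; \<open>C\<close> is their
  common squared norm, the length or area of the period cell.\<close>

locale orthogonal_family =
  fixes M :: "'a measure" and \<eta> :: "'i \<Rightarrow> 'a \<Rightarrow> complex" and C :: real
  assumes C: "0 \<le> C" and \<eta> [measurable]: "\<And>i. \<eta> i \<in> borel_measurable M"
    and int: "\<And>i j. integrable M (\<lambda>z. \<eta> i z * cnj (\<eta> j z))"
    and orth: "\<And>i j. (LINT z|M. \<eta> i z * cnj (\<eta> j z)) = (if i = j then of_real C else 0)"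
begin

definition psum :: "('i \<Rightarrow> complex ^ 2) \<Rightarrow> 'i set \<Rightarrow> 'a \<Rightarrow> complex ^ 2" where
  "psum c X z = (\<Sum>i\<in>X. \<eta> i z *s c i)"

lemma psum_measurable [measurable]: "psum c X \<in> borel_measurable M"
  unfolding psum_def by measurable

lemma sq_norm_psum:
  assumes X: "finite X"
  shows "sq_norm M (psum c X) = ennreal (C * (\<Sum>i\<in>X. (norm (c i))\<^sup>2))"
proof -
  define N where "N z = (\<Sum>i\<in>X. \<Sum>j\<in>X. \<eta> i z * cnj (\<eta> j z) * (c i $ 1 * cnj (c j $ 1) + c i $ 2 * cnj (c j $ 2)))" for z
  have N: "of_real ((norm (\<Sum>i\<in>X. \<eta> i z *s c i))\<^sup>2) = N z" for z
  proof -
    have *: "(\<Sum>i\<in>X. \<eta> i z *s c i) $ r = (\<Sum>i\<in>X. \<eta> i z * c i $ r)" for r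
      by simp
    have "of_real ((norm (\<Sum>i\<in>X. \<eta> i z *s c i))\<^sup>2) =
      (\<Sum>i\<in>X. \<eta> i z * c i $ 1) * cnj (\<Sum>i\<in>X. \<eta> i z * c i $ 1) + (\<Sum>i\<in>X. \<eta> i z * c i $ 2) * cnj (\<Sum>i\<in>X. \<eta> i z * c i $ 2)"
      by (simp add: norm_vec_def L2_set_def sum_2 * complex_norm_square del: of_real_power cnj_sum)
    also have "\<dots> = N z"
      by (simp add: N_def sum_product sum.distrib[symmetric] algebra_simps)
    finally show ?thesis .
  qed
  have intN: "integrable M N" unfolding N_def by (intro Bochner_Integration.integrable_sum integrable_mult_left int)
  have "(LINT z|M. N z) = (\<Sum>i\<in>X. \<Sum>j\<in>X. (if i = j then of_real C else 0) * (c i $ 1 * cnj (c j $ 1) + c i $ 2 * cnj (c j $ 2)))"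
    unfolding N_def by (simp add: Bochner_Integration.integral_sum int orth)
  also have "\<dots> = (\<Sum>i\<in>X. of_real C * (c i $ 1 * cnj (c i $ 1) + c i $ 2 * cnj (c i $ 2)))"
    using X by (intro sum.cong refl) (simp add: if_distrib[of "\<lambda>x. x * _"] sum.delta cong: if_cong)
  also have "\<dots> = of_real (\<Sum>i\<in>X. C * (norm (c i))\<^sup>2)"
    by (simp add: norm_vec_def L2_set_def sum_2 complex_norm_square del: of_real_power)
  finally have L: "(LINT z|M. N z) = of_real (\<Sum>i\<in>X. C * (norm (c i))\<^sup>2)" .
  have R: "(norm (\<Sum>i\<in>X. \<eta> i z *s c i))\<^sup>2 = Re (N z)" for z
    unfolding N[symmetric] by simp
  have "sq_norm M (\<lambda>z. \<Sum>i\<in>X. \<eta> i z *s c i) = ennreal (LINT z|M. Re (N z))"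
    unfolding R
  proof (rule nn_integral_eq_integral)
    show "integrable M (\<lambda>z. Re (N z))" using intN by (rule integrable_Re)
    show "AE z in M. 0 \<le> Re (N z)" unfolding R[symmetric] by simp
  qed
  also have "(LINT z|M. Re (N z)) = (\<Sum>i\<in>X. C * (norm (c i))\<^sup>2)"
    using integral_Re[OF intN] L by simp
  finally show ?thesis by (simp add: psum_def[abs_def] sum_distrib_left)
qed

lemma psum_diff: "finite X \<Longrightarrow> Y \<subseteq> X \<Longrightarrow> psum c X z - psum c Y z = psum c (X - Y) z"
  unfolding psum_def by (simp add: sum_diff)

definition transform :: "('i \<Rightarrow> complex ^ 2) \<Rightarrow> ('a \<Rightarrow> complex ^ 2) \<Rightarrow> bool" where
  "transform c \<phi> \<longleftrightarrow> \<phi> \<in> borel_measurable M \<and>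
     ((\<lambda>X. sq_norm M (\<lambda>z. \<phi> z - psum c X z)) \<longlongrightarrow> 0) (finite_subsets_at_top UNIV)"

text \<open>The form of the witness matters: a pointwise \<open>lim\<close> of partial sums inherits
  the periodicity of the characters at every point, whereas convergence in the mean would give it
  only almost everywhere.\<close>

lemma transform_exists:
  assumes c: "(\<lambda>i. (norm (c i))\<^sup>2) summable_on UNIV"
  obtains X where "\<And>j::nat. finite (X j)" "transform c (\<lambda>z. lim (\<lambda>j. psum c (X j) z))"
proof -
  have m: "(\<lambda>z. \<eta> i z *s c i) \<in> borel_measurable M" for i by measurable
  have b: "sq_norm M (\<lambda>z. \<Sum>i\<in>X. \<eta> i z *s c i) \<le> ennreal (\<Sum>i\<in>X. C * (norm (c i))\<^sup>2)" if "finite X" for X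
    using sq_norm_psum[OF that, of c] by (simp add: psum_def[abs_def] sum_distrib_left)
  obtain X where X: "\<And>j::nat. finite (X j)"
    "((\<lambda>Y. sq_norm M (\<lambda>z. lim (\<lambda>j. psum c (X j) z) - psum c Y z)) \<longlongrightarrow> 0) (finite_subsets_at_top UNIV)"
    unfolding psum_def by (rule riesz_fischer[OF m b summable_on_cmult_right[OF c]]) (auto simp: C)
  moreover have "(\<lambda>z. lim (\<lambda>j. psum c (X j) z)) \<in> borel_measurable M" by measurable
  ultimately show ?thesis using that unfolding transform_def by blast
qed

context
  fixes c \<phi>
  assumes \<phi>: "transform c \<phi>" and c: "(\<lambda>i. (norm (c i))\<^sup>2) summable_on UNIV"
begin

lemma transform_measurable: "\<phi> \<in> borel_measurable M"
  and transform_tendsto: "((\<lambda>X. sq_norm M (\<lambda>z. \<phi> z - psum c X z)) \<longlongrightarrow> 0) (finite_subsets_at_top UNIV)"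
  using \<phi> by (simp_all add: transform_def)

text \<open>For finite \<open>X\<close> containing \<open>Y\<close>, orthogonality gives the norm of
  the difference of partial sums exactly; both sides are then limits along \<open>X\<close>. The
  tail form is what yields uniform control over all diagonals later.\<close>

lemma sq_norm_transform_tail:
  assumes Y: "finite Y"
  shows "sq_norm M (\<lambda>z. \<phi> z - psum c Y z) = ennreal (C * (\<Sum>\<^sub>\<infinity>i\<in>- Y. (norm (c i))\<^sup>2))"
proof -
  note [measurable] = transform_measurable
  define w where "w = (\<lambda>i. (norm (c i))\<^sup>2)"
  have w: "w summable_on UNIV" using c unfolding w_def .
  have ev: "eventually (\<lambda>X. finite X \<and> Y \<subseteq> X) (finite_subsets_at_top UNIV)"
    using Y by (auto simp: eventually_finite_subsets_at_top)
  have eq: "norm (\<phi> z - psum c Y z - (psum c X z - psum c Y z)) = norm (\<phi> z - psum c X z)" for X z by simp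
  have SX: "sq_norm M (\<lambda>z. psum c X z - psum c Y z) = ennreal (C * (sum w X - sum w Y))" if X: "finite X" "Y \<subseteq> X" for X
    using sq_norm_psum[of "X - Y" c] X by (simp add: psum_diff sum_diff w_def)
  \<comment> \<open>One partial sum within distance 1 suffices to show that the norm in question is
    finite, as continuity of the norm requires.\<close>
  have "eventually (\<lambda>X. sq_norm M (\<lambda>z. \<phi> z - psum c X z) < 1) (finite_subsets_at_top UNIV)"
    using order_tendstoD(2)[OF transform_tendsto, of 1] by simp
  from eventually_happens'[OF finite_subsets_at_top_neq_bot eventually_conj[OF ev this]]
  obtain X where X: "finite X" "Y \<subseteq> X" "sq_norm M (\<lambda>z. \<phi> z - psum c X z) < 1" by blast
  have e: "norm (\<phi> z - psum c Y z) = norm ((\<phi> z - psum c X z) + (psum c X z - psum c Y z))" for z by simp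
  have "sq_norm M (\<lambda>z. (\<phi> z - psum c X z) + (psum c X z - psum c Y z)) \<le>
     2 * sq_norm M (\<lambda>z. \<phi> z - psum c X z) + 2 * sq_norm M (\<lambda>z. psum c X z - psum c Y z)"
    by (rule nn_integral_norm_squared_add_le) measurable
  also have "\<dots> < \<infinity>"
    unfolding SX[OF X(1,2)] using less_trans[OF X(3), of top] by (simp add: ennreal_mult_less_top)
  finally have fin: "sq_norm M (\<lambda>z. \<phi> z - psum c Y z) < \<infinity>" unfolding e[symmetric] .
  have l1: "((\<lambda>X. sq_norm M (\<lambda>z. psum c X z - psum c Y z)) \<longlongrightarrow> sq_norm M (\<lambda>z. \<phi> z - psum c Y z)) (finite_subsets_at_top UNIV)"
    by (rule nn_integral_norm_squared_tendsto[OF _ _ _ fin]) (use transform_tendsto in \<open>unfold eq, measurable\<close>)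
  have "((\<lambda>X. ennreal (C * (sum w X - sum w Y))) \<longlongrightarrow> ennreal (C * (infsum w UNIV - sum w Y))) (finite_subsets_at_top UNIV)"
    using has_sum_infsum[OF w] unfolding has_sum_def by (intro tendsto_ennrealI tendsto_intros)
  then have l2: "((\<lambda>X. sq_norm M (\<lambda>z. psum c X z - psum c Y z)) \<longlongrightarrow> ennreal (C * (infsum w UNIV - sum w Y))) (finite_subsets_at_top UNIV)"
    by (rule Lim_transform_eventually) (use ev in eventually_elim, simp add: SX)
  have "infsum w (UNIV - Y) = infsum w UNIV - infsum w Y" using w Y by (intro infsum_Diff) auto
  then have "infsum w (- Y) = infsum w UNIV - sum w Y" using Y by (simp add: Compl_eq_Diff_UNIV)
  then show ?thesis using tendsto_unique[OF finite_subsets_at_top_neq_bot l1 l2] by (simp add: w_def)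
qed

lemma sq_norm_transform: "sq_norm M \<phi> = ennreal (C * (\<Sum>\<^sub>\<infinity>i. (norm (c i))\<^sup>2))"
  using sq_norm_transform_tail[of "{}"] by (simp add: psum_def)

end

end

section \<open>Characters on the circle and on the torus\<close>

lemma borel_measurable_cis [measurable]: "cis \<in> borel_measurable borel"
  by (intro borel_measurable_continuous_onI continuous_intros)

lemma borel_measurable_cnj [measurable]: "cnj \<in> borel_measurable borel"
  by (intro borel_measurable_continuous_onI continuous_intros)

lemma integral_density_indicator:
  fixes f :: "'a \<Rightarrow> 'b::{banach, second_countable_topology}"
  assumes "A \<in> sets M" "f \<in> borel_measurable M"
  shows "(LINT x|density M (indicator A). f x) = (LINT x|M. indicator A x *\<^sub>R f x)"
    and "integrable (density M (indicator A)) f \<longleftrightarrow> integrable M (\<lambda>x. indicator A x *\<^sub>R f x)"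
proof -
  have "(indicator A :: 'a \<Rightarrow> ennreal) = (\<lambda>x. ennreal (indicator A x))" by (simp add: fun_eq_iff ennreal_indicator)
  then show "(LINT x|density M (indicator A). f x) = (LINT x|M. indicator A x *\<^sub>R f x)"
    "integrable (density M (indicator A)) f \<longleftrightarrow> integrable M (\<lambda>x. indicator A x *\<^sub>R f x)"
    using assms by (simp_all add: integral_density integrable_density)
qed

lemma borel_square [measurable]: "{a..b::real} \<times> {c..d::real} \<in> sets borel"
  by (intro borel_closed closed_Times closed_atLeastAtMost)

abbreviation period :: "real measure" where
  "period \<equiv> density lborel (indicator {- pi..pi})"

abbreviation period2 :: "(real \<times> real) measure" where
  "period2 \<equiv> density lborel (indicator ({- pi..pi} \<times> {- pi..pi}))"

lemma period2_eq: "period2 = period \<Otimes>\<^sub>M period"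
proof -
  have "sigma_finite_measure period"
    by (rule sigma_finite_lborel[THEN sigma_finite_measure.sigma_finite_iff_density_finite[THEN iffD2]]) (auto split: split_indicator)
  then have "period \<Otimes>\<^sub>M period = density (lborel \<Otimes>\<^sub>M lborel) (\<lambda>(x, y). indicator {- pi..pi} x * indicator {- pi..pi} y)"
    by (intro pair_measure_density) (auto intro: sigma_finite_lborel)
  also have "(\<lambda>(x, y). indicator {- pi..pi} x * indicator {- pi..pi} y :: ennreal) = indicator ({- pi..pi} \<times> {- pi..pi})"
    by (auto simp: fun_eq_iff split: split_indicator)
  finally show ?thesis by (simp add: lborel_prod)
qed

lemma finite_measure_period: "finite_measure period"
  by (rule finite_measureI) (simp add: emeasure_density)

interpretation period: finite_measure period by (rule finite_measure_period)
interpretation period_pair: pair_sigma_finite period period ..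

lemma finite_measure_period2: "finite_measure period2"
  unfolding period2_eq
proof (intro finite_measureI)
  have "emeasure (period \<Otimes>\<^sub>M period) (space period \<times> space period) = emeasure period (space period) * emeasure period (space period)"
    by (rule period.emeasure_pair_measure_Times) auto
  then show "emeasure (period \<Otimes>\<^sub>M period) (space (period \<Otimes>\<^sub>M period)) \<noteq> \<infinity>"
    unfolding space_pair_measure using period.emeasure_finite by (simp add: ennreal_mult_eq_top_iff)
qed

interpretation period2: finite_measure period2 by (rule finite_measure_period2)

lemma integral_cis_period:
  "(LINT k|period. cis (k * of_int n)) = (if n = 0 then of_real (2 * pi) else 0)"
proof -
  have "(LINT k|period. cis (k * of_int n)) = (LINT k|lborel. indicator {- pi..pi} k *\<^sub>R cis (k * of_int n))"
    by (rule integral_density_indicator) measurable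
  also have "\<dots> = (if n = 0 then of_real (2 * pi) else 0)"
  proof (cases "n = 0")
    case True then show ?thesis by (simp add: scaleR_conv_of_real)
  next
    case False
    define F where "F k = cis (k * of_int n) / (\<i> * of_int n)" for k
    have "(LINT k|lborel. indicator {- pi..pi} k *\<^sub>R cis (k * of_int n)) = F pi - F (- pi)"
    proof (rule integral_FTC_Icc)
      show "(F has_vector_derivative cis (k * of_int n)) (at k within {- pi..pi})" for k
        unfolding F_def cis_conv_exp using False
        by (auto intro!: derivative_eq_intros has_vector_derivative_real_field simp: field_simps)
      show "continuous_on {- pi..pi} (\<lambda>k. cis (k * of_int n))" by (intro continuous_intros)
    qed simp
    also have "F pi = F (- pi)"
    proof -
      have "cis (pi * of_int n) = cis (- pi * of_int n) * cis (2 * pi * of_int n)"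
        unfolding cis_mult by (rule arg_cong[where f = cis]) (simp add: algebra_simps)
      also have "cis (2 * pi * of_int n) = 1" by (rule cis_multiple_2pi) simp
      finally show ?thesis by (simp add: F_def)
    qed
    finally show ?thesis using False by simp
  qed
  finally show ?thesis .
qed

definition char1 :: "int \<Rightarrow> real \<Rightarrow> complex" where
  "char1 m k = cis (- (k * of_int m))"

definition char2 :: "int \<times> int \<Rightarrow> real \<times> real \<Rightarrow> complex" where
  "char2 x k = cis (- (fst k * of_int (fst x) + snd k * of_int (snd x)))"

lemma char1_measurable [measurable]: "char1 m \<in> borel_measurable borel"
  unfolding char1_def by measurable

lemma char2_measurable [measurable]: "char2 m \<in> borel_measurable borel"
  unfolding char2_def by (intro borel_measurable_continuous_onI continuous_intros)

lemma char1_orthogonal: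
  "integrable period (\<lambda>k. char1 i k * cnj (char1 j k))"
  "(LINT k|period. char1 i k * cnj (char1 j k)) = (if i = j then of_real (2 * pi) else 0)"
proof -
  show "integrable period (\<lambda>k. char1 i k * cnj (char1 j k))"
  proof (rule period.integrable_const_bound[where B=1])
    show "(\<lambda>k. char1 i k * cnj (char1 j k)) \<in> borel_measurable period" by measurable
  qed (simp add: char1_def norm_mult)
  have "char1 i k * cnj (char1 j k) = cis (k * of_int (j - i))" for k
    by (simp add: char1_def cis_cnj cis_mult algebra_simps)
  then show "(LINT k|period. char1 i k * cnj (char1 j k)) = (if i = j then of_real (2 * pi) else 0)"
    by (simp only: integral_cis_period) auto
qed

lemma char2_orthogonal:
  "integrable period2 (\<lambda>k. char2 i k * cnj (char2 j k))"
  "(LINT k|period2. char2 i k * cnj (char2 j k)) = (if i = j then of_real ((2 * pi)\<^sup>2) else 0)"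
proof -
  show int: "integrable period2 (\<lambda>k. char2 i k * cnj (char2 j k))"
  proof (rule period2.integrable_const_bound[where B=1])
    show "(\<lambda>k. char2 i k * cnj (char2 j k)) \<in> borel_measurable period2" by measurable
  qed (simp add: char2_def norm_mult)
  have eq: "char2 i (x, y) * cnj (char2 j (x, y)) = cis (x * of_int (fst j - fst i)) * cis (y * of_int (snd j - snd i))" for x y
    by (simp add: char2_def cis_cnj cis_mult algebra_simps)
  have "(LINT k|period2. char2 i k * cnj (char2 j k)) =
     (LINT x|period. LINT y|period. char2 i (x, y) * cnj (char2 j (x, y)))"
    using period_pair.integral_fst'[of "\<lambda>k. char2 i k * cnj (char2 j k)"] int unfolding period2_eq by simp
  also have "\<dots> = (LINT x|period. cis (x * of_int (fst j - fst i))) * (LINT y|period. cis (y * of_int (snd j - snd i)))"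
    unfolding eq by (simp del: of_int_diff)
  also have "\<dots> = (if i = j then of_real ((2 * pi)\<^sup>2) else 0)"
    unfolding integral_cis_period by (auto simp: prod_eq_iff power2_eq_square)
  finally show "(LINT k|period2. char2 i k * cnj (char2 j k)) = (if i = j then of_real ((2 * pi)\<^sup>2) else 0)" .
qed

interpretation char1: orthogonal_family period char1 "2 * pi"
  by unfold_locales (simp_all add: char1_orthogonal)

interpretation char2: orthogonal_family period2 char2 "(2 * pi)\<^sup>2"
  by unfold_locales (simp_all add: char2_orthogonal)

lemma char1_plus_2pi: "char1 m (k + 2 * pi) = char1 m k"
proof -
  have "char1 m (k + 2 * pi) = char1 m k * cis (2 * pi * of_int (- m))"
    by (simp add: char1_def cis_mult algebra_simps)
  also have "cis (2 * pi * of_int (- m)) = 1" by (rule cis_multiple_2pi) simp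
  finally show ?thesis by simp
qed

lemma char2_eq: "char2 x k = char1 (fst x) (fst k) * char1 (snd x) (snd k)"
  by (simp add: char1_def char2_def cis_mult algebra_simps)

lemma is_fourier1_iff: "is_fourier1 \<psi> \<phi> \<longleftrightarrow> (\<forall>k. \<phi> (k + 2 * pi) = \<phi> k) \<and> char1.transform \<psi> \<phi>"
proof (cases "\<phi> \<in> borel_measurable borel")
  case True
  note [measurable] = True
  have "sq_norm period (\<lambda>k. \<phi> k - char1.psum \<psi> X k) =
     (\<integral>\<^sup>+ k \<in> {- pi..pi}. ennreal ((norm (\<phi> k - char1.psum \<psi> X k))\<^sup>2) \<partial>lborel)" for X
    unfolding char1.psum_def by (subst nn_integral_density) (auto simp: mult.commute)
  then show ?thesis unfolding is_fourier1_def char1.transform_def by (simp add: char1.psum_def char1_def)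
qed (simp add: is_fourier1_def char1.transform_def)

lemma is_fourier2_iff: "is_fourier2 \<Psi> \<Phi> \<longleftrightarrow>
     (\<forall>k1 k2. \<Phi> (k1 + 2 * pi, k2) = \<Phi> (k1, k2) \<and> \<Phi> (k1, k2 + 2 * pi) = \<Phi> (k1, k2)) \<and> char2.transform \<Psi> \<Phi>"
proof (cases "\<Phi> \<in> borel_measurable borel")
  case True
  note [measurable] = True
  have "sq_norm period2 (\<lambda>k. \<Phi> k - char2.psum \<Psi> X k) =
     (\<integral>\<^sup>+ k \<in> {- pi..pi} \<times> {- pi..pi}. ennreal ((norm (\<Phi> k - char2.psum \<Psi> X k))\<^sup>2) \<partial>lborel)" for X
    unfolding char2.psum_def by (subst nn_integral_density) (auto simp: mult.commute)
  then show ?thesis unfolding is_fourier2_def char2.transform_def by (simp add: char2.psum_def char2_def)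
qed (simp add: is_fourier2_def char2.transform_def)

text \<open>Completeness supplies a function with the defining property, so the choice in
  \<open>fourier1\<close> is a genuine transform.\<close>

lemma is_fourier1_fourier1:
  assumes "(\<lambda>m. (norm (\<psi> m))\<^sup>2) summable_on UNIV"
  shows "is_fourier1 \<psi> (fourier1 \<psi>)"
proof -
  obtain X where "\<And>j::nat. finite (X j)" "char1.transform \<psi> (\<lambda>k. lim (\<lambda>j. char1.psum \<psi> (X j) k))"
    by (rule char1.transform_exists[OF assms]) blast
  then have "is_fourier1 \<psi> (\<lambda>k. lim (\<lambda>j. char1.psum \<psi> (X j) k))"
    unfolding is_fourier1_iff by (simp add: char1.psum_def char1_plus_2pi)
  then show ?thesis unfolding fourier1_def by (rule someI[of "is_fourier1 \<psi>"])
qed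

lemma is_fourier2_fourier2:
  assumes "(\<lambda>x. (norm (\<Psi> x))\<^sup>2) summable_on UNIV"
  shows "is_fourier2 \<Psi> (fourier2 \<Psi>)"
proof -
  obtain X where "\<And>j::nat. finite (X j)" "char2.transform \<Psi> (\<lambda>k. lim (\<lambda>j. char2.psum \<Psi> (X j) k))"
    by (rule char2.transform_exists[OF assms]) blast
  then have "is_fourier2 \<Psi> (\<lambda>k. lim (\<lambda>j. char2.psum \<Psi> (X j) k))"
    unfolding is_fourier2_iff by (simp add: char2.psum_def char2_eq char1_plus_2pi)
  then show ?thesis unfolding fourier2_def by (rule someI[of "is_fourier2 \<Psi>"])
qed

subsection \<open>Integration over the momentum torus\<close>

lemma nn_integral_periodic_shift:
  fixes h :: "real \<Rightarrow> ennreal"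
  assumes [measurable]: "h \<in> borel_measurable borel" and per: "\<And>x. h (x + 2 * pi) = h x"
    and c: "0 \<le> c" "c \<le> 2 * pi"
  shows "(\<integral>\<^sup>+ x \<in> {u + c..<u + c + 2 * pi}. h x \<partial>lborel) = (\<integral>\<^sup>+ x \<in> {u..<u + 2 * pi}. h x \<partial>lborel)"
proof -
  have sh: "(\<integral>\<^sup>+ x \<in> {u + 2 * pi..<u + c + 2 * pi}. h x \<partial>lborel) = (\<integral>\<^sup>+ x \<in> {u..<u + c}. h x \<partial>lborel)"
  proof -
    have "(\<integral>\<^sup>+ x \<in> {u + 2 * pi..<u + c + 2 * pi}. h x \<partial>lborel) =
      (\<integral>\<^sup>+ x. h (2 * pi + 1 * x) * indicator {u + 2 * pi..<u + c + 2 * pi} (2 * pi + 1 * x) \<partial>lborel)"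
      by (subst nn_integral_real_affine[where c = 1 and t = "2 * pi"]) auto
    also have "\<dots> = (\<integral>\<^sup>+ x \<in> {u..<u + c}. h x \<partial>lborel)"
      using per by (intro nn_integral_cong) (auto simp: add.commute split: split_indicator)
    finally show ?thesis .
  qed
  have "(\<integral>\<^sup>+ x \<in> {u + c..<u + c + 2 * pi}. h x \<partial>lborel) =
    (\<integral>\<^sup>+ x. h x * indicator {u + c..<u + 2 * pi} x + h x * indicator {u + 2 * pi..<u + c + 2 * pi} x \<partial>lborel)"
    using c by (intro nn_integral_cong) (auto split: split_indicator)
  also have "\<dots> = (\<integral>\<^sup>+ x \<in> {u + c..<u + 2 * pi}. h x \<partial>lborel) + (\<integral>\<^sup>+ x \<in> {u..<u + c}. h x \<partial>lborel)"
    by (subst nn_integral_add) (auto simp: sh)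
  also have "\<dots> = (\<integral>\<^sup>+ x. h x * indicator {u + c..<u + 2 * pi} x + h x * indicator {u..<u + c} x \<partial>lborel)"
    by (subst nn_integral_add) auto
  also have "\<dots> = (\<integral>\<^sup>+ x \<in> {u..<u + 2 * pi}. h x \<partial>lborel)"
    using c by (intro nn_integral_cong) (auto split: split_indicator)
  finally show ?thesis .
qed

lemma nn_integral_period_shift:
  fixes h :: "real \<Rightarrow> ennreal"
  assumes [measurable]: "h \<in> borel_measurable borel" and per: "\<And>x. h (x + 2 * pi) = h x"
    and c: "\<bar>c\<bar> \<le> 2 * pi"
  shows "(\<integral>\<^sup>+ x \<in> {c - pi..c + pi}. h x \<partial>lborel) = (\<integral>\<^sup>+ x. h x \<partial>period)"
proof -
  have cl: "(\<integral>\<^sup>+ x \<in> {v - pi..v + pi}. h x \<partial>lborel) = (\<integral>\<^sup>+ x \<in> {v - pi..<v - pi + 2 * pi}. h x \<partial>lborel)" for v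
    by (intro nn_integral_cong_AE, rule AE_mp[OF AE_lborel_singleton[of "v + pi"]]) (auto split: split_indicator)
  have "(\<integral>\<^sup>+ x \<in> {c - pi..<c - pi + 2 * pi}. h x \<partial>lborel) = (\<integral>\<^sup>+ x \<in> {0 - pi..<0 - pi + 2 * pi}. h x \<partial>lborel)"
  proof (cases "c \<ge> 0")
    case True
    then show ?thesis using nn_integral_periodic_shift[OF assms(1) per, of c "- pi"] c by (simp add: algebra_simps)
  next
    case False
    then show ?thesis using nn_integral_periodic_shift[OF assms(1) per, of "- c" "c - pi"] c by (simp add: algebra_simps)
  qed
  then have "(\<integral>\<^sup>+ x \<in> {c - pi..c + pi}. h x \<partial>lborel) = (\<integral>\<^sup>+ x \<in> {0 - pi..0 + pi}. h x \<partial>lborel)" unfolding cl .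
  also have "\<dots> = (\<integral>\<^sup>+ x. h x \<partial>period)"
    by (subst nn_integral_density) (auto simp: mult.commute)
  finally show ?thesis .
qed

text \<open>The momentum with \<open>l1\<close> equal to the first coordinate and second component
  equal to the second coordinate. It has integer entries and determinant 1, so it respects the
  period lattice; the limit integrand depends on the first coordinate and on the transform
  only.\<close>

definition shear :: "real \<times> real \<Rightarrow> real \<times> real" where
  "shear z = (fst z - snd z, snd z)"

lemma shear_measurable [measurable]: "shear \<in> borel_measurable borel"
  unfolding shear_def by (intro borel_measurable_continuous_onI continuous_intros)

lemma momentum_measurable [measurable]: "momentum \<in> borel_measurable borel"
  unfolding momentum_def by (intro borel_measurable_continuous_onI continuous_intros) auto

lemma nn_integral_period2:
  fixes F :: "real \<times> real \<Rightarrow> ennreal"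
  assumes [measurable]: "F \<in> borel_measurable borel"
  shows "(\<integral>\<^sup>+ z. F z \<partial>period2) = (\<integral>\<^sup>+ x. \<integral>\<^sup>+ y. F (x, y) \<partial>period \<partial>period)"
    and "(\<integral>\<^sup>+ z. F z \<partial>period2) = (\<integral>\<^sup>+ y. \<integral>\<^sup>+ x. F (x, y) \<partial>period \<partial>period)"
proof -
  have "sets (period \<Otimes>\<^sub>M period) = sets borel" unfolding period2_eq[symmetric] by simp
  then have [measurable]: "F \<in> borel_measurable (period \<Otimes>\<^sub>M period)"
    using assms by (simp cong: measurable_cong_sets)
  show "(\<integral>\<^sup>+ z. F z \<partial>period2) = (\<integral>\<^sup>+ x. \<integral>\<^sup>+ y. F (x, y) \<partial>period \<partial>period)"
    unfolding period2_eq by (rule period.nn_integral_fst[symmetric]) measurable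
  show "(\<integral>\<^sup>+ z. F z \<partial>period2) = (\<integral>\<^sup>+ y. \<integral>\<^sup>+ x. F (x, y) \<partial>period \<partial>period)"
    unfolding period2_eq by (rule period_pair.nn_integral_snd[symmetric]) measurable
qed

context
  fixes F :: "real \<times> real \<Rightarrow> ennreal"
  assumes F [measurable]: "F \<in> borel_measurable borel"
    and per: "\<And>k1 k2. F (k1 + 2 * pi, k2) = F (k1, k2)" "\<And>k1 k2. F (k1, k2 + 2 * pi) = F (k1, k2)"
begin

text \<open>For fixed second coordinate the shear is a translation of the first one, which does not
  change an integral over a full period.\<close>

lemma nn_integral_shear: "(\<integral>\<^sup>+ z. F (shear z) \<partial>period2) = (\<integral>\<^sup>+ k. F k \<partial>period2)"
proof -
  have "(\<integral>\<^sup>+ x. F (x - y, y) \<partial>period) = (\<integral>\<^sup>+ x. F (x, y) \<partial>period)" if y: "\<bar>y\<bar> \<le> pi" for y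
  proof -
    have m [measurable]: "(\<lambda>x. F (x, y)) \<in> borel_measurable borel" "(\<lambda>x. F (x - y, y)) \<in> borel_measurable borel" by measurable
    have "(\<integral>\<^sup>+ x. F (x - y, y) \<partial>period) = (\<integral>\<^sup>+ x. F (x - y, y) * indicator {- pi..pi} x \<partial>lborel)"
      by (subst nn_integral_density) (auto simp: mult.commute)
    also have "\<dots> = (\<integral>\<^sup>+ x. F (y + 1 * x - y, y) * indicator {- pi..pi} (y + 1 * x) \<partial>lborel)"
      by (subst nn_integral_real_affine[where c = 1 and t = y]) auto
    also have "\<dots> = (\<integral>\<^sup>+ x \<in> {- y - pi..- y + pi}. F (x, y) \<partial>lborel)"
      by (intro nn_integral_cong) (auto split: split_indicator)
    also have "\<dots> = (\<integral>\<^sup>+ x. F (x, y) \<partial>period)"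
      using y by (intro nn_integral_period_shift m per) simp
    finally show ?thesis .
  qed
  note * = this
  have "(\<integral>\<^sup>+ z. F (shear z) \<partial>period2) = (\<integral>\<^sup>+ y. \<integral>\<^sup>+ x. F (x - y, y) \<partial>period \<partial>period)"
    by (subst nn_integral_period2(2), measurable, simp add: shear_def)
  also have "\<dots> = (\<integral>\<^sup>+ y. \<integral>\<^sup>+ x. F (x, y) \<partial>period \<partial>period)"
  proof (rule nn_integral_cong_AE)
    show "AE y in period. (\<integral>\<^sup>+ x. F (x - y, y) \<partial>period) = (\<integral>\<^sup>+ x. F (x, y) \<partial>period)"
      using * by (subst AE_density) (auto simp: indicator_def abs_le_iff)
  qed
  also have "\<dots> = (\<integral>\<^sup>+ k. F k \<partial>period2)" by (rule nn_integral_period2(2)[symmetric]) measurable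
  finally show ?thesis .
qed

text \<open>For fixed \<open>x\<close> put \<open>- x + 2 * y\<close> for the second coordinate:
  then \<open>momentum\<close> becomes \<open>shear (x, y)\<close>, the interval of length
  \<open>4 * pi\<close> becomes a period centred at \<open>x / 2\<close>, and the factor 2 is the
  Jacobian.\<close>

lemma nn_integral_rectangle:
  "(\<integral>\<^sup>+ z \<in> {- pi..pi} \<times> {- 2 * pi..2 * pi}. F (momentum z) \<partial>lborel) = 2 * (\<integral>\<^sup>+ z. F (shear z) \<partial>period2)"
proof -
  have inner: "(\<integral>\<^sup>+ y. F (momentum (x, y)) * indicator {- 2 * pi..2 * pi} y \<partial>lborel) = 2 * (\<integral>\<^sup>+ y. F (shear (x, y)) \<partial>period)"
    if x: "\<bar>x\<bar> \<le> pi" for x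
  proof -
    have m [measurable]: "(\<lambda>y. F (x - y, y)) \<in> borel_measurable borel" "(\<lambda>y. F (momentum (x, y))) \<in> borel_measurable borel"
      by measurable
    have p: "F (x - (y + 2 * pi), y + 2 * pi) = F (x - y, y)" for y
      using per(1)[of "x - (y + 2 * pi)" "y + 2 * pi"] per(2)[of "x - y" y] by simp
    have "(\<integral>\<^sup>+ y. F (momentum (x, y)) * indicator {- 2 * pi..2 * pi} y \<partial>lborel) =
      2 * (\<integral>\<^sup>+ y. F (momentum (x, - x + 2 * y)) * indicator {- 2 * pi..2 * pi} (- x + 2 * y) \<partial>lborel)"
      by (subst nn_integral_real_affine[where c = 2 and t = "- x"]) auto
    also have "(\<integral>\<^sup>+ y. F (momentum (x, - x + 2 * y)) * indicator {- 2 * pi..2 * pi} (- x + 2 * y) \<partial>lborel) =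
      (\<integral>\<^sup>+ y \<in> {x / 2 - pi..x / 2 + pi}. F (x - y, y) \<partial>lborel)"
      by (intro nn_integral_cong) (auto simp: momentum_def diff_divide_distrib split: split_indicator)
    also have "\<dots> = (\<integral>\<^sup>+ y. F (x - y, y) \<partial>period)"
      using x by (intro nn_integral_period_shift m p) simp
    finally show ?thesis by (simp add: shear_def)
  qed
  have "(\<integral>\<^sup>+ z \<in> {- pi..pi} \<times> {- 2 * pi..2 * pi}. F (momentum z) \<partial>lborel) =
     (\<integral>\<^sup>+ z \<in> {- pi..pi} \<times> {- 2 * pi..2 * pi}. F (momentum z) \<partial>(lborel \<Otimes>\<^sub>M lborel))"
    by (simp add: lborel_prod)
  also have "\<dots> = (\<integral>\<^sup>+ x. \<integral>\<^sup>+ y. F (momentum (x, y)) * indicator ({- pi..pi} \<times> {- 2 * pi..2 * pi}) (x, y) \<partial>lborel \<partial>lborel)"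
    by (rule lborel.nn_integral_fst[symmetric]) (simp add: lborel_prod)
  also have "\<dots> = (\<integral>\<^sup>+ x. indicator {- pi..pi} x * (\<integral>\<^sup>+ y. F (momentum (x, y)) * indicator {- 2 * pi..2 * pi} y \<partial>lborel) \<partial>lborel)"
    by (intro nn_integral_cong) (auto simp: indicator_times split: split_indicator)
  also have "\<dots> = (\<integral>\<^sup>+ x. indicator {- pi..pi} x * (2 * (\<integral>\<^sup>+ y. F (shear (x, y)) \<partial>period)) \<partial>lborel)"
    using inner by (intro nn_integral_cong) (auto split: split_indicator simp: abs_le_iff)
  also have "\<dots> = 2 * (\<integral>\<^sup>+ x. indicator {- pi..pi} x * (\<integral>\<^sup>+ y. F (shear (x, y)) \<partial>period) \<partial>lborel)"
    by (subst nn_integral_cmult[symmetric]) (auto intro!: nn_integral_cong simp: mult.left_commute)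
  also have "(\<integral>\<^sup>+ x. indicator {- pi..pi} x * (\<integral>\<^sup>+ y. F (shear (x, y)) \<partial>period) \<partial>lborel) =
     (\<integral>\<^sup>+ x. \<integral>\<^sup>+ y. F (shear (x, y)) \<partial>period \<partial>period)"
    by (subst nn_integral_density[of _ lborel]) auto
  also have "\<dots> = (\<integral>\<^sup>+ z. F (shear z) \<partial>period2)"
    by (rule nn_integral_period2(1)[symmetric]) measurable
  finally show ?thesis .
qed

text \<open>Moving two of the outer boxes by \<open>(2 * pi, - 2 * pi)\<close> or its negative
  completes the other boxes to a rectangle. Such a move shifts the first momentum component by a
  period and leaves the second one fixed.\<close>

lemma nn_integral_Lboxes:
  "(\<integral>\<^sup>+ z \<in> Lboxes 0. F (momentum z) \<partial>lborel) + (\<integral>\<^sup>+ z \<in> Lboxes 1. F (momentum z) \<partial>lborel) =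
   (\<integral>\<^sup>+ z \<in> {- pi..pi} \<times> {- 2 * pi..2 * pi}. F (momentum z) \<partial>lborel)"
proof -
  have tr: "(\<integral>\<^sup>+ z. F (momentum z) * indicator S z \<partial>lborel) = (\<integral>\<^sup>+ z. F (momentum z) * indicator S (c + z) \<partial>lborel)"
    if [measurable]: "S \<in> sets borel" and c: "c = (2 * pi, - 2 * pi) \<or> c = (- 2 * pi, 2 * pi)" for S and c :: "real \<times> real"
  proof -
    have k: "F (momentum (c + z)) = F (momentum z)" for z
      using c per(1)[of "fst (momentum z)" "snd (momentum z)"] per(1)[of "fst (momentum z) - 2 * pi" "snd (momentum z)"]
      by (auto simp: momentum_def field_simps)
    have "(\<integral>\<^sup>+ z. F (momentum z) * indicator S z \<partial>lborel) = (\<integral>\<^sup>+ z. F (momentum z) * indicator S z \<partial>(distr lborel borel ((+) c)))"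
      by (simp add: lborel_distr_plus)
    also have "\<dots> = (\<integral>\<^sup>+ z. F (momentum (c + z)) * indicator S (c + z) \<partial>lborel)"
      by (rule nn_integral_distr) measurable
    finally show ?thesis unfolding k .
  qed
  let ?B5 = "{- 2 * pi..- pi} \<times> {0..pi} :: (real \<times> real) set" and ?B6 = "{- pi..0} \<times> {- 2 * pi..- pi} :: (real \<times> real) set"
    and ?B7 = "{pi..2 * pi} \<times> {- pi..0} :: (real \<times> real) set" and ?B8 = "{0..pi} \<times> {pi..2 * pi} :: (real \<times> real) set"
  have ae: "AE z :: real \<times> real in lborel. sin (fst z) \<noteq> 0 \<and> sin (snd z) \<noteq> 0"
  proof -
    have "AE z in (lborel :: (real \<times> real) measure). sin (fst z) \<noteq> 0"
      by (rule AE_plane_fst[of "\<lambda>z. sin (fst z) = 0"]) (auto intro!: borel_closed closed_Collect_eq continuous_intros simp: countable_sin_eq_0)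
    moreover have "AE z in (lborel :: (real \<times> real) measure). sin (snd z) \<noteq> 0"
      by (rule AE_plane_snd[of "\<lambda>z. sin (snd z) = 0"]) (auto intro!: borel_closed closed_Collect_eq continuous_intros simp: countable_sin_eq_0)
    ultimately show ?thesis by eventually_elim simp
  qed
  have [measurable]: "Lboxes 0 \<in> sets borel" "Lboxes 1 \<in> sets borel"
    using closed_Lboxes[of 0] closed_Lboxes[of 1] by auto
  have sp: "sin x \<noteq> 0 \<Longrightarrow> x \<noteq> 0 \<and> x \<noteq> pi \<and> x \<noteq> - pi \<and> x \<noteq> 2 * pi \<and> x \<noteq> - 2 * pi" for x :: real
    by auto
  have i1: "AE z in lborel. F (momentum z) * indicator (Lboxes 1) z =
     F (momentum z) * indicator ?B5 z + F (momentum z) * indicator ?B6 z + F (momentum z) * indicator ?B7 z + F (momentum z) * indicator ?B8 z"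
    using ae
  proof eventually_elim
    case (elim z)
    then have "indicator (Lboxes 1) z = (indicator ?B5 z + indicator ?B6 z + indicator ?B7 z + indicator ?B8 z :: ennreal)"
      using sp[of "fst z"] sp[of "snd z"] pi_gt_zero unfolding Lboxes_1
      by (cases z) (auto simp: indicator_def simp del: pi_gt_zero)
    then show ?case by (simp only: distrib_left)
  qed
  have "(\<integral>\<^sup>+ z \<in> Lboxes 1. F (momentum z) \<partial>lborel) = (\<integral>\<^sup>+ z. F (momentum z) * indicator ?B5 z + F (momentum z) * indicator ?B6 z + F (momentum z) * indicator ?B7 z + F (momentum z) * indicator ?B8 z \<partial>lborel)"
    by (rule nn_integral_cong_AE[OF i1])
  also have "\<dots> = (\<integral>\<^sup>+ z. F (momentum z) * indicator ?B5 z \<partial>lborel) + (\<integral>\<^sup>+ z. F (momentum z) * indicator ?B6 z \<partial>lborel) + (\<integral>\<^sup>+ z. F (momentum z) * indicator ?B7 z \<partial>lborel) + (\<integral>\<^sup>+ z. F (momentum z) * indicator ?B8 z \<partial>lborel)"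
    by (simp add: nn_integral_add)
  also have "\<dots> = (\<integral>\<^sup>+ z. F (momentum z) * indicator ?B5 ((- 2 * pi, 2 * pi) + z) \<partial>lborel) + (\<integral>\<^sup>+ z. F (momentum z) * indicator ?B6 z \<partial>lborel) + (\<integral>\<^sup>+ z. F (momentum z) * indicator ?B7 ((2 * pi, - 2 * pi) + z) \<partial>lborel) + (\<integral>\<^sup>+ z. F (momentum z) * indicator ?B8 z \<partial>lborel)"
    using tr[of ?B5 "(- 2 * pi, 2 * pi)"] tr[of ?B7 "(2 * pi, - 2 * pi)"] by simp
  finally have L1: "(\<integral>\<^sup>+ z \<in> Lboxes 1. F (momentum z) \<partial>lborel) = \<dots>" .
  have i2: "AE z in lborel. F (momentum z) * indicator (Lboxes 0) z + (F (momentum z) * indicator ?B5 ((- 2 * pi, 2 * pi) + z) + F (momentum z) * indicator ?B6 z + F (momentum z) * indicator ?B7 ((2 * pi, - 2 * pi) + z) + F (momentum z) * indicator ?B8 z) =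
     F (momentum z) * indicator ({- pi..pi} \<times> {- 2 * pi..2 * pi}) z"
    using ae
  proof eventually_elim
    case (elim z)
    then have "(indicator (Lboxes 0) z + (indicator ?B5 ((- 2 * pi, 2 * pi) + z) + indicator ?B6 z + indicator ?B7 ((2 * pi, - 2 * pi) + z) + indicator ?B8 z) :: ennreal) =
       indicator ({- pi..pi} \<times> {- 2 * pi..2 * pi}) z"
    proof (cases z)
      case (Pair a b)
      have a: "a \<noteq> 0" "a \<noteq> pi" "a \<noteq> - pi" and b: "b \<noteq> 0" "b \<noteq> pi" "b \<noteq> - pi" "b \<noteq> 2 * pi" "b \<noteq> - 2 * pi"
        using elim sp[of a] sp[of b] Pair by auto
      then have da: "a < - pi \<or> - pi < a \<and> a < 0 \<or> 0 < a \<and> a < pi \<or> pi < a" by linarith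
      from b have db: "b < - 2 * pi \<or> - 2 * pi < b \<and> b < - pi \<or> - pi < b \<and> b < 0 \<or> 0 < b \<and> b < pi \<or>
          pi < b \<and> b < 2 * pi \<or> 2 * pi < b" by linarith
      from da db show ?thesis unfolding Pair Lboxes_0 using pi_gt_zero
        by (elim disjE conjE) (simp_all add: indicator_def del: pi_gt_zero)
    qed
    then show ?case by (simp only: distrib_left[symmetric])
  qed
  have [measurable]: "(\<lambda>z. indicator S (c + z) :: ennreal) \<in> borel_measurable borel" if [measurable]: "S \<in> sets borel" for S and c :: "real \<times> real"
    by measurable
  show ?thesis unfolding L1
    by (subst nn_integral_cong_AE[OF i2, symmetric]) (simp add: nn_integral_add)
qed

end

section \<open>Signed integrals over the torus\<close>

lemma set_integral_lebesgue_lborel: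
  fixes f :: "'a::euclidean_space \<Rightarrow> real"
  assumes "S \<in> sets borel" and "f \<in> borel_measurable borel"
  shows "set_integrable lebesgue S f \<longleftrightarrow> set_integrable lborel S f"
    and "(LINT x:S|lebesgue. f x) = (LINT x:S|lborel. f x)"
proof -
  have "(\<lambda>x. indicator S x *\<^sub>R f x) \<in> borel_measurable lborel" using assms by measurable
  then show "set_integrable lebesgue S f \<longleftrightarrow> set_integrable lborel S f"
    "(LINT x:S|lebesgue. f x) = (LINT x:S|lborel. f x)"
    unfolding set_integrable_def set_lebesgue_integral_def
    by (simp_all add: integrable_completion integral_completion)
qed

lemma set_integral_eq_nn_integral:
  fixes f :: "'a \<Rightarrow> real"
  assumes [measurable]: "S \<in> sets M" "f \<in> borel_measurable M"
    and fin: "(\<integral>\<^sup>+ x \<in> S. ennreal \<bar>f x\<bar> \<partial>M) < \<infinity>"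
  shows "set_integrable M S f"
    and "(LINT x:S|M. f x) = enn2real (\<integral>\<^sup>+ x \<in> S. ennreal (f x) \<partial>M) - enn2real (\<integral>\<^sup>+ x \<in> S. ennreal (- f x) \<partial>M)"
proof -
  have e: "ennreal \<bar>indicator S x *\<^sub>R f x\<bar> = ennreal \<bar>f x\<bar> * indicator S x"
    "ennreal (indicator S x *\<^sub>R f x) = ennreal (f x) * indicator S x"
    "ennreal (- (indicator S x *\<^sub>R f x)) = ennreal (- f x) * indicator S x" for x
    by (auto split: split_indicator)
  show i: "set_integrable M S f"
    unfolding set_integrable_def by (rule integrableI_bounded) (use fin e in \<open>simp_all\<close>)
  show "(LINT x:S|M. f x) = enn2real (\<integral>\<^sup>+ x \<in> S. ennreal (f x) \<partial>M) - enn2real (\<integral>\<^sup>+ x \<in> S. ennreal (- f x) \<partial>M)"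
    using real_lebesgue_integral_def[OF i[unfolded set_integrable_def]] unfolding set_lebesgue_integral_def e .
qed

context
  fixes F :: "real \<times> real \<Rightarrow> real"
  assumes F [measurable]: "F \<in> borel_measurable borel"
    and per: "\<And>k1 k2. F (k1 + 2 * pi, k2) = F (k1, k2)" "\<And>k1 k2. F (k1, k2 + 2 * pi) = F (k1, k2)"
    and int: "integrable period2 F"
begin

lemma integrable_shear: "integrable period2 (\<lambda>z. F (shear z))"
proof (rule integrableI_bounded)
  have "(\<integral>\<^sup>+ z. ennreal (norm (F (shear z))) \<partial>period2) = (\<integral>\<^sup>+ z. ennreal (norm (F z)) \<partial>period2)"
    by (rule nn_integral_shear[of "\<lambda>z. ennreal (norm (F z))"]) (simp_all add: per)
  then show "(\<integral>\<^sup>+ z. ennreal (norm (F (shear z))) \<partial>period2) < \<infinity>"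
    using int by (simp add: integrable_iff_bounded)
qed measurable

lemma integrable_Lboxes:
  assumes "\<mu> \<in> {0, 1}"
  shows "set_integrable lebesgue (Lboxes \<mu>) (\<lambda>z. F (momentum z))"
    and "(LINT z:Lboxes \<mu>|lebesgue. F (momentum z)) =
      enn2real (\<integral>\<^sup>+ z \<in> Lboxes \<mu>. ennreal (F (momentum z)) \<partial>lborel) - enn2real (\<integral>\<^sup>+ z \<in> Lboxes \<mu>. ennreal (- F (momentum z)) \<partial>lborel)"
    and "(\<integral>\<^sup>+ z \<in> Lboxes \<mu>. ennreal (F (momentum z)) \<partial>lborel) < \<infinity>"
    and "(\<integral>\<^sup>+ z \<in> Lboxes \<mu>. ennreal (- F (momentum z)) \<partial>lborel) < \<infinity>"
proof -
  have L [measurable]: "Lboxes \<mu> \<in> sets borel" using closed_Lboxes[OF assms] by auto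
  have "(\<integral>\<^sup>+ z \<in> Lboxes \<mu>. ennreal \<bar>F (momentum z)\<bar> \<partial>lborel) \<le>
    (\<integral>\<^sup>+ z \<in> Lboxes 0. ennreal \<bar>F (momentum z)\<bar> \<partial>lborel) + (\<integral>\<^sup>+ z \<in> Lboxes 1. ennreal \<bar>F (momentum z)\<bar> \<partial>lborel)"
    using assms by auto
  also have "\<dots> = 2 * (\<integral>\<^sup>+ z. ennreal \<bar>F (shear z)\<bar> \<partial>period2)"
    by (subst nn_integral_Lboxes[of "\<lambda>z. ennreal \<bar>F z\<bar>"], simp_all add: per del: One_nat_def)
       (rule nn_integral_rectangle[of "\<lambda>z. ennreal \<bar>F z\<bar>", simplified], simp_all add: per)
  also have "\<dots> < \<infinity>" using integrable_shear by (simp add: integrable_iff_bounded ennreal_mult_less_top)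
  finally have fin: "(\<integral>\<^sup>+ z \<in> Lboxes \<mu>. ennreal \<bar>F (momentum z)\<bar> \<partial>lborel) < \<infinity>" .
  show "set_integrable lebesgue (Lboxes \<mu>) (\<lambda>z. F (momentum z))"
    "(LINT z:Lboxes \<mu>|lebesgue. F (momentum z)) =
      enn2real (\<integral>\<^sup>+ z \<in> Lboxes \<mu>. ennreal (F (momentum z)) \<partial>lborel) - enn2real (\<integral>\<^sup>+ z \<in> Lboxes \<mu>. ennreal (- F (momentum z)) \<partial>lborel)"
    using set_integral_eq_nn_integral[of "Lboxes \<mu>" lborel "\<lambda>z. F (momentum z)"] fin
    by (simp_all add: set_integral_lebesgue_lborel)
  show "(\<integral>\<^sup>+ z \<in> Lboxes \<mu>. ennreal (F (momentum z)) \<partial>lborel) < \<infinity>"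
    by (rule le_less_trans[OF nn_integral_mono fin]) (auto intro!: ennreal_leI mult_right_mono)
  show "(\<integral>\<^sup>+ z \<in> Lboxes \<mu>. ennreal (- F (momentum z)) \<partial>lborel) < \<infinity>"
    by (rule le_less_trans[OF nn_integral_mono fin]) (auto intro!: ennreal_leI mult_right_mono)
qed

text \<open>The nonnegative identities are applied to the positive and the negative part, the cases
  \<open>c = 1\<close> and \<open>c = - 1\<close>. The factor 2 reflects that
  \<open>momentum\<close> halves areas.\<close>

lemma integral_Lboxes:
  "(\<Sum>\<mu>\<in>{0, 1}. LINT z:Lboxes \<mu>|lebesgue. F (momentum z)) = 2 * (LINT z|period2. F (shear z))"
proof -
  have nn: "(\<integral>\<^sup>+ z \<in> Lboxes 0. ennreal (c * F (momentum z)) \<partial>lborel) + (\<integral>\<^sup>+ z \<in> Lboxes 1. ennreal (c * F (momentum z)) \<partial>lborel) =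
    2 * (\<integral>\<^sup>+ z. ennreal (c * F (shear z)) \<partial>period2)" for c
    using nn_integral_Lboxes[of "\<lambda>z. ennreal (c * F z)"] nn_integral_rectangle[of "\<lambda>z. ennreal (c * F z)"] per by simp
  have e: "enn2real (\<integral>\<^sup>+ z \<in> Lboxes 0. ennreal (c * F (momentum z)) \<partial>lborel) + enn2real (\<integral>\<^sup>+ z \<in> Lboxes 1. ennreal (c * F (momentum z)) \<partial>lborel) =
    2 * enn2real (\<integral>\<^sup>+ z. ennreal (c * F (shear z)) \<partial>period2)" if c: "c \<in> {1, - 1}" for c
  proof -
    have "(\<integral>\<^sup>+ z \<in> Lboxes \<mu>. ennreal (c * F (momentum z)) \<partial>lborel) < top" if "\<mu> \<in> {0, 1}" for \<mu>
      using integrable_Lboxes(3,4)[OF that] c by auto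
    then have "enn2real (\<integral>\<^sup>+ z \<in> Lboxes 0. ennreal (c * F (momentum z)) \<partial>lborel) + enn2real (\<integral>\<^sup>+ z \<in> Lboxes 1. ennreal (c * F (momentum z)) \<partial>lborel) =
      enn2real ((\<integral>\<^sup>+ z \<in> Lboxes 0. ennreal (c * F (momentum z)) \<partial>lborel) + (\<integral>\<^sup>+ z \<in> Lboxes 1. ennreal (c * F (momentum z)) \<partial>lborel))"
      by (intro enn2real_plus[symmetric]) auto
    then show ?thesis unfolding nn by (simp add: enn2real_mult)
  qed
  have "(LINT z|period2. F (shear z)) = enn2real (\<integral>\<^sup>+ z. ennreal (F (shear z)) \<partial>period2) - enn2real (\<integral>\<^sup>+ z. ennreal (- F (shear z)) \<partial>period2)"
    by (rule real_lebesgue_integral_def[OF integrable_shear])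
  then show ?thesis using e[of 1] e[of "- 1"]
    by (simp add: integrable_Lboxes(2) del: One_nat_def)
qed

end

subsection \<open>Parseval's identity along diagonals\<close>

text \<open>Infinite sums are rewritten as integrals over a counting measure so that Tonelli's
  theorem can exchange them with integrals over the circle.\<close>

lemma nn_integral_count_space_infsum:
  fixes f :: "'i \<Rightarrow> real"
  assumes "f summable_on A" "\<And>x. x \<in> A \<Longrightarrow> 0 \<le> f x"
  shows "(\<integral>\<^sup>+ x. ennreal (f x) \<partial>count_space A) = ennreal (infsum f A)"
proof -
  have "(\<lambda>x. norm (f x)) summable_on A"
    by (rule summable_on_cong[THEN iffD1, OF _ assms(1)]) (use assms(2) in auto)
  then have a: "Infinite_Set_Sum.abs_summable_on f A" using abs_summable_equivalent by blast
  show ?thesis using nn_integral_conv_infsetsum[OF a assms(2)] infsetsum_infsum[OF a] by simp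
qed

lemma has_sum_nn_integral_count_space:
  fixes f :: "'i \<Rightarrow> real"
  assumes "(\<integral>\<^sup>+ x. ennreal (f x) \<partial>count_space UNIV) = ennreal q" "\<And>x. 0 \<le> f x" "0 \<le> q"
  shows "(f has_sum q) UNIV"
proof -
  have "integrable (count_space UNIV) f"
    by (rule integrableI_bounded) (use assms in auto)
  then have "Infinite_Set_Sum.abs_summable_on f UNIV" unfolding Infinite_Set_Sum.abs_summable_on_def .
  then have "f summable_on UNIV"
    using abs_summable_equivalent[of f UNIV] abs_summable_summable by blast
  moreover from this have "infsum f UNIV = q"
    using nn_integral_count_space_infsum[of f UNIV] assms by (simp add: infsum_nonneg)
  ultimately show ?thesis by (simp add: has_sum_iff)
qed

lemma norm_braket_le: "cmod (braket u w) \<le> norm u * norm w"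
proof -
  have "cmod (braket u w) \<le> (\<Sum>i\<in>UNIV. cmod (u $ i) * cmod (w $ i))"
    unfolding braket_def by (rule order_trans[OF norm_sum]) (simp add: norm_mult)
  also have "\<dots> \<le> norm u * norm w"
    unfolding norm_vec_def using L2_set_mult_ineq[of "\<lambda>i. cmod (u $ i)" "\<lambda>i. cmod (w $ i)" UNIV] by simp
  finally show ?thesis .
qed

lemma braket_diff: "braket u (v - w) = braket u v - braket u w"
  unfolding braket_def by (simp add: right_diff_distrib sum_subtractf)

lemma braket_sum: "braket u (sum f X) = (\<Sum>x\<in>X. braket u (f x))"
  unfolding braket_def by (simp add: sum_distrib_left) (rule sum.swap)

lemma braket_scale: "braket u (c *s w) = c * braket u w"
  unfolding braket_def by (simp add: sum_distrib_left algebra_simps)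

lemma braket_measurable [measurable]:
  assumes [measurable]: "f \<in> borel_measurable M" "g \<in> borel_measurable M"
  shows "(\<lambda>z. braket (f z) (g z)) \<in> borel_measurable M"
proof -
  have n: "(\<lambda>x :: complex ^ 2. x $ i) \<in> borel_measurable borel" for i
    by (intro borel_measurable_continuous_onI continuous_intros)
  have [measurable]: "(\<lambda>z. f z $ i) \<in> borel_measurable M" "(\<lambda>z. g z $ i) \<in> borel_measurable M" for i
    using measurable_compose[OF assms(1) n] measurable_compose[OF assms(2) n] by auto
  show ?thesis unfolding braket_def by measurable
qed

lemma char2_shear: "char2 x (shear (k, l)) = char1 (fst x) k * char1 (snd x - fst x) l"
  by (simp add: char1_def char2_def shear_def cis_mult algebra_simps)

lemma fst_borel [measurable]: "fst \<in> borel_measurable (borel :: (real \<times> real) measure)"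
  and snd_borel [measurable]: "snd \<in> borel_measurable (borel :: (real \<times> real) measure)"
  by (intro borel_measurable_continuous_onI continuous_intros)+

lemma sq_norm_fourier2:
  assumes "(\<lambda>x. (norm (\<Psi> x))\<^sup>2) summable_on UNIV"
  shows "sq_norm period2 (fourier2 \<Psi>) = ennreal ((2 * pi)\<^sup>2 * (\<Sum>\<^sub>\<infinity>x. (norm (\<Psi> x))\<^sup>2))"
  by (rule char2.sq_norm_transform) (use is_fourier2_fourier2[OF assms] assms in \<open>simp_all add: is_fourier2_iff\<close>)

text \<open>Embeds scalar coefficients as first components, so that
  \<open>char1.sq_norm_psum\<close> also serves for scalar series.\<close>

lemma norm_axis_1_cmod: "norm (axis 1 c :: complex ^ 2) = cmod c"
  by (simp add: norm_vec_def L2_set_def sum_2 axis_def)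

lemma bij_diag: "bij (\<lambda>(n, m). (m, n + m) :: int \<times> int)"
  by (rule o_bij[of "\<lambda>(x, y). (y - x, x)"]) (auto simp: fun_eq_iff)

lemma diag_state_summable:
  assumes \<Psi>: "(\<lambda>x. (norm (\<Psi> x))\<^sup>2) summable_on UNIV"
  shows "(\<lambda>m. (norm (diag_state \<Psi> n m))\<^sup>2) summable_on UNIV"
proof -
  have "(\<lambda>x. (norm (\<Psi> x))\<^sup>2) summable_on range (\<lambda>m. (m, n + m))"
    using \<Psi> by (rule summable_on_subset_banach) simp
  then have "((\<lambda>x. (norm (\<Psi> x))\<^sup>2) \<circ> (\<lambda>m. (m, n + m))) summable_on UNIV"
    by (subst (asm) summable_on_reindex) (auto simp: inj_on_def)
  then show ?thesis by (simp add: o_def diag_state_def)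
qed

text \<open>Both sides are limits of the same quantity for finitely supported truncations of the
  state: one in the plane, the other in the disjoint union of the circles indexed by \<open>n\<close>.\<close>
lemma parseval_diagonal_integrated:
  fixes e :: "real \<Rightarrow> complex ^ 2"
  assumes \<Psi>: "(\<lambda>x. (norm (\<Psi> x))\<^sup>2) summable_on UNIV"
    and e [measurable]: "e \<in> borel_measurable borel" and ne: "\<And>x. norm (e x) = 1"
    and B [measurable]: "B \<in> sets borel"
  shows "sq_norm period2 (\<lambda>z. indicator B (fst z) *\<^sub>R braket (e (fst z)) (fourier2 \<Psi> (shear z))) =
     ennreal (2 * pi) * (\<integral>\<^sup>+ x. sq_norm (count_space UNIV) (\<lambda>n. indicator B x *\<^sub>R braket (e x) (fourier1 (diag_state \<Psi> n) x)) \<partial>period)"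
proof -
  define S where "S X = char2.psum \<Psi> X" for X
  \<comment> \<open>\<open>Y X n\<close> is the slice of \<open>X\<close> on the diagonal
    \<open>n\<close>, and \<open>S1 X n\<close> is the circle sum it carries.\<close>
  define Y where "Y X n = {m. (m, n + m) \<in> X}" for X :: "(int \<times> int) set" and n
  define S1 where "S1 X n = char1.psum (diag_state \<Psi> n) (Y X n)" for X n
  have Yfin: "finite (Y X n)" if "finite X" for X n
    unfolding Y_def by (rule finite_vimageI[of X "\<lambda>m. (m, n + m)", OF that, unfolded vimage_def]) (simp add: inj_on_def)
  have F: "is_fourier2 \<Psi> (fourier2 \<Psi>)" by (rule is_fourier2_fourier2[OF \<Psi>])
  then have [measurable]: "fourier2 \<Psi> \<in> borel_measurable borel" by (simp add: is_fourier2_def)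
  have F1: "is_fourier1 (diag_state \<Psi> n) (fourier1 (diag_state \<Psi> n))" for n
    by (rule is_fourier1_fourier1[OF diag_state_summable[OF \<Psi>]])
  then have [measurable]: "fourier1 (diag_state \<Psi> n) \<in> borel_measurable borel" for n by (simp add: is_fourier1_def)
  have [measurable]: "S X \<in> borel_measurable borel" for X unfolding S_def char2.psum_def[abs_def] by measurable
  have [measurable]: "S1 X n \<in> borel_measurable borel" for X n unfolding S1_def char1.psum_def[abs_def] by measurable
  have lim: "((\<lambda>X. sq_norm period2 (\<lambda>k. fourier2 \<Psi> k - S X k)) \<longlongrightarrow> 0) (finite_subsets_at_top UNIV)"
    using F unfolding is_fourier2_iff char2.transform_def S_def by blast
  have bk: "ennreal ((cmod (indicator B x *\<^sub>R braket (e x) u))\<^sup>2) \<le> ennreal ((norm u)\<^sup>2)" for x u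
  proof -
    have "cmod (indicator B x *\<^sub>R braket (e x) u) \<le> norm u"
      using norm_braket_le[of "e x" u] ne[of x] by (auto split: split_indicator)
    then show ?thesis by (intro ennreal_leI power_mono) auto
  qed
  have bd: "indicator B x *\<^sub>R braket (e x) u - indicator B x *\<^sub>R braket (e x) w = indicator B x *\<^sub>R braket (e x) (u - w)" for x u w
    by (simp add: braket_diff scaleR_diff_right)
  have char2_per: "char2 x (k1 + 2 * pi, k2) = char2 x (k1, k2)" "char2 x (k1, k2 + 2 * pi) = char2 x (k1, k2)" for x k1 k2
    by (simp_all add: char2_eq char1_plus_2pi)
  have \<Phi>_per: "fourier2 \<Psi> (k1 + 2 * pi, k2) = fourier2 \<Psi> (k1, k2)" "fourier2 \<Psi> (k1, k2 + 2 * pi) = fourier2 \<Psi> (k1, k2)" for k1 k2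
    using F by (simp_all add: is_fourier2_def)
  have S_per: "S X (k1 + 2 * pi, k2) = S X (k1, k2)" "S X (k1, k2 + 2 * pi) = S X (k1, k2)" for X k1 k2
    by (simp_all add: S_def char2.psum_def char2_per)
  let ?f = "\<lambda>z. indicator B (fst z) *\<^sub>R braket (e (fst z)) (fourier2 \<Psi> (shear z))"
  let ?fX = "\<lambda>X z. indicator B (fst z) *\<^sub>R braket (e (fst z)) (S X (shear z))"
  have A: "((\<lambda>X. sq_norm period2 (?fX X)) \<longlongrightarrow> sq_norm period2 ?f) (finite_subsets_at_top UNIV)"
  proof (rule nn_integral_norm_squared_tendsto)
    show "((\<lambda>X. sq_norm period2 (\<lambda>z. ?f z - ?fX X z)) \<longlongrightarrow> 0) (finite_subsets_at_top UNIV)"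
    proof (rule tendsto_sandwich[OF always_eventually always_eventually tendsto_const lim]; intro allI)
      fix X
      show "0 \<le> sq_norm period2 (\<lambda>z. ?f z - ?fX X z)" by simp
      have "sq_norm period2 (\<lambda>z. ?f z - ?fX X z) \<le> sq_norm period2 (\<lambda>z. fourier2 \<Psi> (shear z) - S X (shear z))"
        unfolding bd by (intro nn_integral_mono bk)
      also have "\<dots> = sq_norm period2 (\<lambda>k. fourier2 \<Psi> k - S X k)"
        by (rule nn_integral_shear[of "\<lambda>k. ennreal ((norm (fourier2 \<Psi> k - S X k))\<^sup>2)"]) (simp_all add: \<Phi>_per S_per)
      finally show "sq_norm period2 (\<lambda>z. ?f z - ?fX X z) \<le> sq_norm period2 (\<lambda>k. fourier2 \<Psi> k - S X k)" .
    qed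
    have "sq_norm period2 ?f \<le> sq_norm period2 (\<lambda>z. fourier2 \<Psi> (shear z))"
      by (intro nn_integral_mono bk)
    also have "\<dots> = sq_norm period2 (fourier2 \<Psi>)"
      by (rule nn_integral_shear[of "\<lambda>k. ennreal ((norm (fourier2 \<Psi> k))\<^sup>2)"]) (simp_all add: \<Phi>_per)
    also have "\<dots> < \<infinity>" unfolding sq_norm_fourier2[OF \<Psi>] by simp
    finally show "sq_norm period2 ?f < \<infinity>" .
  qed measurable
  let ?M = "count_space (UNIV :: int set) \<Otimes>\<^sub>M period"
  let ?h = "\<lambda>y. indicator B (snd y) *\<^sub>R braket (e (snd y)) (fourier1 (diag_state \<Psi> (fst y)) (snd y))"
  let ?hX = "\<lambda>X y. indicator B (snd y) *\<^sub>R braket (e (snd y)) (S1 X (fst y) (snd y))"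
  have Mnn: "(\<integral>\<^sup>+ y. H y \<partial>?M) = (\<integral>\<^sup>+ n. \<integral>\<^sup>+ x. H (n, x) \<partial>period \<partial>count_space UNIV)"
    if "\<And>n. (\<lambda>x. H (n, x)) \<in> borel_measurable borel" for H :: "int \<times> real \<Rightarrow> ennreal"
    by (rule period.nn_integral_fst[symmetric], rule measurable_pair_measure_countable1) (use that in auto)
  have hm: "?h \<in> borel_measurable ?M" "\<And>X. ?hX X \<in> borel_measurable ?M"
    by (rule measurable_pair_measure_countable1; simp)+
  \<comment> \<open>Each circle has its own exact tail. The diagonals partition the lattice, so the
    tails add up to the tail of the whole state outside \<open>X\<close>, whatever the shape of
    \<open>X\<close>.\<close>
  have tails: "sq_norm ?M (\<lambda>y. fourier1 (diag_state \<Psi> (fst y)) (snd y) - S1 X (fst y) (snd y)) \<le>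
    ennreal (2 * pi * (\<Sum>\<^sub>\<infinity>x\<in>- X. (norm (\<Psi> x))\<^sup>2))" if X: "finite X" for X
  proof -
    have sm: "(\<lambda>m. (norm (diag_state \<Psi> n m))\<^sup>2) summable_on - Y X n" for n
      using diag_state_summable[OF \<Psi>] by (rule summable_on_subset_banach) simp
    have "sq_norm ?M (\<lambda>y. fourier1 (diag_state \<Psi> (fst y)) (snd y) - S1 X (fst y) (snd y)) =
       (\<integral>\<^sup>+ n. sq_norm period (\<lambda>x. fourier1 (diag_state \<Psi> n) x - S1 X n x) \<partial>count_space UNIV)"
      by (subst Mnn) simp_all
    also have "\<dots> \<le> (\<integral>\<^sup>+ n. ennreal (2 * pi * (\<Sum>\<^sub>\<infinity>m\<in>- Y X n. (norm (diag_state \<Psi> n m))\<^sup>2)) \<partial>count_space UNIV)"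
      unfolding S1_def
      by (intro nn_integral_mono eq_refl char1.sq_norm_transform_tail diag_state_summable \<Psi> Yfin X F1[unfolded is_fourier1_iff, THEN conjunct2])
    also have "\<dots> = ennreal (2 * pi) * (\<integral>\<^sup>+ n. ennreal (\<Sum>\<^sub>\<infinity>m\<in>- Y X n. (norm (diag_state \<Psi> n m))\<^sup>2) \<partial>count_space UNIV)"
      by (subst nn_integral_cmult[symmetric]) (auto simp: ennreal_mult infsum_nonneg)
    also have "(\<integral>\<^sup>+ n. ennreal (\<Sum>\<^sub>\<infinity>m\<in>- Y X n. (norm (diag_state \<Psi> n m))\<^sup>2) \<partial>count_space UNIV) =
      (\<integral>\<^sup>+ n. \<integral>\<^sup>+ m. ennreal ((norm (\<Psi> (m, n + m)))\<^sup>2) * indicator (- X) (m, n + m) \<partial>count_space UNIV \<partial>count_space UNIV)"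
    proof (rule nn_integral_cong)
      fix n
      have "ennreal (\<Sum>\<^sub>\<infinity>m\<in>- Y X n. (norm (diag_state \<Psi> n m))\<^sup>2) = sq_norm (count_space (- Y X n)) (diag_state \<Psi> n)"
        by (rule nn_integral_count_space_infsum[symmetric, OF sm]) simp
      also have "\<dots> = (\<integral>\<^sup>+ m. ennreal ((norm (diag_state \<Psi> n m))\<^sup>2) * indicator (- Y X n) m \<partial>count_space UNIV)"
        by (rule nn_integral_count_space_indicator) simp
      also have "\<dots> = (\<integral>\<^sup>+ m. ennreal ((norm (\<Psi> (m, n + m)))\<^sup>2) * indicator (- X) (m, n + m) \<partial>count_space UNIV)"
        by (intro nn_integral_cong) (simp add: diag_state_def Y_def indicator_def)
      finally show "ennreal (\<Sum>\<^sub>\<infinity>m\<in>- Y X n. (norm (diag_state \<Psi> n m))\<^sup>2) =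
        (\<integral>\<^sup>+ m. ennreal ((norm (\<Psi> (m, n + m)))\<^sup>2) * indicator (- X) (m, n + m) \<partial>count_space UNIV)" .
    qed
    also have "\<dots> = (\<integral>\<^sup>+ y. (\<lambda>x. ennreal ((norm (\<Psi> x))\<^sup>2) * indicator (- X) x) ((\<lambda>(n, m). (m, n + m)) y) \<partial>count_space UNIV)"
      by (subst nn_integral_fst_count_space[symmetric]) simp
    also have "\<dots> = (\<integral>\<^sup>+ x. ennreal ((norm (\<Psi> x))\<^sup>2) * indicator (- X) x \<partial>count_space UNIV)"
      by (rule nn_integral_bij_count_space[OF bij_diag])
    also have "\<dots> = sq_norm (count_space (- X)) \<Psi>"
      by (rule nn_integral_count_space_indicator[symmetric]) simp
    also have "\<dots> = ennreal (\<Sum>\<^sub>\<infinity>x\<in>- X. (norm (\<Psi> x))\<^sup>2)"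
      by (rule nn_integral_count_space_infsum) (auto intro: summable_on_subset_banach[OF \<Psi>])
    finally show ?thesis by (simp add: ennreal_mult infsum_nonneg)
  qed
  have ev: "eventually (\<lambda>X. finite X) (finite_subsets_at_top (UNIV :: (int \<times> int) set))"
    by (auto simp: eventually_finite_subsets_at_top)
  have tail0: "((\<lambda>X. ennreal (2 * pi * (\<Sum>\<^sub>\<infinity>x\<in>- X. (norm (\<Psi> x))\<^sup>2))) \<longlongrightarrow> 0) (finite_subsets_at_top UNIV)"
  proof -
    have "((\<lambda>X. 2 * pi * (infsum (\<lambda>x. (norm (\<Psi> x))\<^sup>2) UNIV - (\<Sum>x\<in>X. (norm (\<Psi> x))\<^sup>2))) \<longlongrightarrow>
        2 * pi * (infsum (\<lambda>x. (norm (\<Psi> x))\<^sup>2) UNIV - infsum (\<lambda>x. (norm (\<Psi> x))\<^sup>2) UNIV)) (finite_subsets_at_top UNIV)"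
      using has_sum_infsum[OF \<Psi>] unfolding has_sum_def by (intro tendsto_intros)
    then have "((\<lambda>X. ennreal (2 * pi * (infsum (\<lambda>x. (norm (\<Psi> x))\<^sup>2) UNIV - (\<Sum>x\<in>X. (norm (\<Psi> x))\<^sup>2)))) \<longlongrightarrow> ennreal 0) (finite_subsets_at_top UNIV)"
      by (intro tendsto_ennrealI) simp
    moreover have "eventually (\<lambda>X. ennreal (2 * pi * (infsum (\<lambda>x. (norm (\<Psi> x))\<^sup>2) UNIV - (\<Sum>x\<in>X. (norm (\<Psi> x))\<^sup>2))) =
        ennreal (2 * pi * (\<Sum>\<^sub>\<infinity>x\<in>- X. (norm (\<Psi> x))\<^sup>2))) (finite_subsets_at_top UNIV)"
      using ev
    proof eventually_elim
      case (elim X)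
      have "infsum (\<lambda>x. (norm (\<Psi> x))\<^sup>2) (UNIV - X) = infsum (\<lambda>x. (norm (\<Psi> x))\<^sup>2) UNIV - infsum (\<lambda>x. (norm (\<Psi> x))\<^sup>2) X"
        using \<Psi> elim by (intro infsum_Diff) auto
      then show ?case using elim by (simp add: Compl_eq_Diff_UNIV)
    qed
    ultimately show ?thesis by (simp add: Lim_transform_eventually)
  qed
  have Bl: "((\<lambda>X. sq_norm ?M (?hX X)) \<longlongrightarrow> sq_norm ?M ?h) (finite_subsets_at_top UNIV)"
  proof (rule nn_integral_norm_squared_tendsto[OF hm])
    show "((\<lambda>X. sq_norm ?M (\<lambda>y. ?h y - ?hX X y)) \<longlongrightarrow> 0) (finite_subsets_at_top UNIV)"
    proof (rule tendsto_sandwich[OF always_eventually _ tendsto_const tail0]; (intro allI)?)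
      show "0 \<le> sq_norm ?M (\<lambda>y. ?h y - ?hX X y)" for X by simp
      show "eventually (\<lambda>X. sq_norm ?M (\<lambda>y. ?h y - ?hX X y) \<le> ennreal (2 * pi * (\<Sum>\<^sub>\<infinity>x\<in>- X. (norm (\<Psi> x))\<^sup>2))) (finite_subsets_at_top UNIV)"
        using ev
      proof eventually_elim
        case (elim X)
        show ?case unfolding bd by (rule order_trans[OF nn_integral_mono tails[OF elim]]) (rule bk)
      qed
    qed
    have "sq_norm ?M ?h \<le> sq_norm ?M (\<lambda>y. fourier1 (diag_state \<Psi> (fst y)) (snd y))"
      by (intro nn_integral_mono bk)
    also have "\<dots> \<le> ennreal (2 * pi * (\<Sum>\<^sub>\<infinity>x\<in>- {}. (norm (\<Psi> x))\<^sup>2))"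
      using tails[of "{}"] by (simp add: S1_def char1.psum_def Y_def)
    also have "\<dots> < \<infinity>" by simp
    finally show "sq_norm ?M ?h < \<infinity>" .
  qed
  \<comment> \<open>For a finite truncation the identity is a computation with finitely many Fourier
    modes in the second coordinate.\<close>
  have eqX: "sq_norm period2 (?fX X) = ennreal (2 * pi) * sq_norm ?M (?hX X)" if X: "finite X" for X
  proof -
    define N where "N = (\<lambda>x. snd x - fst x) ` X"
    have N: "finite N" using X by (simp add: N_def)
    \<comment> \<open>In sheared coordinates a character splits into
      \<open>char1 m x * char1 n l\<close> with \<open>n\<close> the index of the diagonal, so the
      diagonals are precisely the Fourier modes in \<open>l\<close>.\<close>
    have Sx: "S X (shear (x, l)) = (\<Sum>n\<in>N. char1 n l *s S1 X n x)" for x l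
    proof -
      have "S X (shear (x, l)) = (\<Sum>n\<in>N. \<Sum>y\<in>{y \<in> X. snd y - fst y = n}. char2 y (shear (x, l)) *s \<Psi> y)"
        unfolding S_def char2.psum_def N_def using X by (intro sum.group[symmetric]) auto
      also have "\<dots> = (\<Sum>n\<in>N. \<Sum>m\<in>Y X n. char1 n l *s (char1 m x *s diag_state \<Psi> n m))"
      proof (rule sum.cong[OF refl])
        fix n
        show "(\<Sum>y\<in>{y \<in> X. snd y - fst y = n}. char2 y (shear (x, l)) *s \<Psi> y) = (\<Sum>m\<in>Y X n. char1 n l *s (char1 m x *s diag_state \<Psi> n m))"
          by (rule sum.reindex_bij_witness[of _ "\<lambda>m. (m, n + m)" fst])
             (auto simp: Y_def char2_shear diag_state_def vector_smult_assoc mult.commute)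
      qed
      also have "\<dots> = (\<Sum>n\<in>N. char1 n l *s S1 X n x)"
        unfolding S1_def char1.psum_def by (intro sum.cong refl) (simp add: vec_eq_iff sum_distrib_left mult.assoc)
      finally show ?thesis .
    qed
    have out: "S1 X n x = 0" if "n \<notin> N" for n x
    proof -
      have "Y X n = {}" using that by (force simp: Y_def N_def)
      then show ?thesis by (simp add: S1_def char1.psum_def)
    qed
    have inner: "sq_norm period (\<lambda>l. ?fX X (x, l)) = ennreal (2 * pi) * (\<Sum>n\<in>N. ennreal ((cmod (?hX X (n, x)))\<^sup>2))" for x
    proof -
      define c where "c n = axis (1 :: 2) (indicator B x *\<^sub>R braket (e x) (S1 X n x))" for n
      have nc: "norm (c n) = cmod (?hX X (n, x))" for n unfolding c_def by (simp only: norm_axis_1_cmod fst_conv snd_conv)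
      have "(\<Sum>n\<in>N. char1 n l *s c n) = axis 1 (?fX X (x, l))" for l
        by (auto simp: Sx braket_sum braket_scale c_def vec_eq_iff axis_def scaleR_sum_right intro!: sum.cong)
      then have "cmod (?fX X (x, l)) = norm (\<Sum>n\<in>N. char1 n l *s c n)" for l by (simp only: norm_axis_1_cmod)
      then have "sq_norm period (\<lambda>l. ?fX X (x, l)) = ennreal (2 * pi * (\<Sum>n\<in>N. (norm (c n))\<^sup>2))"
        using char1.sq_norm_psum[OF N, of c] by (simp add: char1.psum_def[abs_def])
      also have "\<dots> = ennreal (2 * pi) * (\<Sum>n\<in>N. ennreal ((cmod (?hX X (n, x)))\<^sup>2))"
        unfolding nc by (subst ennreal_mult; simp add: sum_nonneg)
      finally show ?thesis .
    qed
    have "sq_norm period2 (?fX X) = (\<integral>\<^sup>+ x. sq_norm period (\<lambda>l. ?fX X (x, l)) \<partial>period)"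
      by (rule nn_integral_period2(1)) measurable
    also have "\<dots> = (\<integral>\<^sup>+ x. ennreal (2 * pi) * (\<Sum>n\<in>N. ennreal ((cmod (?hX X (n, x)))\<^sup>2)) \<partial>period)"
      unfolding inner ..
    also have "\<dots> = ennreal (2 * pi) * (\<Sum>n\<in>N. sq_norm period (\<lambda>x. ?hX X (n, x)))"
    proof -
      have m: "(\<lambda>x. ennreal ((cmod (?hX X (n, x)))\<^sup>2)) \<in> borel_measurable period" for n
        unfolding fst_conv snd_conv by measurable
      show ?thesis by (simp only: nn_integral_cmult[OF borel_measurable_sum[OF m]] nn_integral_sum[OF m])
    qed
    also have "(\<Sum>n\<in>N. sq_norm period (\<lambda>x. ?hX X (n, x))) = (\<integral>\<^sup>+ n. sq_norm period (\<lambda>x. ?hX X (n, x)) \<partial>count_space UNIV)"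
      by (rule nn_integral_count_space'[symmetric]) (auto simp: N out braket_def)
    also have "\<dots> = sq_norm ?M (?hX X)"
      by (rule Mnn[symmetric]) simp
    finally show ?thesis .
  qed
  have "((\<lambda>X. ennreal (2 * pi) * sq_norm ?M (?hX X)) \<longlongrightarrow> ennreal (2 * pi) * sq_norm ?M ?h) (finite_subsets_at_top UNIV)"
    by (rule ennreal_tendsto_cmult[OF _ Bl]) simp
  moreover have "eventually (\<lambda>X. ennreal (2 * pi) * sq_norm ?M (?hX X) = sq_norm period2 (?fX X)) (finite_subsets_at_top UNIV)"
    using ev by eventually_elim (simp only: eqX)
  ultimately have "((\<lambda>X. sq_norm period2 (?fX X)) \<longlongrightarrow> ennreal (2 * pi) * sq_norm ?M ?h) (finite_subsets_at_top UNIV)"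
    by (rule Lim_transform_eventually)
  from tendsto_unique[OF finite_subsets_at_top_neq_bot A this]
  have "sq_norm period2 ?f = ennreal (2 * pi) * sq_norm ?M ?h" .
  also have "sq_norm ?M ?h = (\<integral>\<^sup>+ x. sq_norm (count_space UNIV) (\<lambda>n. ?h (n, x)) \<partial>period)"
  proof -
    interpret P: pair_sigma_finite "count_space (UNIV :: int set)" period
      by (intro pair_sigma_finite.intro sigma_finite_measure_count_space period.sigma_finite_measure_axioms)
    show ?thesis by (rule P.nn_integral_snd[symmetric]) (use hm(1) in measurable)
  qed
  finally show ?thesis by simp
qed

section \<open>One-dimensional velocities and eigenvectors\<close>

lemma one_minus_cos_pos:
  assumes "0 < a1" "a1 < (1::real)"
  shows "0 < 1 - (a1 * cos k)\<^sup>2"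
proof -
  have "\<bar>a1 * cos k\<bar> \<le> a1" using assms by (simp add: abs_mult mult_left_le)
  then have "\<bar>a1 * cos k\<bar> < 1" using assms by simp
  then show ?thesis by (simp add: abs_square_less_1)
qed

lemma continuous_on_velK:
  assumes "0 < a1" "a1 < 1"
  shows "continuous_on UNIV (velK a1)"
  unfolding velK_def
  by (intro continuous_intros) (use one_minus_cos_pos[OF assms] in \<open>auto simp: less_le\<close>)

lemma velK_periodic: "velK a1 (k + 2 * pi) = velK a1 k"
  by (simp add: velK_def)

lemma eigvecK_periodic: "eigvecK a1 s (k + 2 * pi) = eigvecK a1 s k"
proof -
  have "cis (k + 2 * pi) = cis k" by (simp add: complex_eq_iff)
  then show ?thesis by (simp add: eigvecK_def velK_periodic)
qed

lemma eigvecK_measurable: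
  assumes a: "0 < a1" "a1 < 1"
  shows "eigvecK a1 s \<in> borel_measurable borel"
proof (rule borel_measurable_continuous_onI)
  have v: "continuous_on UNIV (velK a1)" by (rule continuous_on_velK[OF a])
  have eq: "eigvecK a1 s = (\<lambda>k. \<chi> i. of_real (1 / sqrt 2) * (if i = 1 then cis k * of_real (sqrt (1 - s * velK a1 k))
      else of_real s * \<i> * of_real (sqrt (1 + s * velK a1 k))))"
    by (simp add: fun_eq_iff vec_eq_iff forall_2 eigvecK_def)
  show "continuous_on UNIV (eigvecK a1 s)"
    unfolding eq
  proof (rule continuous_on_vec_lambda)
    fix i :: 2
    show "continuous_on UNIV (\<lambda>k. complex_of_real (1 / sqrt 2) * (if i = 1 then cis k * of_real (sqrt (1 - s * velK a1 k))
      else of_real s * \<i> * of_real (sqrt (1 + s * velK a1 k))))"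
      by (cases "i = 1") (auto intro!: continuous_intros v)
  qed
qed

lemma norm_eigvecK:
  assumes a: "0 < a1" "a1 < 1" and s: "s \<in> {1, - 1}"
  shows "norm (eigvecK a1 s k) = 1"
proof -
  have "(velK a1 k)\<^sup>2 \<le> 1"
  proof -
    have "(a1 * sin k)\<^sup>2 \<le> 1 - (a1 * cos k)\<^sup>2"
      using a by (simp add: power_mult_distrib sin_squared_eq algebra_simps power_le_one)
    then show ?thesis using one_minus_cos_pos[OF a, of k] by (simp add: velK_def power_divide)
  qed
  then have v: "\<bar>velK a1 k\<bar> \<le> 1" by (simp add: abs_square_le_1)
  have "(norm (eigvecK a1 s k))\<^sup>2 = (1 - s * velK a1 k) / 2 + (1 + s * velK a1 k) / 2"
    unfolding norm_vec2_squared eigvecK_def using v s by (auto simp: norm_mult norm_divide power_mult_distrib power_divide)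
  also have "\<dots> = 1" by (simp add: add_divide_distrib[symmetric])
  finally show ?thesis using norm_ge_zero by (simp add: power2_eq_1_iff) (smt (verit) norm_ge_zero)
qed

text \<open>The limiting weight with \<open>l1\<close> fixed at \<open>x\<close>, integrated over
  the second momentum component. It is kept in \<open>ennreal\<close>, since it may be infinite for
  exceptional \<open>x\<close>.\<close>

definition fibre_weight :: "real \<Rightarrow> (int \<times> int \<Rightarrow> complex ^ 2) \<Rightarrow> real \<Rightarrow> real \<Rightarrow> ennreal" where
  "fibre_weight a1 \<Psi> \<tau> x =
     sq_norm period (\<lambda>l. braket (eigvecK a1 \<tau> x) (fourier2 \<Psi> (shear (x, l))))"

text \<open>The mean of the limiting weight over a fibre. An infinite fibre weight, possible only on
  a null set of the period, is sent to 0 by \<open>enn2real\<close>.\<close>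

definition qK :: "real \<Rightarrow> (int \<times> int \<Rightarrow> complex ^ 2) \<Rightarrow> real \<Rightarrow> real \<Rightarrow> real" where
  "qK a1 \<Psi> \<tau> x = enn2real (fibre_weight a1 \<Psi> \<tau> x) / (2 * pi)"

section \<open>Fibre weights of a square-summable state\<close>

locale walk_limit =
  fixes a1 :: real and \<Psi> :: "int \<times> int \<Rightarrow> complex ^ 2"
  assumes a1: "0 < a1" "a1 < 1" and summable: "(\<lambda>x. (norm (\<Psi> x))\<^sup>2) summable_on UNIV"
begin

lemma fourier2_measurable [measurable]: "fourier2 \<Psi> \<in> borel_measurable borel"
  using is_fourier2_fourier2[OF summable] by (simp add: is_fourier2_def)

lemma fourier2_periodic:
  "fourier2 \<Psi> (k1 + 2 * pi, k2) = fourier2 \<Psi> (k1, k2)" "fourier2 \<Psi> (k1, k2 + 2 * pi) = fourier2 \<Psi> (k1, k2)"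
  using is_fourier2_fourier2[OF summable] by (simp_all add: is_fourier2_def)

lemma fourier1_measurable [measurable]: "fourier1 (diag_state \<Psi> n) \<in> borel_measurable borel"
  using is_fourier1_fourier1[OF diag_state_summable[OF summable]] by (simp add: is_fourier1_def)

lemma fourier1_periodic: "fourier1 (diag_state \<Psi> n) (k + 2 * pi) = fourier1 (diag_state \<Psi> n) k"
  using is_fourier1_fourier1[OF diag_state_summable[OF summable]] by (simp add: is_fourier1_def)

lemma eigvecK_measurable' [measurable]: "eigvecK a1 s \<in> borel_measurable borel"
  by (rule eigvecK_measurable[OF a1])

lemma wtK_periodic: "wtK a1 \<Psi> n s (k + 2 * pi) = wtK a1 \<Psi> n s k"
  by (simp add: wtK_def eigvecK_periodic fourier1_periodic)

lemma fibre_weight_measurable [measurable]: "fibre_weight a1 \<Psi> \<tau> \<in> borel_measurable borel"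
proof -
  have "(\<lambda>(x, l). ennreal ((cmod (braket (eigvecK a1 \<tau> x) (fourier2 \<Psi> (shear (x, l)))))\<^sup>2)) \<in> borel_measurable (borel \<Otimes>\<^sub>M period)"
    unfolding split_def by measurable
  then show ?thesis unfolding fibre_weight_def by (rule period.borel_measurable_nn_integral)
qed

lemma qK_measurable [measurable]: "qK a1 \<Psi> \<tau> \<in> borel_measurable borel"
  unfolding qK_def by measurable

lemma qK_nonneg: "0 \<le> qK a1 \<Psi> \<tau> x"
  by (simp add: qK_def)

lemma qK_periodic: "qK a1 \<Psi> \<tau> (x + 2 * pi) = qK a1 \<Psi> \<tau> x"
proof -
  have "fourier2 \<Psi> (shear (x + 2 * pi, l)) = fourier2 \<Psi> (shear (x, l))" for l
    using fourier2_periodic(1)[of "x - l" l] by (simp add: shear_def algebra_simps)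
  then show ?thesis by (simp add: qK_def fibre_weight_def eigvecK_periodic)
qed

lemma integrable_norm_fourier2_shear: "integrable period2 (\<lambda>z. (norm (fourier2 \<Psi> (shear z)))\<^sup>2)"
  and nn_integral_norm_fourier2_shear: "sq_norm period2 (\<lambda>z. fourier2 \<Psi> (shear z)) = ennreal ((2 * pi)\<^sup>2 * (\<Sum>\<^sub>\<infinity>x. (norm (\<Psi> x))\<^sup>2))"
proof -
  have "sq_norm period2 (\<lambda>z. fourier2 \<Psi> (shear z)) = sq_norm period2 (fourier2 \<Psi>)"
    by (rule nn_integral_shear[of "\<lambda>k. ennreal ((norm (fourier2 \<Psi> k))\<^sup>2)"]) (simp_all add: fourier2_periodic)
  then show *: "sq_norm period2 (\<lambda>z. fourier2 \<Psi> (shear z)) = ennreal ((2 * pi)\<^sup>2 * (\<Sum>\<^sub>\<infinity>x. (norm (\<Psi> x))\<^sup>2))"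
    using sq_norm_fourier2[OF summable] by simp
  show "integrable period2 (\<lambda>z. (norm (fourier2 \<Psi> (shear z)))\<^sup>2)"
    by (rule integrableI_bounded) (use * in \<open>simp_all\<close>)
qed

lemma braket_eigvecK_le: "\<tau> \<in> {1, - 1} \<Longrightarrow> (cmod (braket (eigvecK a1 \<tau> x) w))\<^sup>2 \<le> (norm w)\<^sup>2"
  using norm_braket_le[of "eigvecK a1 \<tau> x" w] norm_eigvecK[OF a1, of \<tau> x] by (intro power_mono) auto

lemma nn_integral_fibre_weight:
  assumes [measurable]: "h \<in> borel_measurable borel"
  shows "(\<integral>\<^sup>+ z. h (fst z) * ennreal ((cmod (braket (eigvecK a1 \<tau> (fst z)) (fourier2 \<Psi> (shear z))))\<^sup>2) \<partial>period2) =
    (\<integral>\<^sup>+ x. h x * fibre_weight a1 \<Psi> \<tau> x \<partial>period)"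
proof -
  let ?w = "\<lambda>z. ennreal ((cmod (braket (eigvecK a1 \<tau> (fst z)) (fourier2 \<Psi> (shear z))))\<^sup>2)"
  have m [measurable]: "?w \<in> borel_measurable borel" by measurable
  have "(\<integral>\<^sup>+ z. h (fst z) * ?w z \<partial>period2) = (\<integral>\<^sup>+ x. \<integral>\<^sup>+ l. h (fst (x, l)) * ?w (x, l) \<partial>period \<partial>period)"
    by (rule nn_integral_period2(1)) measurable
  also have "\<dots> = (\<integral>\<^sup>+ x. h x * (\<integral>\<^sup>+ l. ?w (x, l) \<partial>period) \<partial>period)"
    unfolding fst_conv by (intro nn_integral_cong nn_integral_cmult) measurable
  finally show ?thesis unfolding fibre_weight_def by simp
qed

lemma fibre_weight_finite:
  assumes \<tau>: "\<tau> \<in> {1, - 1}"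
  shows "(\<integral>\<^sup>+ x. fibre_weight a1 \<Psi> \<tau> x \<partial>period) < \<infinity>"
    and "AE x in period. fibre_weight a1 \<Psi> \<tau> x < \<infinity>"
proof -
  have "(\<integral>\<^sup>+ x. fibre_weight a1 \<Psi> \<tau> x \<partial>period) = sq_norm period2 (\<lambda>z. braket (eigvecK a1 \<tau> (fst z)) (fourier2 \<Psi> (shear z)))"
    using nn_integral_fibre_weight[of "\<lambda>_. 1" \<tau>] by simp
  also have "\<dots> \<le> sq_norm period2 (\<lambda>z. fourier2 \<Psi> (shear z))"
    by (intro nn_integral_mono ennreal_leI braket_eigvecK_le \<tau>)
  also have "\<dots> < \<infinity>" unfolding nn_integral_norm_fourier2_shear by simp
  finally show *: "(\<integral>\<^sup>+ x. fibre_weight a1 \<Psi> \<tau> x \<partial>period) < \<infinity>" .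
  have "AE x in period. fibre_weight a1 \<Psi> \<tau> x \<noteq> \<infinity>"
    by (rule nn_integral_PInf_AE) (use * in auto)
  then show "AE x in period. fibre_weight a1 \<Psi> \<tau> x < \<infinity>" by eventually_elim (simp add: less_top)
qed

text \<open>Both transforms are fixed only up to null sets, so Parseval's identity is available
  after integration over \<open>x\<close>. Having it for every Borel set \<open>B\<close> makes both
  sides densities of the same finite measure, and densities are unique almost everywhere; finiteness
  of \<open>fibre_weight\<close> then turns the equality in \<open>ennreal\<close> into convergence
  of the sum.\<close>

lemma AE_wtK_has_sum:
  assumes \<tau>: "\<tau> \<in> {1, - 1}"
  shows "AE x in period. ((\<lambda>n. wtK a1 \<Psi> n \<tau> x) has_sum qK a1 \<Psi> \<tau> x) UNIV"
proof -
  define H where "H x = (\<integral>\<^sup>+ n. ennreal (wtK a1 \<Psi> n \<tau> x) \<partial>count_space UNIV)" for x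
  have Hm [measurable]: "H \<in> borel_measurable borel"
  proof -
    interpret C: sigma_finite_measure "count_space (UNIV :: int set)" by (rule sigma_finite_measure_count_space)
    have "(\<lambda>(n, x). ennreal (wtK a1 \<Psi> n \<tau> x)) \<in> borel_measurable (count_space UNIV \<Otimes>\<^sub>M borel)"
      by (rule measurable_pair_measure_countable1) (simp_all add: wtK_def)
    then have "(\<lambda>(x, n). ennreal (wtK a1 \<Psi> n \<tau> x)) \<in> borel_measurable (borel \<Otimes>\<^sub>M count_space UNIV)"
      by (subst measurable_pair_swap_iff) (simp add: split_def)
    then show ?thesis unfolding H_def by (rule C.borel_measurable_nn_integral)
  qed
  have "AE x in period. fibre_weight a1 \<Psi> \<tau> x = ennreal (2 * pi) * H x"
  proof (rule period.density_unique_finite_measure)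
    fix B assume "B \<in> sets period"
    then have B [measurable]: "B \<in> sets borel" by simp
    have i: "ennreal ((cmod (indicator B x *\<^sub>R c))\<^sup>2) = indicator B x * ennreal ((cmod c)\<^sup>2)" for x c
      by (simp split: split_indicator)
    have "(\<integral>\<^sup>+ x. fibre_weight a1 \<Psi> \<tau> x * indicator B x \<partial>period) =
      (\<integral>\<^sup>+ z. indicator B (fst z) * ennreal ((cmod (braket (eigvecK a1 \<tau> (fst z)) (fourier2 \<Psi> (shear z))))\<^sup>2) \<partial>period2)"
      by (subst nn_integral_fibre_weight) (simp_all add: mult.commute)
    also have "\<dots> = ennreal (2 * pi) * (\<integral>\<^sup>+ x. (\<integral>\<^sup>+ n. indicator B x * ennreal (wtK a1 \<Psi> n \<tau> x) \<partial>count_space UNIV) \<partial>period)"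
      using parseval_diagonal_integrated[OF summable eigvecK_measurable' norm_eigvecK[OF a1 \<tau>] B] unfolding i wtK_def .
    also have "\<dots> = ennreal (2 * pi) * (\<integral>\<^sup>+ x. indicator B x * H x \<partial>period)"
      unfolding H_def by (simp add: nn_integral_cmult)
    also have "\<dots> = (\<integral>\<^sup>+ x. ennreal (2 * pi) * (indicator B x * H x) \<partial>period)"
      by (rule nn_integral_cmult[symmetric]) measurable
    finally show "(\<integral>\<^sup>+ x. fibre_weight a1 \<Psi> \<tau> x * indicator B x \<partial>period) = (\<integral>\<^sup>+ x. ennreal (2 * pi) * H x * indicator B x \<partial>period)"
      by (simp add: ac_simps)
  qed simp_all
  with fibre_weight_finite(2)[OF \<tau>] show ?thesis
  proof eventually_elim
    case (elim x)
    then obtain r where r: "fibre_weight a1 \<Psi> \<tau> x = ennreal r" "0 \<le> r" by (metis infinity_ennreal_def less_top_ennreal)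
    have q: "qK a1 \<Psi> \<tau> x = r / (2 * pi)" using r by (simp add: qK_def)
    have "ennreal (1 / (2 * pi)) * (ennreal (2 * pi) * H x) = H x"
      by (simp add: mult.assoc[symmetric] ennreal_mult[symmetric])
    moreover have "ennreal (1 / (2 * pi)) * (ennreal (2 * pi) * H x) = ennreal (r / (2 * pi))"
      unfolding elim(2)[symmetric] r(1) by (simp add: ennreal_mult[symmetric] r(2))
    ultimately have "H x = ennreal (qK a1 \<Psi> \<tau> x)" unfolding q by simp
    then show ?case unfolding H_def
      by (rule has_sum_nn_integral_count_space) (simp_all add: wtK_def qK_nonneg)
  qed
qed

lemma integral_braket_eigvecK:
  fixes h :: "real \<Rightarrow> real"
  assumes h [measurable]: "h \<in> borel_measurable borel" and bd: "\<And>x. \<bar>h x\<bar> \<le> C" and \<tau>: "\<tau> \<in> {1, - 1}"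
  shows "integrable period (\<lambda>x. h x * qK a1 \<Psi> \<tau> x)"
    and "(LINT z|period2. h (fst z) * (cmod (braket (eigvecK a1 \<tau> (fst z)) (fourier2 \<Psi> (shear z))))\<^sup>2) =
      2 * pi * (LINT x|period. h x * qK a1 \<Psi> \<tau> x)"
proof -
  let ?G = "\<lambda>z. h (fst z) * (cmod (braket (eigvecK a1 \<tau> (fst z)) (fourier2 \<Psi> (shear z))))\<^sup>2"
  have C: "C \<ge> 0" using bd[of 0] by linarith
  have int: "integrable period2 ?G"
  proof (rule Bochner_Integration.integrable_bound)
    show "integrable period2 (\<lambda>z. C * (norm (fourier2 \<Psi> (shear z)))\<^sup>2)"
      using integrable_norm_fourier2_shear by (rule integrable_mult_right)
    show "AE z in period2. norm (?G z) \<le> norm (C * (norm (fourier2 \<Psi> (shear z)))\<^sup>2)"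
      using bd C braket_eigvecK_le[OF \<tau>] by (auto simp: abs_mult intro!: mult_mono)
  qed measurable
  then have int': "integrable (period \<Otimes>\<^sub>M period) ?G" unfolding period2_eq .
  have inner: "(LINT l|period. ?G (x, l)) = 2 * pi * (h x * qK a1 \<Psi> \<tau> x)" for x
  proof -
    have "(LINT l|period. ?G (x, l)) = h x * (LINT l|period. (cmod (braket (eigvecK a1 \<tau> x) (fourier2 \<Psi> (shear (x, l)))))\<^sup>2)"
      by simp
    also have "(LINT l|period. (cmod (braket (eigvecK a1 \<tau> x) (fourier2 \<Psi> (shear (x, l)))))\<^sup>2) = enn2real (fibre_weight a1 \<Psi> \<tau> x)"
      unfolding fibre_weight_def 
    proof (rule integral_eq_nn_integral)
      show "(\<lambda>l. (cmod (braket (eigvecK a1 \<tau> x) (fourier2 \<Psi> (shear (x, l)))))\<^sup>2) \<in> borel_measurable period"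
        by measurable
    qed simp
    finally show ?thesis by (simp add: qK_def)
  qed
  have "integrable period (\<lambda>x. LINT l|period. ?G (x, l))" by (rule period_pair.integrable_fst'[OF int'])
  then have "integrable period (\<lambda>x. 2 * pi * (h x * qK a1 \<Psi> \<tau> x))" unfolding inner .
  then show "integrable period (\<lambda>x. h x * qK a1 \<Psi> \<tau> x)" by simp
  have "(LINT z|period2. ?G z) = (LINT x|period. LINT l|period. ?G (x, l))"
    unfolding period2_eq by (rule period_pair.integral_fst'[OF int', symmetric])
  then show "(LINT z|period2. ?G z) = 2 * pi * (LINT x|period. h x * qK a1 \<Psi> \<tau> x)" unfolding inner by simp
qed

end

subsection \<open>The one-dimensional velocity map\<close>

text \<open>The open arcs on which the cosine keeps its sign \<open>(- 1) ^ m\<close>. On each of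
  them \<open>velK\<close> is injective, and at the ends its modulus reaches
  \<open>a1\<close>.\<close>

definition half_circle :: "nat \<Rightarrow> real set" where
  "half_circle m = {real m * pi - pi / 2<..<real m * pi + pi / 2}"

lemma integral_period_halves:
  fixes h :: "real \<Rightarrow> real"
  assumes h [measurable]: "h \<in> borel_measurable borel" and per: "\<And>x. h (x + 2 * pi) = h x" and int: "integrable period h"
  shows "m \<in> {0, 1} \<Longrightarrow> set_integrable lebesgue (half_circle m) h"
    and "(LINT x|period. h x) = (\<Sum>m\<in>{0, 1}. LINT x:half_circle m|lebesgue. h x)"
proof -
  \<comment> \<open>The period is shifted so that, up to end points, it is the union of the two
    arcs.\<close>
  let ?I = "{pi / 2 - pi..pi / 2 + pi}"
  have sh: "(\<integral>\<^sup>+ x \<in> ?I. u x \<partial>lborel) = (\<integral>\<^sup>+ x. u x \<partial>period)"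
    if "u \<in> borel_measurable borel" "\<And>x. u (x + 2 * pi) = u x" for u :: "real \<Rightarrow> ennreal"
    using that by (rule nn_integral_period_shift) (use pi_gt_zero in linarith)
  have fin: "(\<integral>\<^sup>+ x \<in> ?I. ennreal \<bar>h x\<bar> \<partial>lborel) < \<infinity>"
    using int by (subst sh) (auto simp: per integrable_iff_bounded)
  have I: "set_integrable lborel ?I h"
    and L: "(LINT x:?I|lborel. h x) = (LINT x|period. h x)"
    using set_integral_eq_nn_integral[of ?I lborel h] fin sh[of "\<lambda>x. ennreal (h x)"] sh[of "\<lambda>x. ennreal (- h x)"]
      real_lebesgue_integral_def[OF int] per by simp_all
  have hb [measurable]: "half_circle m \<in> sets borel" for m by (simp add: half_circle_def)
  have Ih: "set_integrable lborel (half_circle m) h" if "m \<in> {0, 1}" for m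
    by (rule set_integrable_subset[OF I]) (use that in \<open>auto simp: half_circle_def\<close>)
  then show "m \<in> {0, 1} \<Longrightarrow> set_integrable lebesgue (half_circle m) h"
    by (simp add: set_integral_lebesgue_lborel)
  have "(LINT x:?I|lborel. h x) = (LINT x|lborel. indicator (half_circle 0) x *\<^sub>R h x + indicator (half_circle 1) x *\<^sub>R h x)"
    unfolding set_lebesgue_integral_def
  proof (rule integral_cong_AE)
    have "AE x in lborel. x \<noteq> - pi / 2 \<and> x \<noteq> pi / 2 \<and> x \<noteq> 3 * pi / 2"
      using AE_lborel_singleton[of "- pi / 2"] AE_lborel_singleton[of "pi / 2"] AE_lborel_singleton[of "3 * pi / 2"]
      by eventually_elim simp
    then show "AE x in lborel. indicator ?I x *\<^sub>R h x = indicator (half_circle 0) x *\<^sub>R h x + indicator (half_circle 1) x *\<^sub>R h x"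
      by eventually_elim (auto simp: half_circle_def indicator_def)
  qed measurable
  also have "\<dots> = (\<Sum>m\<in>{0, 1}. LINT x:half_circle m|lborel. h x)"
    using Ih[of 0] Ih[of 1] unfolding set_integrable_def set_lebesgue_integral_def
    by (simp add: Bochner_Integration.integral_add)
  finally show "(LINT x|period. h x) = (\<Sum>m\<in>{0, 1}. LINT x:half_circle m|lebesgue. h x)"
    unfolding L by (simp add: set_integral_lebesgue_lborel)
qed

locale konno_param =
  fixes a1 \<tau> :: real and m :: nat
  assumes a1: "0 < a1" "a1 < 1" and \<tau>: "\<tau> \<in> {1, - 1}"
begin

text \<open>The sign of the derivative of \<open>kK\<close>, which is monotone on each
  branch.\<close>

definition "\<epsilon> = - \<tau> * (- 1) ^ m"

lemma \<epsilon>: "\<epsilon> * \<epsilon> = 1" "\<bar>\<epsilon>\<bar> = 1" "(- 1) ^ m * \<epsilon> = - \<tau>" "\<tau> * \<tau> = 1"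
  using \<tau> by (auto simp: \<epsilon>_def abs_mult power_mult_distrib[symmetric])

definition "arg v = \<epsilon> * sb a1 * v / (a1 * sqrt (1 - v\<^sup>2))"

lemma kK_eq: "kK a1 \<tau> m v = real m * pi + arcsin (arg v)"
  by (simp add: kK_def arg_def \<epsilon>_def)

lemma v_bounds:
  assumes "v \<in> {- a1<..<a1}"
  shows "0 < a1\<^sup>2 - v\<^sup>2" "0 < 1 - v\<^sup>2"
proof -
  have "\<bar>v\<bar> < \<bar>a1\<bar>" using assms a1 by auto
  then have "v\<^sup>2 < a1\<^sup>2" using power_strict_mono[of "\<bar>v\<bar>" a1 2] a1 by simp
  then show "0 < a1\<^sup>2 - v\<^sup>2" by simp
  moreover have "a1\<^sup>2 < 1" using a1 by (simp add: abs_square_less_1)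
  ultimately show "0 < 1 - v\<^sup>2" by linarith
qed

lemma one_minus_arg:
  assumes v: "v \<in> {- a1<..<a1}"
  shows "1 - (arg v)\<^sup>2 = (a1\<^sup>2 - v\<^sup>2) / (a1\<^sup>2 * (1 - v\<^sup>2))"
proof -
  have "(arg v)\<^sup>2 = (1 - a1\<^sup>2) * v\<^sup>2 / (a1\<^sup>2 * (1 - v\<^sup>2))"
    using v_bounds[OF v] \<epsilon>(1) sb_squared[OF a1] by (simp add: arg_def power_divide power_mult_distrib power2_eq_square[of \<epsilon>])
  then show ?thesis using v_bounds[OF v] a1 by (simp add: field_simps)
qed

lemma abs_arg:
  assumes v: "v \<in> {- a1<..<a1}"
  shows "\<bar>arg v\<bar> < 1"
proof -
  have "0 < 1 - (arg v)\<^sup>2" unfolding one_minus_arg[OF v] using v_bounds[OF v] a1 by simp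
  then show ?thesis by (simp add: abs_square_less_1)
qed

lemma kK_in_half:
  assumes v: "v \<in> {- a1<..<a1}"
  shows "kK a1 \<tau> m v \<in> half_circle m"
  using abs_arg[OF v] arcsin_lt_bounded[of "arg v"] by (auto simp: kK_eq half_circle_def abs_less_iff)

lemma sin_shift: "sin (real m * pi + x) = (- 1) ^ m * sin x"
  by (simp add: sin_add)

lemma velK_kK:
  assumes v: "v \<in> {- a1<..<a1}"
  shows "\<tau> * velK a1 (kK a1 \<tau> m v) = v"
proof -
  have b: "0 < sb a1" "(sb a1)\<^sup>2 = 1 - a1\<^sup>2" using sb_pos[OF a1] sb_squared[OF a1] by auto
  define k where "k = kK a1 \<tau> m v"
  have "sin k = ((- 1) ^ m * \<epsilon>) * (sb a1 * v / (a1 * sqrt (1 - v\<^sup>2)))"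
  proof -
    have "sin (arcsin (arg v)) = arg v" using abs_arg[OF v] by (intro sin_arcsin) auto
    then show ?thesis unfolding k_def kK_eq sin_shift by (simp add: arg_def)
  qed
  then have s: "sin k = - \<tau> * (sb a1 * v / (a1 * sqrt (1 - v\<^sup>2)))" unfolding \<epsilon> .
  have "(sin k)\<^sup>2 = (sb a1)\<^sup>2 * v\<^sup>2 / (a1\<^sup>2 * (1 - v\<^sup>2))"
    unfolding s using v_bounds[OF v] \<epsilon>(4) by (simp add: power_mult_distrib power_divide power2_eq_square[of \<tau>])
  then have "1 - (a1 * cos k)\<^sup>2 = (sb a1)\<^sup>2 / (1 - v\<^sup>2)"
    unfolding power_mult_distrib cos_squared_eq using v_bounds[OF v] a1 b(2) by (simp add: field_simps)
  then have "sqrt (1 - (a1 * cos k)\<^sup>2) = sb a1 / sqrt (1 - v\<^sup>2)" using b(1) by (simp add: real_sqrt_divide)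
  then have "velK a1 k = \<tau> * v" unfolding velK_def s using b(1) a1 v_bounds[OF v] by (simp add: field_simps)
  then show ?thesis unfolding k_def[symmetric] using \<epsilon>(4) by (simp add: mult.assoc[symmetric])
qed

lemma kK_velK:
  assumes x: "x \<in> half_circle m"
  shows "\<tau> * velK a1 x \<in> {- a1<..<a1}" "kK a1 \<tau> m (\<tau> * velK a1 x) = x"
proof -
  have b: "0 < sb a1" "(sb a1)\<^sup>2 = 1 - a1\<^sup>2" using sb_pos[OF a1] sb_squared[OF a1] by auto
  define D where "D = sqrt (1 - (a1 * cos x)\<^sup>2)"
  have D: "0 < D" "D\<^sup>2 = 1 - (a1 * cos x)\<^sup>2" using one_minus_cos_pos[OF a1, of x] by (simp_all add: D_def)
  define v where "v = \<tau> * velK a1 x"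
  have v: "v = - \<tau> * a1 * sin x / D" by (simp add: v_def velK_def D_def)
  have y: "- (pi / 2) < x - real m * pi" "x - real m * pi < pi / 2" using x by (auto simp: half_circle_def)
  have "cos x \<noteq> 0"
  proof -
    have "cos (x - real m * pi) > 0" using y by (intro cos_gt_zero_pi) auto
    moreover have "cos (x - real m * pi) = (- 1) ^ m * cos x" by (simp add: cos_diff)
    ultimately show ?thesis by auto
  qed
  \<comment> \<open>This quantity is \<open>D\<^sup>2 - (sin x)\<^sup>2\<close>; its positivity
    inside the arc is what makes the velocity strictly smaller than \<open>a1\<close> in
    modulus.\<close>
  then have "0 < (1 - a1\<^sup>2) * (cos x)\<^sup>2" using a1 by (simp add: abs_square_less_1)
  also have "\<dots> = D\<^sup>2 - (sin x)\<^sup>2" unfolding D by (simp add: sin_squared_eq power_mult_distrib algebra_simps)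
  finally have "(sin x)\<^sup>2 < D\<^sup>2" by simp
  then have "\<bar>sin x\<bar> < D" using D(1) by (metis abs_le_square_iff abs_of_pos not_le)
  then have "a1 * (\<bar>sin x\<bar> / D) < a1 * 1" using a1 D by (intro mult_strict_left_mono) auto
  then have "\<bar>v\<bar> < a1" unfolding v using \<tau> a1 D by (auto simp: abs_mult)
  then show vb: "\<tau> * velK a1 x \<in> {- a1<..<a1}" unfolding v_def[symmetric] by auto
  have v2: "v\<^sup>2 = a1\<^sup>2 * (sin x)\<^sup>2 / D\<^sup>2" unfolding v using \<epsilon>(4) by (simp add: power_mult_distrib power_divide power2_eq_square[of \<tau>])
  have "1 - v\<^sup>2 = (D\<^sup>2 - a1\<^sup>2 * (sin x)\<^sup>2) / D\<^sup>2" unfolding v2 using D(1) by (simp add: diff_divide_distrib)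
  also have "D\<^sup>2 - a1\<^sup>2 * (sin x)\<^sup>2 = (sb a1)\<^sup>2" unfolding D b by (simp add: sin_squared_eq power_mult_distrib algebra_simps)
  finally have "sqrt (1 - v\<^sup>2) = sb a1 / D" using b(1) D(1) by (simp add: real_sqrt_divide)
  then have "arg v = - (\<epsilon> * \<tau>) * sin x" unfolding arg_def v using a1 b(1) D(1) by (simp add: field_simps)
  also have "- (\<epsilon> * \<tau>) = (- 1) ^ m" using \<tau> by (auto simp: \<epsilon>_def)
  also have "(- 1) ^ m * sin x = sin (x - real m * pi)" by (simp add: sin_diff)
  finally have "arcsin (arg v) = x - real m * pi" using y by (simp add: arcsin_sin)
  then show "kK a1 \<tau> m (\<tau> * velK a1 x) = x" by (simp add: kK_eq v_def[symmetric])
qed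

lemma kK_image: "kK a1 \<tau> m ` {- a1<..<a1} = half_circle m"
  using kK_in_half kK_velK by force

lemma inj_on_kK: "inj_on (kK a1 \<tau> m) {- a1<..<a1}"
  by (rule inj_onI) (metis velK_kK)

lemma kK_derivative:
  assumes v: "v \<in> {- a1<..<a1}"
  shows "(kK a1 \<tau> m has_field_derivative \<epsilon> * sb a1 / ((1 - v\<^sup>2) * sqrt (a1\<^sup>2 - v\<^sup>2))) (at v within S)"
proof -
  define r where "r = sqrt (1 - v\<^sup>2)"
  have r: "0 < r" "r\<^sup>2 = 1 - v\<^sup>2" using v_bounds[OF v] by (simp_all add: r_def)
  define w where "w = sqrt (a1\<^sup>2 - v\<^sup>2)"
  have w: "0 < w" using v_bounds[OF v] by (simp add: w_def)
  have "((\<lambda>v. sqrt (1 - v\<^sup>2)) has_field_derivative (- (2 * v) * (inverse (sqrt (1 - v\<^sup>2)) / 2))) (at v within S)"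
    using v_bounds[OF v] by (auto intro!: derivative_eq_intros)
  then have dr: "((\<lambda>v. a1 * sqrt (1 - v\<^sup>2)) has_field_derivative (- a1 * v / r)) (at v within S)"
    unfolding r_def[symmetric] by (rule DERIV_cmult[THEN DERIV_cong]) (simp add: field_simps)
  have "(arg has_field_derivative (\<epsilon> * sb a1 * (a1 * r) - \<epsilon> * sb a1 * v * (- a1 * v / r)) / ((a1 * r) * (a1 * r))) (at v within S)"
    unfolding arg_def using r a1 dr
    by (intro DERIV_divide[where g = "\<lambda>v. a1 * sqrt (1 - v\<^sup>2)" and x = v, folded r_def] DERIV_cmult_Id) auto
  moreover have "(\<epsilon> * sb a1 * (a1 * r) - \<epsilon> * sb a1 * v * (- a1 * v / r)) / ((a1 * r) * (a1 * r)) = \<epsilon> * sb a1 / (a1 * r^3)"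
  proof -
    have "\<epsilon> * sb a1 * (a1 * r) - \<epsilon> * sb a1 * v * (- a1 * v / r) = \<epsilon> * sb a1 * a1 * (r\<^sup>2 + v\<^sup>2) / r"
      using r(1) by (simp add: field_simps power2_eq_square)
    also have "r\<^sup>2 + v\<^sup>2 = 1" using r(2) by simp
    finally show ?thesis using r(1) a1 by (simp add: power3_eq_cube)
  qed
  ultimately have da: "(arg has_field_derivative \<epsilon> * sb a1 / (a1 * r^3)) (at v within S)" by simp
  have "- 1 < arg v" "arg v < 1" using abs_arg[OF v] by (auto simp: abs_less_iff)
  then have "((\<lambda>v. arcsin (arg v)) has_field_derivative inverse (sqrt (1 - (arg v)\<^sup>2)) * (\<epsilon> * sb a1 / (a1 * r^3))) (at v within S)"
    by (intro DERIV_chain2[OF DERIV_arcsin da])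
  moreover have "sqrt (1 - (arg v)\<^sup>2) = w / (a1 * r)"
    unfolding one_minus_arg[OF v] using a1 by (simp add: real_sqrt_divide real_sqrt_mult w_def r_def)
  moreover have "inverse (w / (a1 * r)) * (\<epsilon> * sb a1 / (a1 * r^3)) = \<epsilon> * sb a1 / ((1 - v\<^sup>2) * w)"
    unfolding r(2)[symmetric] using a1 r(1) w by (simp add: field_simps power3_eq_cube power2_eq_square)
  ultimately have "((\<lambda>v. arcsin (arg v)) has_field_derivative \<epsilon> * sb a1 / ((1 - v\<^sup>2) * w)) (at v within S)"
    by simp
  from DERIV_add[OF DERIV_const[of "real m * pi"] this]
  have "((\<lambda>v. real m * pi + arcsin (arg v)) has_field_derivative \<epsilon> * sb a1 / ((1 - v\<^sup>2) * w)) (at v within S)"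
    by simp
  then show ?thesis unfolding w_def kK_eq[abs_def] .
qed

text \<open>The modulus of the derivative of \<open>kK\<close> is \<open>pi * konno a1\<close>. The
  Konno function is thus the density of the velocity when \<open>x\<close> is uniformly distributed
  on an arc of length \<open>pi\<close>.\<close>

lemma konno_substitution:
  fixes f :: "real \<Rightarrow> real"
  assumes int: "set_integrable lebesgue (half_circle m) f"
  shows "set_integrable lebesgue {- a1<..<a1} (\<lambda>v. pi * konno a1 v * f (kK a1 \<tau> m v))"
    and "(LINT v:{- a1<..<a1}|lebesgue. pi * konno a1 v * f (kK a1 \<tau> m v)) = (LINT x:half_circle m|lebesgue. f x)"
proof -
  have d: "\<bar>\<epsilon> * sb a1 / ((1 - v\<^sup>2) * sqrt (a1\<^sup>2 - v\<^sup>2))\<bar> = pi * konno a1 v" if v: "v \<in> {- a1<..<a1}" for v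
    using v_bounds[OF v] \<epsilon>(2) sb_pos[OF a1] v by (simp add: konno_def abs_mult sb_def)
  have cv: "(\<lambda>v. \<bar>\<epsilon> * sb a1 / ((1 - v\<^sup>2) * sqrt (a1\<^sup>2 - v\<^sup>2))\<bar> * f (kK a1 \<tau> m v)) absolutely_integrable_on {- a1<..<a1} \<and>
    integral {- a1<..<a1} (\<lambda>v. \<bar>\<epsilon> * sb a1 / ((1 - v\<^sup>2) * sqrt (a1\<^sup>2 - v\<^sup>2))\<bar> * f (kK a1 \<tau> m v)) = integral (half_circle m) f"
  proof -
    have S: "{- a1<..<a1} \<in> sets lebesgue" by simp
    show ?thesis
      using has_absolute_integral_change_of_variables_1'[OF S kK_derivative inj_on_kK, of f "integral (half_circle m) f", unfolded kK_image] int
      by blast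
  qed
  have "(\<lambda>v. \<bar>\<epsilon> * sb a1 / ((1 - v\<^sup>2) * sqrt (a1\<^sup>2 - v\<^sup>2))\<bar> * f (kK a1 \<tau> m v)) absolutely_integrable_on {- a1<..<a1} \<longleftrightarrow>
    set_integrable lebesgue {- a1<..<a1} (\<lambda>v. pi * konno a1 v * f (kK a1 \<tau> m v))"
    by (rule set_integrable_cong) (simp_all only: d)
  with cv show I: "set_integrable lebesgue {- a1<..<a1} (\<lambda>v. pi * konno a1 v * f (kK a1 \<tau> m v))" by simp
  have "integral {- a1<..<a1} (\<lambda>v. pi * konno a1 v * f (kK a1 \<tau> m v)) = integral (half_circle m) f"
  proof -
    have "integral {- a1<..<a1} (\<lambda>v. pi * konno a1 v * f (kK a1 \<tau> m v)) =
      integral {- a1<..<a1} (\<lambda>v. \<bar>\<epsilon> * sb a1 / ((1 - v\<^sup>2) * sqrt (a1\<^sup>2 - v\<^sup>2))\<bar> * f (kK a1 \<tau> m v))"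
      by (rule integral_cong) (simp only: d)
    then show ?thesis using cv by simp
  qed
  then show "(LINT v:{- a1<..<a1}|lebesgue. pi * konno a1 v * f (kK a1 \<tau> m v)) = (LINT x:half_circle m|lebesgue. f x)"
    using set_lebesgue_integral_eq_integral(2)[OF I] set_lebesgue_integral_eq_integral(2)[OF int] by simp
qed

text \<open>Carries the exceptional momenta of Parseval's identity over to velocities: the set in
  question lies in the image of \<open>N\<close> under the differentiable map
  \<open>\<tau> * velK a1\<close>, and such maps send null sets to null sets.\<close>

lemma negligible_kK_vimage:
  assumes N: "negligible (N \<inter> half_circle m)"
  shows "negligible {v \<in> {- a1<..<a1}. kK a1 \<tau> m v \<in> N}"
proof -
  have "{v \<in> {- a1<..<a1}. kK a1 \<tau> m v \<in> N} \<subseteq> (\<lambda>x. \<tau> * velK a1 x) ` (N \<inter> half_circle m)"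
    using kK_in_half velK_kK by force
  moreover have "negligible ((\<lambda>x. \<tau> * velK a1 x) ` (N \<inter> half_circle m))"
  proof (rule negligible_differentiable_image_negligible[OF _ N])
    have "(\<lambda>x. \<tau> * velK a1 x) differentiable (at x within N \<inter> half_circle m)" for x
    proof -
      have "0 < 1 - (a1 * cos x)\<^sup>2" by (rule one_minus_cos_pos[OF a1])
      then show ?thesis unfolding velK_def
        by (intro derivative_intros) (auto intro!: derivative_eq_intros simp: differentiable_def has_field_derivative_def)
    qed
    then show "(\<lambda>x. \<tau> * velK a1 x) differentiable_on (N \<inter> half_circle m)" by (simp add: differentiable_on_def)
  qed simp
  ultimately show ?thesis using negligible_subset by blast
qed

end

subsection \<open>The limit\<close>

text \<open>The two spectral projections add up to the identity. With nonnegativity of each weight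
  this bounds both by the squared norm of the transform, and it fixes the total mass in the
  limit.\<close>

lemma eigen_weight_sum: "eigen_weight s p q w + eigen_weight (- s) p q w = (norm w)\<^sup>2"
proof -
  define t where "t = s * Im p / sqrt (1 - (Re p)\<^sup>2)"
  define r where "r = s * Re (- \<i> * q * cnj (w $ 1) * w $ 2) / sqrt (1 - (Re p)\<^sup>2)"
  have "- s * Im p / sqrt (1 - (Re p)\<^sup>2) = - t" "- s * Re (- \<i> * q * cnj (w $ 1) * w $ 2) / sqrt (1 - (Re p)\<^sup>2) = - r"
    by (simp_all add: t_def r_def)
  then show ?thesis
    unfolding eigen_weight_def norm_vec2_squared t_def[symmetric] r_def[symmetric] by (simp add: field_simps)
qed

lemma abs_mult_le:
  fixes x w :: real
  shows "\<bar>x\<bar> \<le> C \<Longrightarrow> 0 \<le> w \<Longrightarrow> w \<le> N \<Longrightarrow> \<bar>x * w\<bar> \<le> C * N"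
  unfolding abs_mult by (intro mult_mono) auto

lemma eigen_weight_measurable:
  assumes [measurable]: "p \<in> borel_measurable M" "q \<in> borel_measurable M" "w \<in> borel_measurable M"
  shows "(\<lambda>z. eigen_weight s (p z) (q z) (w z)) \<in> borel_measurable M"
proof -
  have n: "(\<lambda>x :: complex ^ 2. x $ i) \<in> borel_measurable borel" for i
    by (intro borel_measurable_continuous_onI continuous_intros)
  have [measurable]: "(\<lambda>z. w z $ i) \<in> borel_measurable M" for i
    using measurable_compose[OF assms(3) n] .
  have [measurable]: "Re \<in> borel_measurable borel" "Im \<in> borel_measurable borel"
    by (intro borel_measurable_continuous_onI continuous_intros)+
  show ?thesis unfolding eigen_weight_def by measurable
qed

context walk_limit
begin

lemma vel_measurable:
  assumes "a1 < a2" "a2 < 1"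
  shows "vel a1 a2 \<in> borel_measurable borel"
proof (rule borel_measurable_continuous_onI)
  have "sqrt (1 - (tau a1 a2 k)\<^sup>2) \<noteq> 0" for k
    using abs_tau_less_1[OF a1(1) assms, of k] by (simp add: abs_square_eq_1)
  then show "continuous_on UNIV (vel a1 a2)"
    unfolding vel_def Let_def tau_def l1_def l2_def by (intro continuous_intros) auto
qed

lemma Up_Uq_measurable [measurable]: "Up a1 a2 \<in> borel_measurable borel" "Uq a1 a2 \<in> borel_measurable borel"
  unfolding Up_def Uq_def l1_def l2_def by (intro borel_measurable_continuous_onI continuous_intros)+

lemma wt_bounds:
  assumes "a1 < a2" "a2 < 1" "\<tau> \<in> {1, - 1}"
  shows "0 \<le> wt a1 a2 \<Psi> \<tau> k" "wt a1 a2 \<Psi> \<tau> k \<le> (norm (fourier2 \<Psi> k))\<^sup>2"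
proof -
  show "0 \<le> wt a1 a2 \<Psi> \<tau> k" by (simp add: wt_def)
  have "wt a1 a2 \<Psi> \<tau> k + wt a1 a2 \<Psi> (- \<tau>) k = (norm (fourier2 \<Psi> k))\<^sup>2"
    using assms a1 eigen_weight_sum by (subst (1 2) wt_eq) auto
  moreover have "0 \<le> wt a1 a2 \<Psi> (- \<tau>) k" by (simp add: wt_def)
  ultimately show "wt a1 a2 \<Psi> \<tau> k \<le> (norm (fourier2 \<Psi> k))\<^sup>2" by linarith
qed

lemma wt_measurable:
  assumes "a1 < a2" "a2 < 1" "\<tau> \<in> {1, - 1}"
  shows "wt a1 a2 \<Psi> \<tau> \<in> borel_measurable borel"
proof -
  have "wt a1 a2 \<Psi> \<tau> = (\<lambda>k. eigen_weight \<tau> (Up a1 a2 k) (Uq a1 a2 k) (fourier2 \<Psi> k))"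
    using wt_eq[OF a1(1) assms(1,2), of \<tau>] assms(3) by auto
  then show ?thesis by (simp add: eigen_weight_measurable)
qed

lemma momentum_periodic:
  assumes "a1 < a2" "a2 < 1" "\<tau> \<in> {1, - 1}"
  shows "vel a1 a2 (k1 + 2 * pi, k2) = vel a1 a2 (k1, k2)" "vel a1 a2 (k1, k2 + 2 * pi) = vel a1 a2 (k1, k2)"
    and "wt a1 a2 \<Psi> \<tau> (k1 + 2 * pi, k2) = wt a1 a2 \<Psi> \<tau> (k1, k2)" "wt a1 a2 \<Psi> \<tau> (k1, k2 + 2 * pi) = wt a1 a2 \<Psi> \<tau> (k1, k2)"
proof -
  have tr: "sin (k2 + (k1 + 2 * pi)) = sin (k2 + k1)" "cos (k2 + (k1 + 2 * pi)) = cos (k2 + k1)"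
    "sin (k2 - (k1 + 2 * pi)) = sin (k2 - k1)" "cos (k2 - (k1 + 2 * pi)) = cos (k2 - k1)"
    "sin (k2 + 2 * pi + k1) = sin (k2 + k1)" "cos (k2 + 2 * pi + k1) = cos (k2 + k1)"
    "sin (k2 + 2 * pi - k1) = sin (k2 - k1)" "cos (k2 + 2 * pi - k1) = cos (k2 - k1)"
    using sin_periodic[of "k2 + k1"] cos_periodic[of "k2 + k1"] sin_periodic[of "k2 - k1"] cos_periodic[of "k2 - k1"]
      sin_periodic[of "k2 - k1 - 2 * pi"] cos_periodic[of "k2 - k1 - 2 * pi"]
    by (simp_all add: algebra_simps)
  show "vel a1 a2 (k1 + 2 * pi, k2) = vel a1 a2 (k1, k2)" "vel a1 a2 (k1, k2 + 2 * pi) = vel a1 a2 (k1, k2)"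
    by (simp_all add: vel_def Let_def tau_def l1_def l2_def tr)
  have c: "cis x = cis y" if "sin x = sin y" "cos x = cos y" for x y using that by (simp add: complex_eq_iff)
  have tc: "cis (k2 + (k1 + 2 * pi)) = cis (k2 + k1)" "cis (k2 - (k1 + 2 * pi)) = cis (k2 - k1)"
    "cis (k2 + 2 * pi + k1) = cis (k2 + k1)" "cis (k2 + 2 * pi - k1) = cis (k2 - k1)"
    by (intro c tr)+
  have "Up a1 a2 (k1 + 2 * pi, k2) = Up a1 a2 (k1, k2)" "Up a1 a2 (k1, k2 + 2 * pi) = Up a1 a2 (k1, k2)"
    "Uq a1 a2 (k1 + 2 * pi, k2) = Uq a1 a2 (k1, k2)" "Uq a1 a2 (k1, k2 + 2 * pi) = Uq a1 a2 (k1, k2)"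
    unfolding Up_def Uq_def l1_def l2_def fst_conv snd_conv tc by simp_all
  then show "wt a1 a2 \<Psi> \<tau> (k1 + 2 * pi, k2) = wt a1 a2 \<Psi> \<tau> (k1, k2)" "wt a1 a2 \<Psi> \<tau> (k1, k2 + 2 * pi) = wt a1 a2 \<Psi> \<tau> (k1, k2)"
    using assms by (simp_all add: wt_eq[OF a1(1)] fourier2_periodic)
qed

text \<open>The factor 2 of \<open>integral_Lboxes\<close> turns \<open>1 / (8 * pi\<^sup>2)\<close>
  into \<open>1 / (4 * pi\<^sup>2)\<close>, the normalisation of a mean over the torus. Sheared
  coordinates are used because they remain suitable in the limit.\<close>

lemma integral_rho_period:
  fixes g :: "real \<times> real \<Rightarrow> real"
  assumes par: "a1 < a2" "a2 < 1" and g [measurable]: "g \<in> borel_measurable borel" and bd: "\<And>v. \<bar>g v\<bar> \<le> C"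
  shows "(LINT v:ellE a1 \<inter> ellE a2|lebesgue. g v * rho a1 a2 \<Psi> v) =
    1 / (4 * pi\<^sup>2) * (\<Sum>\<tau>\<in>{1, - 1}. LINT z|period2. g (\<tau> *\<^sub>R vel a1 a2 (shear z)) * wt a1 a2 \<Psi> \<tau> (shear z))"
proof -
  interpret walk a1 a2 using a1 par by unfold_locales
  define F where "F \<tau> k = g (\<tau> *\<^sub>R vel a1 a2 k) * wt a1 a2 \<Psi> \<tau> k" for \<tau> k
  have C: "C \<ge> 0" using bd[of 0] by linarith
  note [measurable] = vel_measurable[OF par]
  have Fm [measurable]: "F \<tau> \<in> borel_measurable borel" if "\<tau> \<in> {1, - 1}" for \<tau>
  proof -
    note [measurable] = wt_measurable[OF par that]
    show ?thesis unfolding F_def by measurable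
  qed
  have Fp: "F \<tau> (k1 + 2 * pi, k2) = F \<tau> (k1, k2)" "F \<tau> (k1, k2 + 2 * pi) = F \<tau> (k1, k2)" if "\<tau> \<in> {1, - 1}" for \<tau> k1 k2
    unfolding F_def using momentum_periodic[OF par that] by simp_all
  have Fi: "integrable period2 (F \<tau>)" if \<tau>: "\<tau> \<in> {1, - 1}" for \<tau>
  proof (rule Bochner_Integration.integrable_bound)
    have "integrable period2 (\<lambda>k. (norm (fourier2 \<Psi> k))\<^sup>2)"
      by (rule integrableI_bounded) (simp_all add: sq_norm_fourier2[OF summable])
    then show "integrable period2 (\<lambda>k. C * (norm (fourier2 \<Psi> k))\<^sup>2)" by simp
    show "F \<tau> \<in> borel_measurable period2" using Fm[OF \<tau>] by simp
    show "AE k in period2. norm (F \<tau> k) \<le> norm (C * (norm (fourier2 \<Psi> k))\<^sup>2)"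
      unfolding F_def real_norm_def abs_mult[of C] abs_power2 abs_of_nonneg[OF C]
      by (intro AE_I2 abs_mult_le bd wt_bounds par \<tau>)
  qed
  have eq: "g (\<tau> *\<^sub>R V z) * wt a1 a2 \<Psi> \<tau> (momentum z) = F \<tau> (momentum z)" for \<tau> z by (simp add: F_def V_def)
  have "(LINT v:ellE a1 \<inter> ellE a2|lebesgue. g v * rho a1 a2 \<Psi> v) =
    1 / (8 * pi\<^sup>2) * (\<Sum>\<tau>\<in>{1, - 1}. \<Sum>\<mu>\<in>{0, 1}. LINT z:Lboxes \<mu>|lebesgue. F \<tau> (momentum z))"
    unfolding eq[symmetric]
    by (rule integral_rho, unfold eq, rule integrable_Lboxes(1)) (use Fm Fp Fi in blast)+
  also have "(\<Sum>\<tau>\<in>{1, - 1}. \<Sum>\<mu>\<in>{0, 1}. LINT z:Lboxes \<mu>|lebesgue. F \<tau> (momentum z)) = (\<Sum>\<tau>\<in>{1, - 1}. 2 * (LINT z|period2. F \<tau> (shear z)))"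
    by (rule sum.cong[OF refl], rule integral_Lboxes) (use Fm Fp Fi in blast)+
  also have "1 / (8 * pi\<^sup>2) * (\<Sum>\<tau>\<in>{1, - 1}. 2 * (LINT z|period2. F \<tau> (shear z))) =
    1 / (4 * pi\<^sup>2) * (\<Sum>\<tau>\<in>{1, - 1}. LINT z|period2. F \<tau> (shear z))"
    unfolding sum_distrib_left[symmetric] mult.assoc[symmetric] by (rule arg_cong[where f = "\<lambda>c. c * _"]) simp
  finally show ?thesis unfolding F_def .
qed

text \<open>Stated for sequences, as dominated convergence will need it. The bound
  \<open>X i < sb a1\<close> is the condition \<open>a1 < a2\<close> in terms of \<open>b2\<close>.
  Every occurrence of \<open>l2\<close> carries the factor \<open>sb (Y i) = X i\<close> and
  disappears, which makes both velocity components equal.\<close>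

lemma limit_integrand:
  fixes g :: "real \<times> real \<Rightarrow> real"
  assumes g: "continuous_on UNIV g" and X: "\<And>i. 0 < X i" "\<And>i. X i < sb a1" "X \<longlonglongrightarrow> 0" and \<tau>: "\<tau> \<in> {1, - 1}"
  defines "Y \<equiv> \<lambda>i. sqrt (1 - (X i)\<^sup>2)"
  shows "a1 < Y i" "Y i < 1"
    and "(\<lambda>i. g (\<tau> *\<^sub>R vel a1 (Y i) (shear z)) * wt a1 (Y i) \<Psi> \<tau> (shear z)) \<longlonglongrightarrow>
      g (\<tau> * velK a1 (fst z), \<tau> * velK a1 (fst z)) * (cmod (braket (eigvecK a1 \<tau> (fst z)) (fourier2 \<Psi> (shear z))))\<^sup>2"
proof -
  have b: "0 < sb a1" "(sb a1)\<^sup>2 = 1 - a1\<^sup>2" using sb_pos[OF a1] sb_squared[OF a1] by auto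
  have X1: "0 < (X i)\<^sup>2" "(X i)\<^sup>2 < 1 - a1\<^sup>2" for i
    using X(1,2)[of i] power_strict_mono[of "X i" "sb a1" 2] b by auto
  have "(X i)\<^sup>2 \<le> 1" for i using X1(2)[of i] zero_le_power2[of a1] by linarith
  then have Y2: "(Y i)\<^sup>2 = 1 - (X i)\<^sup>2" and Y0: "0 \<le> Y i" for i by (simp_all add: Y_def)
  show Y1: "a1 < Y i" "Y i < 1" for i
  proof -
    have "a1\<^sup>2 < (Y i)\<^sup>2" using X1[of i] unfolding Y2 by simp
    then show "a1 < Y i" using Y0 by (rule power2_less_imp_less)
    have "(Y i)\<^sup>2 < 1\<^sup>2" using X1[of i] unfolding Y2 by simp
    then show "Y i < 1" by (rule power2_less_imp_less) simp
  qed
  have sbY: "sb (Y i) = X i" for i unfolding sb_def Y2 using X(1)[of i] by simp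
  have Yl: "Y \<longlonglongrightarrow> 1"
  proof -
    have "Y \<longlonglongrightarrow> sqrt (1 - 0\<^sup>2)" unfolding Y_def by (intro tendsto_intros X(3))
    then show ?thesis by simp
  qed
  define x where "x = fst z"
  define y where "y = l2 (shear z)"
  have l1: "l1 (shear z) = x" by (simp add: l1_def shear_def x_def)
  have D: "0 < 1 - (a1 * cos x)\<^sup>2" by (rule one_minus_cos_pos[OF a1])
  have tl: "(\<lambda>i. tau a1 (Y i) (shear z)) \<longlonglongrightarrow> a1 * 1 * cos x - sb a1 * 0 * cos y"
    unfolding tau_def l1 y_def[symmetric] sbY by (intro tendsto_intros Yl X(3))
  then have tl: "(\<lambda>i. tau a1 (Y i) (shear z)) \<longlonglongrightarrow> a1 * cos x" by simp
  have sl: "(\<lambda>i. sqrt (1 - (tau a1 (Y i) (shear z))\<^sup>2)) \<longlonglongrightarrow> sqrt (1 - (a1 * cos x)\<^sup>2)"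
    by (intro tendsto_intros tl)
  have v: "(\<lambda>i. vel a1 (Y i) (shear z)) \<longlonglongrightarrow> (velK a1 x, velK a1 x)"
  proof -
    have "(\<lambda>i. vel a1 (Y i) (shear z)) \<longlonglongrightarrow> (- (a1 * 1 * sin x + sb a1 * 0 * sin y) / sqrt (1 - (a1 * cos x)\<^sup>2),
       - (a1 * 1 * sin x - sb a1 * 0 * sin y) / sqrt (1 - (a1 * cos x)\<^sup>2))"
      unfolding vel_def Let_def l1 y_def[symmetric] sbY
      using D by (intro tendsto_intros Yl X(3) sl) auto
    then show ?thesis by (simp add: velK_def)
  qed
  have gl: "(\<lambda>i. g (\<tau> *\<^sub>R vel a1 (Y i) (shear z))) \<longlonglongrightarrow> g (\<tau> *\<^sub>R (velK a1 x, velK a1 x))"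
    by (rule continuous_on_tendsto_compose[OF g tendsto_scaleR[OF tendsto_const v]]) auto
  let ?p = "of_real a1 * cis x" and ?q = "of_real (sb a1) * cis x"
  have pl: "(\<lambda>i. Up a1 (Y i) (shear z)) \<longlonglongrightarrow> ?p"
  proof -
    have "(\<lambda>i. Up a1 (Y i) (shear z)) \<longlonglongrightarrow> of_real (a1 * 1) * cis x - of_real (sb a1 * 0) * cis y"
      unfolding Up_def l1 y_def[symmetric] sbY by (intro tendsto_intros Yl X(3))
    then show ?thesis by simp
  qed
  have ql: "(\<lambda>i. Uq a1 (Y i) (shear z)) \<longlonglongrightarrow> ?q"
  proof -
    have "(\<lambda>i. Uq a1 (Y i) (shear z)) \<longlonglongrightarrow> of_real (sb a1 * 1) * cis x + of_real (a1 * 0) * cis y"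
      unfolding Uq_def l1 y_def[symmetric] sbY by (intro tendsto_intros Yl X(3))
    then show ?thesis by simp
  qed
  have "(\<lambda>i. eigen_weight \<tau> (Up a1 (Y i) (shear z)) (Uq a1 (Y i) (shear z)) (fourier2 \<Psi> (shear z))) \<longlonglongrightarrow>
     eigen_weight \<tau> ?p ?q (fourier2 \<Psi> (shear z))"
    unfolding eigen_weight_def using D by (intro tendsto_intros pl ql) auto
  moreover have "wt a1 (Y i) \<Psi> \<tau> (shear z) = eigen_weight \<tau> (Up a1 (Y i) (shear z)) (Uq a1 (Y i) (shear z)) (fourier2 \<Psi> (shear z))" for i
    using \<tau> by (intro wt_eq a1 Y1) auto
  moreover have "(cmod (braket (eigvecK a1 \<tau> x) (fourier2 \<Psi> (shear z))))\<^sup>2 = eigen_weight \<tau> ?p ?q (fourier2 \<Psi> (shear z))"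
    using \<tau> by (intro wtK_eq a1) auto
  ultimately have wl: "(\<lambda>i. wt a1 (Y i) \<Psi> \<tau> (shear z)) \<longlonglongrightarrow> (cmod (braket (eigvecK a1 \<tau> x) (fourier2 \<Psi> (shear z))))\<^sup>2"
    by simp
  show "(\<lambda>i. g (\<tau> *\<^sub>R vel a1 (Y i) (shear z)) * wt a1 (Y i) \<Psi> \<tau> (shear z)) \<longlonglongrightarrow>
      g (\<tau> * velK a1 (fst z), \<tau> * velK a1 (fst z)) * (cmod (braket (eigvecK a1 \<tau> (fst z)) (fourier2 \<Psi> (shear z))))\<^sup>2"
    using tendsto_mult[OF gl wl] by (simp add: x_def)
qed

lemma velK_measurable [measurable]: "velK a1 \<in> borel_measurable borel"
  by (intro borel_measurable_continuous_onI continuous_on_velK a1)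

lemma tendsto_integral_rho:
  fixes g :: "real \<times> real \<Rightarrow> real"
  assumes g: "continuous_on UNIV g" and bd: "\<And>v. \<bar>g v\<bar> \<le> C"
  shows "((\<lambda>b2. let a2 = sqrt (1 - b2\<^sup>2) in LINT v:ellE a1 \<inter> ellE a2|lebesgue. g v * rho a1 a2 \<Psi> v) \<longlongrightarrow>
     1 / (2 * pi) * (\<Sum>\<tau>\<in>{1, - 1}. LINT x|period. g (\<tau> * velK a1 x, \<tau> * velK a1 x) * qK a1 \<Psi> \<tau> x)) (at_right 0)"
proof -
  have gm [measurable]: "g \<in> borel_measurable borel" using g by (rule borel_measurable_continuous_onI)
  have C: "C \<ge> 0" using bd[of 0] by linarith
  define R where "R b2 = (let a2 = sqrt (1 - b2\<^sup>2) in LINT v:ellE a1 \<inter> ellE a2|lebesgue. g v * rho a1 a2 \<Psi> v)" for b2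
  define L where "L \<tau> z = g (\<tau> * velK a1 (fst z), \<tau> * velK a1 (fst z)) * (cmod (braket (eigvecK a1 \<tau> (fst z)) (fourier2 \<Psi> (shear z))))\<^sup>2" for \<tau> and z :: "real \<times> real"
  have seq: "(\<lambda>i. R (X i)) \<longlonglongrightarrow> 1 / (4 * pi\<^sup>2) * (\<Sum>\<tau>\<in>{1, - 1}. LINT z|period2. L \<tau> z)"
    if X: "\<And>i. 0 < X i" "\<And>i. X i < sb a1" "X \<longlonglongrightarrow> 0" for X
  proof -
    define Y where "Y i = sqrt (1 - (X i)\<^sup>2)" for i
    have Y: "a1 < Y i" "Y i < 1" for i unfolding Y_def by (rule limit_integrand(1,2)[OF g X, of 1]; simp)+
    have dc: "(\<lambda>i. LINT z|period2. g (\<tau> *\<^sub>R vel a1 (Y i) (shear z)) * wt a1 (Y i) \<Psi> \<tau> (shear z)) \<longlonglongrightarrow> (LINT z|period2. L \<tau> z)"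
      if \<tau>: "\<tau> \<in> {1, - 1}" for \<tau>
    proof (rule integral_dominated_convergence)
      show "L \<tau> \<in> borel_measurable period2" unfolding L_def by measurable
      show "(\<lambda>z. g (\<tau> *\<^sub>R vel a1 (Y i) (shear z)) * wt a1 (Y i) \<Psi> \<tau> (shear z)) \<in> borel_measurable period2" for i
      proof -
        note [measurable] = vel_measurable[OF Y] wt_measurable[OF Y \<tau>]
        show ?thesis by measurable
      qed
      \<comment> \<open>The dominating function contains neither \<open>i\<close> nor the parameter
        \<open>a2\<close>.\<close>
      show "integrable period2 (\<lambda>z. C * (norm (fourier2 \<Psi> (shear z)))\<^sup>2)"
        using integrable_norm_fourier2_shear by (rule integrable_mult_right)
      show "AE z in period2. (\<lambda>i. g (\<tau> *\<^sub>R vel a1 (Y i) (shear z)) * wt a1 (Y i) \<Psi> \<tau> (shear z)) \<longlonglongrightarrow> L \<tau> z"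
        unfolding L_def Y_def by (intro AE_I2 limit_integrand(3) g X \<tau>)
      show "AE z in period2. norm (g (\<tau> *\<^sub>R vel a1 (Y i) (shear z)) * wt a1 (Y i) \<Psi> \<tau> (shear z)) \<le> C * (norm (fourier2 \<Psi> (shear z)))\<^sup>2" for i
        unfolding real_norm_def by (intro AE_I2 abs_mult_le bd wt_bounds Y \<tau>)
    qed
    have "R (X i) = 1 / (4 * pi\<^sup>2) * (\<Sum>\<tau>\<in>{1, - 1}. LINT z|period2. g (\<tau> *\<^sub>R vel a1 (Y i) (shear z)) * wt a1 (Y i) \<Psi> \<tau> (shear z))" for i
      unfolding R_def Let_def Y_def[symmetric] by (rule integral_rho_period[OF Y gm bd])
    then show ?thesis by (simp only:) (intro tendsto_mult_left tendsto_sum dc)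
  qed
  have "(R \<longlongrightarrow> 1 / (4 * pi\<^sup>2) * (\<Sum>\<tau>\<in>{1, - 1}. LINT z|period2. L \<tau> z)) (at 0 within {0<..})"
    unfolding tendsto_at_iff_sequentially
  proof (intro allI impI)
    fix X :: "nat \<Rightarrow> real" assume X: "\<forall>i. X i \<in> {0<..} - {0}" "X \<longlonglongrightarrow> 0"
    \<comment> \<open>A sequence tending to 0 enters the admissible parameter range only eventually,
      so an initial segment is cut off.\<close>
    have "eventually (\<lambda>i. X i < sb a1) sequentially" using order_tendstoD(2)[OF X(2) sb_pos[OF a1]] .
    then obtain N where N: "\<And>i. i \<ge> N \<Longrightarrow> X i < sb a1" by (auto simp: eventually_sequentially)
    have "(\<lambda>i. R (X (i + N))) \<longlonglongrightarrow> 1 / (4 * pi\<^sup>2) * (\<Sum>\<tau>\<in>{1, - 1}. LINT z|period2. L \<tau> z)"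
      by (rule seq) (use X N LIMSEQ_ignore_initial_segment[OF X(2)] in auto)
    then show "(R \<circ> X) \<longlonglongrightarrow> 1 / (4 * pi\<^sup>2) * (\<Sum>\<tau>\<in>{1, - 1}. LINT z|period2. L \<tau> z)"
      unfolding o_def by (rule LIMSEQ_offset)
  qed
  moreover have "1 / (4 * pi\<^sup>2) * (\<Sum>\<tau>\<in>{1, - 1}. LINT z|period2. L \<tau> z) =
     1 / (2 * pi) * (\<Sum>\<tau>\<in>{1, - 1}. LINT x|period. g (\<tau> * velK a1 x, \<tau> * velK a1 x) * qK a1 \<Psi> \<tau> x)"
  proof -
    have "(LINT z|period2. L \<tau> z) = 2 * pi * (LINT x|period. g (\<tau> * velK a1 x, \<tau> * velK a1 x) * qK a1 \<Psi> \<tau> x)" if "\<tau> \<in> {1, - 1}" for \<tau>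
      unfolding L_def by (rule integral_braket_eigvecK(2)[OF _ bd that]) measurable
    then have "(\<Sum>\<tau>\<in>{1, - 1}. LINT z|period2. L \<tau> z) = (\<Sum>\<tau>\<in>{1, - 1}. 2 * pi * (LINT x|period. g (\<tau> * velK a1 x, \<tau> * velK a1 x) * qK a1 \<Psi> \<tau> x))"
      by (rule sum.cong[OF refl])
    then show ?thesis unfolding sum_distrib_left[symmetric]
      by (simp only: mult.assoc[symmetric]) (rule arg_cong[where f = "\<lambda>c. c * _"], simp add: power2_eq_square)
  qed
  ultimately show ?thesis unfolding R_def by simp
qed

text \<open>The limiting density with the fibre mean \<open>qK\<close> in place of the sum over
  diagonals. The substitution computes its integrals directly; the comparison with \<open>w1\<close>
  is needed only almost everywhere.\<close>

definition density1 :: "real \<Rightarrow> real" where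
  "density1 v = (1 / 2) * (\<Sum>\<tau>\<in>{1, - 1}. \<Sum>m\<in>{0, 1}. qK a1 \<Psi> \<tau> (kK a1 \<tau> m v)) * konno a1 v"

lemma integral_density1:
  fixes G :: "real \<Rightarrow> real"
  assumes G [measurable]: "G \<in> borel_measurable borel" and bd: "\<And>v. \<bar>G v\<bar> \<le> C"
  shows "set_integrable lebesgue {- a1<..<a1} (\<lambda>v. G v * density1 v)"
    and "(LINT v:{- a1<..<a1}|lebesgue. G v * density1 v) =
      1 / (2 * pi) * (\<Sum>\<tau>\<in>{1, - 1}. LINT x|period. G (\<tau> * velK a1 x) * qK a1 \<Psi> \<tau> x)"
proof -
  define f where "f \<tau> x = G (\<tau> * velK a1 x) * qK a1 \<Psi> \<tau> x" for \<tau> x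
  define T where "T \<tau> m v = pi * konno a1 v * f \<tau> (kK a1 \<tau> m v)" for \<tau> m v
  have fm [measurable]: "f \<tau> \<in> borel_measurable borel" for \<tau> unfolding f_def by measurable
  have fp: "f \<tau> (x + 2 * pi) = f \<tau> x" for \<tau> x by (simp add: f_def velK_periodic qK_periodic)
  have fi: "integrable period (f \<tau>)" if "\<tau> \<in> {1, - 1}" for \<tau>
    unfolding f_def by (rule integral_braket_eigvecK(1)[OF _ bd that]) measurable
  have sub: "set_integrable lebesgue {- a1<..<a1} (T \<tau> m)" "(LINT v:{- a1<..<a1}|lebesgue. T \<tau> m v) = (LINT x:half_circle m|lebesgue. f \<tau> x)"
    if \<tau>: "\<tau> \<in> {1, - 1}" and m: "m \<in> {0, 1}" for \<tau> m
  proof -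
    interpret konno_param a1 \<tau> m using a1 \<tau> by unfold_locales
    show "set_integrable lebesgue {- a1<..<a1} (T \<tau> m)" "(LINT v:{- a1<..<a1}|lebesgue. T \<tau> m v) = (LINT x:half_circle m|lebesgue. f \<tau> x)"
      unfolding T_def using konno_substitution[OF integral_period_halves(1)[OF fm fp fi[OF \<tau>] m]] by simp_all
  qed
  have T: "T \<tau> m v = pi * konno a1 v * (G v * qK a1 \<Psi> \<tau> (kK a1 \<tau> m v))"
    if \<tau>: "\<tau> \<in> {1, - 1}" and v: "v \<in> {- a1<..<a1}" for \<tau> m v
  proof -
    interpret konno_param a1 \<tau> m using a1 \<tau> by unfold_locales
    show ?thesis unfolding T_def f_def velK_kK[OF v] ..
  qed
  have eq: "G v * density1 v = (\<Sum>\<tau>\<in>{1, - 1}. \<Sum>m\<in>{0, 1}. 1 / (2 * pi) * T \<tau> m v)" if v: "v \<in> {- a1<..<a1}" for v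
    by (simp add: T[OF _ v] density1_def field_simps)
  have I: "set_integrable lebesgue {- a1<..<a1} (\<lambda>v. 1 / (2 * pi) * T \<tau> m v)" if "\<tau> \<in> {1, - 1}" "m \<in> {0, 1}" for \<tau> m
    using sub(1)[OF that] by (rule set_integrable_mult_right)
  have "set_integrable lebesgue {- a1<..<a1} (\<lambda>v. \<Sum>\<tau>\<in>{1, - 1}. \<Sum>m\<in>{0, 1}. 1 / (2 * pi) * T \<tau> m v)"
    using I unfolding set_integrable_def scaleR_sum_right by (intro Bochner_Integration.integrable_sum) blast
  then show "set_integrable lebesgue {- a1<..<a1} (\<lambda>v. G v * density1 v)"
    by (subst set_integrable_cong[OF refl refl eq]) auto
  have "(LINT v:{- a1<..<a1}|lebesgue. G v * density1 v) = (LINT v:{- a1<..<a1}|lebesgue. (\<Sum>\<tau>\<in>{1, - 1}. \<Sum>m\<in>{0, 1}. 1 / (2 * pi) * T \<tau> m v))"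
    by (rule set_lebesgue_integral_cong) (use eq in auto)
  also have "\<dots> = (\<Sum>\<tau>\<in>{1, - 1}. \<Sum>m\<in>{0, 1}. LINT v:{- a1<..<a1}|lebesgue. 1 / (2 * pi) * T \<tau> m v)"
  proof -
    define u where "u \<tau> m v = indicator {- a1<..<a1} v *\<^sub>R (1 / (2 * pi) * T \<tau> m v)" for \<tau> m v
    have i2: "integrable lebesgue (u \<tau> m)" if "\<tau> \<in> {1, - 1}" "m \<in> {0, 1}" for \<tau> m
      using I[OF that] unfolding set_integrable_def u_def .
    have i1: "integrable lebesgue (\<lambda>v. \<Sum>m\<in>{0, 1}. u \<tau> m v)" if "\<tau> \<in> {1, - 1}" for \<tau>
      by (rule Bochner_Integration.integrable_sum) (rule i2[OF that])
    have "(LINT v|lebesgue. (\<Sum>\<tau>\<in>{1, - 1}. \<Sum>m\<in>{0, 1}. u \<tau> m v)) = (\<Sum>\<tau>\<in>{1, - 1}. LINT v|lebesgue. (\<Sum>m\<in>{0, 1}. u \<tau> m v))"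
      by (rule Bochner_Integration.integral_sum) (rule i1)
    also have "\<dots> = (\<Sum>\<tau>\<in>{1, - 1}. \<Sum>m\<in>{0, 1}. LINT v|lebesgue. u \<tau> m v)"
      by (rule sum.cong[OF refl], rule Bochner_Integration.integral_sum) (rule i2)
    finally show ?thesis unfolding u_def set_lebesgue_integral_def scaleR_sum_right .
  qed
  also have "\<dots> = (\<Sum>\<tau>\<in>{1, - 1}. \<Sum>m\<in>{0, 1}. 1 / (2 * pi) * (LINT x:half_circle m|lebesgue. f \<tau> x))"
    by (intro sum.cong refl) (subst set_integral_mult_right, subst sub, auto)
  also have "\<dots> = 1 / (2 * pi) * (\<Sum>\<tau>\<in>{1, - 1}. \<Sum>m\<in>{0, 1}. LINT x:half_circle m|lebesgue. f \<tau> x)"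
    by (simp only: sum_distrib_left)
  also have "(\<Sum>\<tau>\<in>{1, - 1}. \<Sum>m\<in>{0, 1}. LINT x:half_circle m|lebesgue. f \<tau> x) = (\<Sum>\<tau>\<in>{1, - 1}. LINT x|period. f \<tau> x)"
    by (rule sum.cong[OF refl], rule integral_period_halves(2)[symmetric, OF fm fp fi])
  finally show "(LINT v:{- a1<..<a1}|lebesgue. G v * density1 v) =
      1 / (2 * pi) * (\<Sum>\<tau>\<in>{1, - 1}. LINT x|period. G (\<tau> * velK a1 x) * qK a1 \<Psi> \<tau> x)" unfolding f_def .
qed

lemma negligible_not_has_sum:
  assumes \<tau>: "\<tau> \<in> {1, - 1}" and m: "m \<in> {0, 1}"
  shows "negligible ({x. \<not> ((\<lambda>n. wtK a1 \<Psi> n \<tau> x) has_sum qK a1 \<Psi> \<tau> x) UNIV} \<inter> half_circle m)"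
proof -
  define P where "P x \<longleftrightarrow> ((\<lambda>n. wtK a1 \<Psi> n \<tau> x) has_sum qK a1 \<Psi> \<tau> x) UNIV" for x
  have "AE x in lborel. 0 < (indicator {- pi..pi} x :: ennreal) \<longrightarrow> P x"
    using AE_wtK_has_sum[OF \<tau>] unfolding P_def by (subst (asm) AE_density) auto
  then have "AE x in lborel. x \<in> {- pi..pi} \<longrightarrow> P x" by eventually_elim (auto simp: indicator_def)
  then obtain M where M: "{x \<in> space lborel. \<not> (x \<in> {- pi..pi} \<longrightarrow> P x)} \<subseteq> M" "emeasure lborel M = 0" "M \<in> sets lborel"
    by (rule AE_E)
  then have "M \<in> null_sets lebesgue" by (intro null_sets_completionI) (auto simp: null_sets_def)
  then have "negligible M" by (simp add: negligible_iff_null_sets)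
  then have N: "negligible {x. \<not> (x \<in> {- pi..pi} \<longrightarrow> P x)}"
    by (rule negligible_subset) (use M(1) in simp)
  have P2: "P (x + 2 * pi) \<longleftrightarrow> P x" for x by (simp add: P_def wtK_periodic qK_periodic)
  \<comment> \<open>The almost-everywhere statement concerns one period, but the second arc extends
    beyond \<open>pi\<close>; that piece is moved back by \<open>2 * pi\<close>.\<close>
  have "{x. \<not> P x} \<inter> half_circle m \<subseteq> {x. \<not> (x \<in> {- pi..pi} \<longrightarrow> P x)} \<union> (+) (2 * pi) ` {x. \<not> (x \<in> {- pi..pi} \<longrightarrow> P x)}"
  proof
    fix x assume x: "x \<in> {x. \<not> P x} \<inter> half_circle m"
    show "x \<in> {x. \<not> (x \<in> {- pi..pi} \<longrightarrow> P x)} \<union> (+) (2 * pi) ` {x. \<not> (x \<in> {- pi..pi} \<longrightarrow> P x)}"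
    proof (cases "x \<le> pi")
      case True
      then show ?thesis using x m by (auto simp: half_circle_def)
    next
      case False
      then have "x - 2 * pi \<in> {x. \<not> (x \<in> {- pi..pi} \<longrightarrow> P x)}" using x m P2[of "x - 2 * pi"] by (auto simp: half_circle_def)
      moreover have "x = 2 * pi + (x - 2 * pi)" by simp
      ultimately show ?thesis by blast
    qed
  qed
  then show ?thesis unfolding P_def[symmetric]
    by (rule negligible_subset[OF negligible_Un[OF N negligible_translation[OF N]]])
qed

text \<open>Outside the open interval both functions vanish with \<open>konno\<close>. Inside, they
  can differ only where one of the four momenta \<open>kK\<close> of the velocity is exceptional for
  Parseval's identity.\<close>

lemma negligible_w1_neq:
  "negligible {v. w1 a1 \<Psi> v * konno a1 v \<noteq> density1 v}"
proof -
  define Nx where "Nx \<tau> = {x. \<not> ((\<lambda>n. wtK a1 \<Psi> n \<tau> x) has_sum qK a1 \<Psi> \<tau> x) UNIV}" for \<tau>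
  define Z where "Z \<tau> m = {v \<in> {- a1<..<a1}. kK a1 \<tau> m v \<in> Nx \<tau>}" for \<tau> m
  have Z: "negligible (Z \<tau> m)" if \<tau>: "\<tau> \<in> {1, - 1}" and m: "m \<in> {0, 1}" for \<tau> m
  proof -
    interpret konno_param a1 \<tau> m using a1 \<tau> by unfold_locales
    show ?thesis unfolding Z_def by (rule negligible_kK_vimage) (unfold Nx_def, rule negligible_not_has_sum[OF \<tau> m])
  qed
  have "{v. w1 a1 \<Psi> v * konno a1 v \<noteq> density1 v} \<subseteq> Z 1 0 \<union> Z 1 1 \<union> Z (- 1) 0 \<union> Z (- 1) 1"
  proof
    fix v assume v: "v \<in> {v. w1 a1 \<Psi> v * konno a1 v \<noteq> density1 v}"
    have vi: "v \<in> {- a1<..<a1}"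
    proof (rule ccontr)
      assume "v \<notin> {- a1<..<a1}"
      then have "konno a1 v = 0" by (simp add: konno_def indicator_def)
      then show False using v by (simp add: density1_def)
    qed
    show "v \<in> Z 1 0 \<union> Z 1 1 \<union> Z (- 1) 0 \<union> Z (- 1) 1"
    proof (rule ccontr)
      assume "v \<notin> Z 1 0 \<union> Z 1 1 \<union> Z (- 1) 0 \<union> Z (- 1) 1"
      then have hs: "((\<lambda>n. wtK a1 \<Psi> n \<tau> (kK a1 \<tau> m v)) has_sum qK a1 \<Psi> \<tau> (kK a1 \<tau> m v)) UNIV" if "\<tau> \<in> {1, - 1}" "m \<in> {0, 1}" for \<tau> m
        using that vi by (auto simp: Z_def Nx_def)
      have "((\<lambda>n. \<Sum>\<tau>\<in>{1, - 1}. \<Sum>m\<in>{0, 1}. wtK a1 \<Psi> n \<tau> (kK a1 \<tau> m v)) has_sum (\<Sum>\<tau>\<in>{1, - 1}. \<Sum>m\<in>{0, 1}. qK a1 \<Psi> \<tau> (kK a1 \<tau> m v))) UNIV"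
        using hs by (simp add: has_sum_add)
      then have "w1 a1 \<Psi> v = (1 / 2) * (\<Sum>\<tau>\<in>{1, - 1}. \<Sum>m\<in>{0, 1}. qK a1 \<Psi> \<tau> (kK a1 \<tau> m v))"
        unfolding w1_def by (simp only: infsumI)
      then show False using v by (simp add: density1_def)
    qed
  qed
  then show ?thesis by (rule negligible_subset[rotated]) (intro negligible_Un Z; simp)
qed

end

section \<open>The limiting density: sign, integrals and total mass\<close>

context walk_limit
begin

lemma w1_nonneg: "0 \<le> w1 a1 \<Psi> v"
  unfolding w1_def by (intro mult_nonneg_nonneg infsum_nonneg sum_nonneg) (simp_all add: wtK_def)

lemma konno_nonneg: "0 \<le> konno a1 v"
proof (cases "v \<in> {- a1<..<a1}")
  case True
  then interpret konno_param a1 1 0 using a1 by unfold_locales auto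
  show ?thesis using v_bounds[OF True] a1 by (simp add: konno_def power_le_one)
next
  case False
  then show ?thesis by (simp add: konno_def)
qed

text \<open>The set \<open>S\<close> is left free because the closed interval is needed for the
  limit and the whole line for the total mass; outside the open interval the integrand is 0 up to a
  null set.\<close>

lemma integral_w1_konno:
  fixes G :: "real \<Rightarrow> real"
  assumes G: "G \<in> borel_measurable borel" and bd: "\<And>v. \<bar>G v\<bar> \<le> C" and S: "{- a1<..<a1} \<subseteq> S"
  shows "set_integrable lebesgue S (\<lambda>v. G v * (w1 a1 \<Psi> v * konno a1 v))"
    and "(LINT v:S|lebesgue. G v * (w1 a1 \<Psi> v * konno a1 v)) =
      1 / (2 * pi) * (\<Sum>\<tau>\<in>{1, - 1}. LINT x|period. G (\<tau> * velK a1 x) * qK a1 \<Psi> \<tau> x)"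
proof -
  let ?f = "\<lambda>v. G v * density1 v" and ?h = "\<lambda>v. G v * (w1 a1 \<Psi> v * konno a1 v)"
  have I: "?f absolutely_integrable_on {- a1<..<a1}" by (rule integral_density1(1)[OF G bd])
  have 0: "density1 v = 0" if "v \<notin> {- a1<..<a1}" for v
    using that by (simp add: density1_def konno_def indicator_def)
  have n: "negligible {v \<in> {- a1<..<a1} - S. ?f v \<noteq> 0}" "negligible {v \<in> S - {- a1<..<a1}. ?f v \<noteq> 0}"
    using S 0 by (auto simp: Diff_eq_empty_iff[THEN iffD2] intro: negligible_subset[OF negligible_empty])
  have IS: "?f absolutely_integrable_on S" by (rule absolutely_integrable_spike_set[OF I n])
  have eq: "?h v = ?f v" if "v \<in> S - {v. w1 a1 \<Psi> v * konno a1 v \<noteq> density1 v}" for v using that by simp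
  show H: "set_integrable lebesgue S ?h"
    by (rule absolutely_integrable_spike[OF IS negligible_w1_neq eq])
  have "integral S ?h = integral S ?f" by (rule integral_spike[OF negligible_w1_neq]) (simp add: eq)
  also have "\<dots> = integral {- a1<..<a1} ?f" by (rule integral_spike_set[OF n(2,1)])
  finally have "(LINT v:S|lebesgue. ?h v) = (LINT v:{- a1<..<a1}|lebesgue. ?f v)"
    using set_lebesgue_integral_eq_integral(2)[OF H] set_lebesgue_integral_eq_integral(2)[OF I] by simp
  then show "(LINT v:S|lebesgue. ?h v) =
      1 / (2 * pi) * (\<Sum>\<tau>\<in>{1, - 1}. LINT x|period. G (\<tau> * velK a1 x) * qK a1 \<Psi> \<tau> x)"
    using integral_density1(2)[OF G bd] by simp
qed

text \<open>The two weights add up to the squared norm of the transform, and Parseval's identity on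
  the torus turns its integral into the squared norm of the state.\<close>

lemma integral_qK_sum: "(\<Sum>\<tau>\<in>{1, - 1}. LINT x|period. qK a1 \<Psi> \<tau> x) = 2 * pi * (\<Sum>\<^sub>\<infinity>x. (norm (\<Psi> x))\<^sup>2)"
proof -
  let ?w = "\<lambda>\<tau> z. (cmod (braket (eigvecK a1 \<tau> (fst z)) (fourier2 \<Psi> (shear z))))\<^sup>2"
  have q: "(LINT z|period2. ?w \<tau> z) = 2 * pi * (LINT x|period. qK a1 \<Psi> \<tau> x)" if "\<tau> \<in> {1, - 1}" for \<tau>
    using integral_braket_eigvecK(2)[of "\<lambda>_. 1" 1 \<tau>] that by simp
  have I: "integrable period2 (?w \<tau>)" if "\<tau> \<in> {1, - 1}" for \<tau>
  proof (rule Bochner_Integration.integrable_bound[OF integrable_norm_fourier2_shear])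
    show "?w \<tau> \<in> borel_measurable period2" by measurable
    show "AE z in period2. norm (?w \<tau> z) \<le> norm ((norm (fourier2 \<Psi> (shear z)))\<^sup>2)"
      using braket_eigvecK_le[OF that] by simp
  qed
  have s: "?w 1 z + ?w (- 1) z = (norm (fourier2 \<Psi> (shear z)))\<^sup>2" for z
    by (simp add: wtK_eq[OF a1] eigen_weight_sum)
  have "2 * pi * (\<Sum>\<tau>\<in>{1, - 1}. LINT x|period. qK a1 \<Psi> \<tau> x) = (LINT z|period2. ?w 1 z) + (LINT z|period2. ?w (- 1) z)"
    using q[of 1] q[of "- 1"] by (simp add: distrib_left)
  also have "\<dots> = (LINT z|period2. ?w 1 z + ?w (- 1) z)"
    by (rule Bochner_Integration.integral_add[symmetric]) (simp_all add: I)
  also have "\<dots> = enn2real (sq_norm period2 (\<lambda>z. fourier2 \<Psi> (shear z)))"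
    unfolding s by (rule integral_eq_nn_integral) simp_all
  also have "\<dots> = (2 * pi)\<^sup>2 * (\<Sum>\<^sub>\<infinity>x. (norm (\<Psi> x))\<^sup>2)"
    unfolding nn_integral_norm_fourier2_shear by (simp add: infsum_nonneg)
  finally show ?thesis by (simp add: power2_eq_square)
qed

lemma prob_density_w1_konno:
  assumes 1: "(\<Sum>\<^sub>\<infinity>x. (norm (\<Psi> x))\<^sup>2) = 1"
  shows "prob_density (\<lambda>v. w1 a1 \<Psi> v * konno a1 v)"
proof -
  let ?f = "\<lambda>v. w1 a1 \<Psi> v * konno a1 v"
  have I: "integrable lebesgue ?f"
    using integral_w1_konno(1)[of "\<lambda>_. 1" 1 UNIV] by (simp add: set_integrable_def)
  have "(LINT v|lebesgue. ?f v) = 1"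
    using integral_w1_konno(2)[of "\<lambda>_. 1" 1 UNIV] integral_qK_sum 1 by (simp add: set_lebesgue_integral_def)
  moreover have nn: "0 \<le> ?f v" for v using w1_nonneg konno_nonneg by simp
  ultimately have "(\<integral>\<^sup>+ v. ennreal (?f v) \<partial>lebesgue) = 1"
    using nn_integral_eq_integral[OF I] by simp
  then show ?thesis unfolding prob_density_def using I nn by auto
qed

end

theorem theorem7:
  fixes a1 :: real and \<Psi>0 :: "int \<times> int \<Rightarrow> complex ^ 2"
  assumes "0 < a1" and "a1 < 1"
    and "((\<lambda>x. (norm (\<Psi>0 x))\<^sup>2) has_sum 1) UNIV"
  shows "prob_density (\<lambda>v. w1 a1 \<Psi>0 v * konno a1 v) \<and>
    (\<forall>g :: real \<times> real \<Rightarrow> real. continuous_on UNIV g \<longrightarrow> bounded (range g) \<longrightarrow>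
      ((\<lambda>b2. let a2 = sqrt (1 - b2\<^sup>2) in
          LINT v : ellE a1 \<inter> ellE a2 | lebesgue. g v * rho a1 a2 \<Psi>0 v)
        \<longlongrightarrow> (LINT v : {- a1..a1} | lebesgue. g (v, v) * (w1 a1 \<Psi>0 v * konno a1 v)))
      (at_right 0))"
proof (intro conjI allI impI)
  interpret walk_limit a1 \<Psi>0
    using assms by unfold_locales (auto simp: has_sum_imp_summable)
  show "prob_density (\<lambda>v. w1 a1 \<Psi>0 v * konno a1 v)"
    by (rule prob_density_w1_konno[OF infsumI[OF assms(3)]])
  fix g :: "real \<times> real \<Rightarrow> real"
  assume g: "continuous_on UNIV g" and b: "bounded (range g)"
  obtain C where C: "\<And>v. \<bar>g v\<bar> \<le> C" using b by (auto simp: bounded_iff)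
  have "continuous_on UNIV (\<lambda>v. g (v, v))"
    by (rule continuous_on_compose2[OF g]) (auto intro!: continuous_intros)
  then have G: "(\<lambda>v. g (v, v)) \<in> borel_measurable borel" by (rule borel_measurable_continuous_onI)
  \<comment> \<open>The substitution brings the claimed limit to the same integral over the circle
    as the limit found on the momentum side.\<close>
  have "(LINT v:{- a1..a1}|lebesgue. g (v, v) * (w1 a1 \<Psi>0 v * konno a1 v)) =
      1 / (2 * pi) * (\<Sum>\<tau>\<in>{1, - 1}. LINT x|period. g (\<tau> * velK a1 x, \<tau> * velK a1 x) * qK a1 \<Psi>0 \<tau> x)"
    by (rule integral_w1_konno(2)[OF G C]) auto
  then show "((\<lambda>b2. let a2 = sqrt (1 - b2\<^sup>2) in LINT v : ellE a1 \<inter> ellE a2 | lebesgue. g v * rho a1 a2 \<Psi>0 v)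
        \<longlongrightarrow> (LINT v : {- a1..a1} | lebesgue. g (v, v) * (w1 a1 \<Psi>0 v * konno a1 v))) (at_right 0)"
    using tendsto_integral_rho[OF g C] by simp
qed

end
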